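(* For all $t>a_\vartheta$ we have $$-\tfrac12+\mathrm{RH}(t)<S(t)+\tfrac1\pi E(t)\le\tfrac12+\mathrm{RH}(t).$$
   Context: $\zeta$ is Riemann's zeta function; $\vartheta\colon\mathbf{R}\to\mathbf{R}$ is the Riemann–Siegel theta function, i.e. the real analytic function with $\vartheta(0)=0$ and $\Gamma(\frac14+\frac{it}{2})=|\Gamma(\frac14+\frac{it}{2})|\,e^{i(\vartheta(t)+\frac t2\log\pi)}$; $a_\vartheta=6.28983\ldots$ is the unique positive zero of $\vartheta'$. $N(t)$ is the number of zeros $\beta+i\gamma$ of $\zeta$ with $0<\gamma\le t$ counted with multiplicity, $N_{00}(t)$ is the number of real $\xi$ with $0<\xi\le t$ and $\zeta(\frac12+i\xi)=0$, counted without multiplicity, and $\mathrm{RH}(t):=N(t)-N_{00}(t)$. $S(t)=\pi^{-1}\arg\zeta(\frac12+it)$, the argument being obtained by continuous variation along the straight lines joining $2$, $2+it$, $\frac12+it$ starting with value $0$; if $t$ is the ordinate of a zero, $S(t)=S(t+0)$. It satisfies $S(t)=N(t)-1-\frac1\pi\vartheta(t)$. $E(t):=\pi+2\vartheta(t)+\operatorname{ph}\zeta'(\frac12+it)$, where $\operatorname{ph}\zeta'(\frac12+it)$ is the real analytic function of $t\in\mathbf{R}$ with value $\pi$ at $t=0$ such that $\zeta'(\frac12+it)=\rho(t)e^{i\operatorname{ph}\zeta'(\frac12+it)}$ for some real-valued real analytic function $\rho$ on $\mathbf{R}$; in particular $E(0)=2\pi$. *)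

theory Defs
  imports "HOL-Complex_Analysis.Complex_Analysis"
begin

text \<open>
  The analytic continuation of the Dirichlet series to the plane punctured at 1, which is unique
  because the punctured plane is connected; at the pole the value is set to 0 so that the
  description determines a total function.
\<close>
definition zeta :: "complex \<Rightarrow> complex" where
  "zeta = (THE f. f holomorphic_on - {1}
                \<and> (\<forall>s. Re s > 1 \<longrightarrow> (\<lambda>n. of_nat (Suc n) powr (- s)) sums f s)
                \<and> f 1 = 0)"

definition real_analytic :: "(real \<Rightarrow> real) \<Rightarrow> bool" where
  "real_analytic f \<longleftrightarrow>
     (\<forall>x. \<exists>r>0. \<exists>a :: nat \<Rightarrow> real. \<forall>y. \<bar>y - x\<bar> < r \<longrightarrow> (\<lambda>n. a n * (y - x) ^ n) sums f y)"

definition rs_theta :: "real \<Rightarrow> real" where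
  "rs_theta = (THE \<theta>. real_analytic \<theta> \<and> \<theta> 0 = 0
     \<and> (\<forall>t. Gamma (Complex (1/4) (t/2)) =
             of_real (cmod (Gamma (Complex (1/4) (t/2)))) * cis (\<theta> t + t / 2 * ln pi)))"

definition a_theta :: real where
  "a_theta = (THE a. a > 0 \<and> deriv rs_theta a = 0)"

definition zero_count :: "real \<Rightarrow> int" where
  "zero_count t = (\<Sum>s | zeta s = 0 \<and> 0 < Im s \<and> Im s \<le> t. zorder zeta s)"

definition critical_zero_count :: "real \<Rightarrow> nat" where
  "critical_zero_count t = card {\<xi>. 0 < \<xi> \<and> \<xi> \<le> t \<and> zeta (Complex (1/2) \<xi>) = 0}"

definition RH :: "real \<Rightarrow> int" where
  "RH t = zero_count t - int (critical_zero_count t)"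

text \<open>
  The final value of the continuous argument along \<open>p\<close>, parametrised by the unit interval, that
  starts with the value 0; it is uniquely determined if \<open>p\<close> is continuous, avoids 0 and starts on
  the positive real axis.
\<close>
definition arg_along :: "(real \<Rightarrow> complex) \<Rightarrow> real" where
  "arg_along p = (THE \<alpha>. \<exists>g. continuous_on {0..1} g \<and> g 0 = 0 \<and> g 1 = \<alpha>
     \<and> (\<forall>x\<in>{0..1}. p x = of_real (cmod (p x)) * cis (g x)))"

text \<open>The value of \<open>S\<close> for \<open>t\<close> that are not ordinates of zeros of \<open>zeta\<close>:\<close>
definition S_generic :: "real \<Rightarrow> real" where
  "S_generic t = arg_along (zeta \<circ> (linepath 2 (Complex 2 t) +++
                                    linepath (Complex 2 t) (Complex (1/2) t))) / pi"

definition S :: "real \<Rightarrow> real" where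
  "S t = (if \<exists>s. zeta s = 0 \<and> Im s = t then Lim (at_right t) S_generic else S_generic t)"

text \<open>
  The factor \<open>\<rho>\<close> may change sign, so that the phase stays analytic through zeros of the
  derivative on the critical line.
\<close>
definition ph_zeta' :: "real \<Rightarrow> real" where
  "ph_zeta' = (THE h. real_analytic h \<and> h 0 = pi
     \<and> (\<exists>\<rho>. real_analytic \<rho> \<and> (\<forall>t. deriv zeta (Complex (1/2) t) = of_real (\<rho> t) * cis (h t))))"

definition E :: "real \<Rightarrow> real" where
  "E t = pi + 2 * rs_theta t + ph_zeta' t"

end

theory Submission
  imports Defs "HOL-Probability.Probability" "HOL-Real_Asymp.Real_Asymp"
begin

text \<open>
  On the critical line \<open>\<zeta> = Z e\<^bsup>-i\<theta>\<^esup>\<close> and \<open>\<zeta>' = - e\<^bsup>-i\<theta>\<^esup> (P + i Q)\<close> with \<open>P = \<theta>' Z\<close>, \<open>Q = Z'\<close>.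
  Let \<open>h\<close> be the real analytic phase of \<open>P + i Q\<close> with \<open>h(0) = 0\<close>. Then \<open>E = 2 \<pi> + \<theta> + h\<close>, and since
  \<open>S = N - 1 - \<theta> / \<pi>\<close>, the claim says that \<open>\<lceil>h / \<pi> + 1/2\<rceil> = - N\<^sub>0\<^sub>0\<close>. At \<open>t = 0\<close> this integer is 1, and it can
  only change where \<open>cos h = 0\<close>, which forces \<open>\<theta>' = 0\<close> or \<open>Z = 0\<close>. It drops by one at each zero of \<open>Z\<close> and at
  \<open>a_theta\<close>: there \<open>cos h = 0\<close>, and the sign of \<open>sin h cos h\<close> is that of \<open>\<theta>' Z Z'\<close>, which changes from
  negative to positive. At \<open>a_theta\<close> this holds because \<open>Z < 0\<close> and \<open>Z' < 0\<close>, which is verified numerically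
  from \<open>Z = c (M - 1 / (1/4 + t\<^sup>2))\<close> with \<open>c > 0\<close> and \<open>M\<close> twice the real part of the Mellin transform of the theta
  series. As the zeros of \<open>Z\<close> exceed \<open>a_theta\<close>, they are all counted.
\<close>

text \<open>With the formulas for E and S inserted, theta cancels and S + E / pi = N + 1 + h / pi,
  so the half-open inequality is exactly a statement about a ceiling. The sign of sin h cos h
  decides the direction because, near a point t0 with cos h(t0) = 0, sin (2 h) = -sin (2 (h -
  h(t0))): a change from negative to positive means that h decreases through a half-odd multiple of
  pi. At a zero of order m, Z Z' behaves like a positive multiple of (t - t0)^(2 m - 1), so a zero
  of any order causes exactly one drop; this is why N00 ignores multiplicities although N does not.
  The obstacle is that all objects are given by descriptions. The continuation of zeta has to be
  constructed; the functional equation of the theta series yields it, and with it xi and integrals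
  that can be estimated at \<open>a_theta\<close>. The phase has to run analytically through common
  zeros of P and Q, so the angular velocity of the curve is extended over them and integrated. The
  relation between S and N is the argument principle for xi.\<close>

subsection \<open>The functional equation of the theta series\<close>

text \<open>The characteristic function of the standard normal distribution at t is exp (-t^2 / 2);
  the substitution v = c u with c = sqrt (2 pi x) turns it into the Fourier transform of the
  Gaussian.\<close>

lemma gaussian_cos_integral:
  fixes x b :: real
  assumes "x > 0"
  shows "integrable lborel (\<lambda>u. exp (- pi * x * u\<^sup>2) * cos (2 * pi * b * u))"
    and "(LINT u|lborel. exp (- pi * x * u\<^sup>2) * cos (2 * pi * b * u)) = exp (- pi * b\<^sup>2 / x) / sqrt x"
proof -
  define c where "c = sqrt (2 * pi * x)"
  have c: "c > 0" "c\<^sup>2 = 2 * pi * x" using assms by (auto simp: c_def)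
  define t where "t = 2 * pi * b / c"
  have int: "integrable std_normal_distribution (\<lambda>v. cos (t * v))"
  proof -
    interpret real_distribution std_normal_distribution by (rule real_dist_normal_dist)
    show ?thesis by (rule integrable_const_bound[of _ 1]) auto
  qed
  have val: "(LINT v|std_normal_distribution. cos (t * v)) = exp (- t\<^sup>2 / 2)"
  proof -
    interpret real_distribution std_normal_distribution by (rule real_dist_normal_dist)
    have i: "integrable std_normal_distribution (\<lambda>v. iexp (t * v))"
      by (rule integrable_const_bound[of _ 1]) auto
    have "(LINT v|std_normal_distribution. cos (t * v)) = (LINT v|std_normal_distribution. Re (iexp (t * v)))"
      by (simp add: Re_exp)
    also have "\<dots> = Re (char std_normal_distribution t)"
      unfolding char_def using i by (simp add: integral_Re)
    also have "\<dots> = exp (- t\<^sup>2 / 2)"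
      by (simp add: char_std_normal_distribution)
    finally show ?thesis .
  qed
  have hb: "has_bochner_integral lborel (\<lambda>v. std_normal_density v * cos (t * v)) (exp (- t\<^sup>2 / 2))"
    using int val
    by (subst (asm) integrable_density, simp, simp, simp, subst (asm) integral_density)
       (auto simp: has_bochner_integral_iff)
  have "has_bochner_integral lborel (\<lambda>u. std_normal_density (0 + c * u) * cos (t * (0 + c * u))) (exp (- t\<^sup>2 / 2) /\<^sub>R \<bar>c\<bar>)"
    using hb c by (subst (asm) lborel_has_bochner_integral_real_affine_iff[of c _ _ 0]) auto
  hence *: "has_bochner_integral lborel (\<lambda>u. sqrt (2 * pi) * (std_normal_density (0 + c * u) * cos (t * (0 + c * u)))) (sqrt (2 * pi) * (exp (- t\<^sup>2 / 2) /\<^sub>R \<bar>c\<bar>))"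
    by (rule has_bochner_integral_mult_right)
  have e1: "(\<lambda>u. sqrt (2 * pi) * (std_normal_density (0 + c * u) * cos (t * (0 + c * u)))) = (\<lambda>u. exp (- pi * x * u\<^sup>2) * cos (2 * pi * b * u))"
    using c by (auto simp: fun_eq_iff std_normal_density_def t_def power_mult_distrib field_simps)
  have t2: "t\<^sup>2 / 2 = pi * b\<^sup>2 / x"
    using c assms by (simp add: t_def power_divide power_mult_distrib field_simps power2_eq_square)
  have e2: "sqrt (2 * pi) * (exp (- t\<^sup>2 / 2) /\<^sub>R \<bar>c\<bar>) = exp (- pi * b\<^sup>2 / x) / sqrt x"
    using t2 c(1) assms by (simp add: c_def real_sqrt_mult field_simps)
  from *[unfolded e1 e2] show "integrable lborel (\<lambda>u. exp (- pi * x * u\<^sup>2) * cos (2 * pi * b * u))"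
    and "(LINT u|lborel. exp (- pi * x * u\<^sup>2) * cos (2 * pi * b * u)) = exp (- pi * b\<^sup>2 / x) / sqrt x"
    by (auto simp: has_bochner_integral_iff)
qed

section \<open>The periodised Gaussian and its Fourier coefficients\<close>

lemma holomorphic_suminf:
  fixes g :: "nat \<Rightarrow> complex \<Rightarrow> complex"
  assumes "open A" "\<And>n. g n holomorphic_on A"
    and "\<And>z. z \<in> A \<Longrightarrow> \<exists>d>0. \<exists>b. cball z d \<subseteq> A \<and> summable b \<and> (\<forall>n. \<forall>w\<in>cball z d. norm (g n w) \<le> b n)"
  shows "(\<lambda>z. \<Sum>n. g n z) holomorphic_on A"
proof (rule holomorphic_uniform_sequence[OF assms(1)])
  fix n show "(\<lambda>z. \<Sum>i<n. g i z) holomorphic_on A"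
    by (intro holomorphic_on_sum assms)
next
  fix z assume "z \<in> A"
  from assms(3)[OF this] obtain d b where "d > 0" "cball z d \<subseteq> A" "summable b"
    "\<And>n w. w \<in> cball z d \<Longrightarrow> norm (g n w) \<le> b n" by metis
  thus "\<exists>d. 0 < d \<and> cball z d \<subseteq> A \<and> uniform_limit (cball z d) (\<lambda>n z. \<Sum>i<n. g i z) (\<lambda>z. \<Sum>n. g n z) sequentially"
    by (intro exI[of _ d]) (auto intro!: Weierstrass_m_test)
qed

lemma summable_exp_linear:
  fixes a :: real assumes "a > 0"
  shows "summable (\<lambda>n. exp (- a * real (Suc n)))"
proof -
  have "(\<lambda>n. exp (- a * real (Suc n))) = (\<lambda>n. exp (-a) * exp (-a) ^ n)"
    by (simp add: exp_of_nat_mult[symmetric] exp_add[symmetric] algebra_simps)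
  thus ?thesis using assms by (auto intro!: summable_mult summable_geometric)
qed

text \<open>The Gaussian shifted by n + 1 and by -(n + 1), so that the sum over all integer shifts
  becomes a series over the naturals plus one central term.\<close>

definition theta_term :: "real \<Rightarrow> nat \<Rightarrow> complex \<Rightarrow> complex" where
  "theta_term x n z = exp (- of_real (pi * x) * (z + of_nat (Suc n))\<^sup>2) + exp (- of_real (pi * x) * (z - of_nat (Suc n))\<^sup>2)"

text \<open>For real m, Re ((z + m)^2) >= m^2 / 2 - |z|^2, and m^2 >= |m| for a nonzero integer m.
  This trades the Gaussian decay for a geometric series that is uniform on discs.\<close>

lemma norm_theta_term_le:
  assumes "x > 0" "norm z \<le> r"
  shows "norm (theta_term x n z) \<le> 2 * exp (pi * x * r\<^sup>2) * exp (- (pi * x / 2) * real (Suc n))"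
proof -
  have z: "(Re z)\<^sup>2 + (Im z)\<^sup>2 \<le> r\<^sup>2"
    using assms(2) cmod_power2[of z] by (simp add: norm_ge_zero power_mono flip: cmod_power2)
  have *: "norm (exp (- of_real (pi * x) * (z + of_real m)\<^sup>2)) \<le> exp (pi * x * r\<^sup>2) * exp (- (pi * x / 2) * real (Suc n))"
    if "\<bar>m\<bar> = real (Suc n)" for m
  proof -
    have m1: "m\<^sup>2 \<ge> real (Suc n)"
    proof -
      have "m\<^sup>2 = real (Suc n) * real (Suc n)" using that by (metis power2_abs power2_eq_square)
      moreover have "real (Suc n) * 1 \<le> real (Suc n) * real (Suc n)" by (intro mult_left_mono) simp_all
      ultimately show ?thesis by (simp only: mult_1_right)
    qed
    have m2: "m\<^sup>2 / 2 \<le> (Re z + m)\<^sup>2 + (Re z)\<^sup>2"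
      using zero_le_power2[of "2 * Re z + m"] by (simp add: power2_eq_square algebra_simps)
    have "Re ((z + of_real m)\<^sup>2) = (Re z + m)\<^sup>2 - (Im z)\<^sup>2"
      by (simp add: power2_eq_square)
    moreover have "Q \<ge> N / 2 - R" if "Q = P - b" "a + b \<le> R" "N \<le> M" "M / 2 \<le> P + a" for Q P a b R N M :: real
      using that by linarith
    ultimately have "Re ((z + of_real m)\<^sup>2) \<ge> real (Suc n) / 2 - r\<^sup>2" using z m1 m2 by blast
    hence "pi * x * Re ((z + of_real m)\<^sup>2) \<ge> pi * x * (real (Suc n) / 2 - r\<^sup>2)"
      using assms by (intro mult_left_mono) auto
    thus ?thesis by (simp add: norm_exp_eq_Re exp_add[symmetric] algebra_simps del: of_nat_Suc)
  qed
  have "norm (theta_term x n z) \<le> norm (exp (- of_real (pi * x) * (z + of_real (real (Suc n)))\<^sup>2))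
      + norm (exp (- of_real (pi * x) * (z + of_real (- real (Suc n)))\<^sup>2))"
    using norm_triangle_ineq[of "exp (- of_real (pi * x) * (z + of_nat (Suc n))\<^sup>2)" "exp (- of_real (pi * x) * (z - of_nat (Suc n))\<^sup>2)"]
    by (simp only: theta_term_def of_real_minus of_real_of_nat_eq diff_conv_add_uminus)
  also have "\<dots> \<le> exp (pi * x * r\<^sup>2) * exp (- (pi * x / 2) * real (Suc n)) + exp (pi * x * r\<^sup>2) * exp (- (pi * x / 2) * real (Suc n))"
    by (intro add_mono *) auto
  finally show ?thesis by simp
qed

lemma summable_theta_bound:
  assumes "x > 0"
  shows "summable (\<lambda>n. 2 * exp (pi * x * r\<^sup>2) * exp (- (pi * x / 2) * real (Suc n)))"
  using assms by (intro summable_mult summable_exp_linear) auto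

definition theta_per :: "real \<Rightarrow> complex \<Rightarrow> complex" where
  "theta_per x z = exp (- of_real (pi * x) * z\<^sup>2) + (\<Sum>n. theta_term x n z)"

lemma theta_per_holomorphic:
  assumes "x > 0" shows "theta_per x holomorphic_on UNIV"
proof -
  have "(\<lambda>z. \<Sum>n. theta_term x n z) holomorphic_on UNIV"
  proof (rule holomorphic_suminf)
    show "theta_term x n holomorphic_on UNIV" for n
      unfolding theta_term_def by (intro holomorphic_intros)
    fix z :: complex
    let ?b = "\<lambda>n. 2 * exp (pi * x * (norm z + 1)\<^sup>2) * exp (- (pi * x / 2) * real (Suc n))"
    have b: "norm (theta_term x n w) \<le> ?b n" if "w \<in> cball z 1" for n w
    proof (rule norm_theta_term_le[OF assms])
      show "norm w \<le> norm z + 1"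
        using that norm_triangle_ineq2[of w z] by (auto simp: dist_norm norm_minus_commute)
    qed
    show "\<exists>d>0. \<exists>b. cball z d \<subseteq> UNIV \<and> summable b \<and> (\<forall>n. \<forall>w\<in>cball z d. norm (theta_term x n w) \<le> b n)"
    proof (intro exI conjI allI ballI)
      show "(0::real) < 1" "cball z 1 \<subseteq> UNIV" by simp_all
      show "summable ?b" by (rule summable_theta_bound[OF assms])
      show "norm (theta_term x n w) \<le> ?b n" if "w \<in> cball z 1" for n w by (rule b[OF that])
    qed
  qed auto
  thus ?thesis unfolding theta_per_def by (intro holomorphic_intros)
qed

lemma theta_per_continuous: "x > 0 \<Longrightarrow> continuous_on A (\<lambda>u. theta_per x (of_real u))"
  by (rule continuous_on_compose2[OF holomorphic_on_imp_continuous_on[OF theta_per_holomorphic] continuous_on_of_real_id subset_UNIV])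

lemma theta_partial_sums_uniform:
  fixes x :: real and k :: nat
  assumes x: "x > 0"
  shows "uniform_limit {-1/2..1/2} (\<lambda>M u. (exp (- of_real (pi * x) * (of_real u)\<^sup>2) + (\<Sum>n<M. theta_term x n (of_real u))) * of_real (cos (2 * pi * k * u)))
     (\<lambda>u. theta_per x (of_real u) * of_real (cos (2 * pi * k * u))) sequentially"
proof -
  have b: "bounded ((\<lambda>u. complex_of_real (cos (2 * pi * real k * u))) ` {- 1 / 2..1 / 2})"
    unfolding bounded_iff
  proof (intro exI[of _ 1] ballI)
    fix z assume "z \<in> (\<lambda>u. complex_of_real (cos (2 * pi * real k * u))) ` {- 1 / 2..1 / 2}"
    then obtain u where "z = complex_of_real (cos (2 * pi * real k * u))" by (rule imageE)
    thus "norm z \<le> 1" by (simp only: norm_of_real abs_cos_le_one)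
  qed
  have b2: "bounded ((\<lambda>u. theta_per x (complex_of_real u)) ` {- 1 / 2..1 / 2})"
    by (intro compact_imp_bounded compact_continuous_image compact_Icc theta_per_continuous x)
  have u0: "uniform_limit {-1/2..1/2::real} (\<lambda>M u. \<Sum>n<M. theta_term x n (of_real u)) (\<lambda>u. \<Sum>n. theta_term x n (of_real u)) sequentially"
  proof (rule Weierstrass_m_test[where f = "\<lambda>n u. theta_term x n (of_real u)" and M = "\<lambda>n. 2 * exp (pi * x * 1\<^sup>2) * exp (- (pi * x / 2) * real (Suc n))"])
    fix n and u :: real assume u: "u \<in> {-1/2..1/2}"
    have "\<bar>u\<bar> \<le> 1" using u unfolding atLeastAtMost_iff by linarith
    hence "norm (complex_of_real u) \<le> 1" by (simp only: norm_of_real)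
    thus "norm (theta_term x n (of_real u)) \<le> 2 * exp (pi * x * 1\<^sup>2) * exp (- (pi * x / 2) * real (Suc n))"
      by (rule norm_theta_term_le[OF x])
  qed (rule summable_theta_bound[OF x])
  have u1: "uniform_limit {-1/2..1/2::real} (\<lambda>M u. exp (- of_real (pi * x) * (of_real u)\<^sup>2) + (\<Sum>n<M. theta_term x n (of_real u))) (\<lambda>u. theta_per x (of_real u)) sequentially"
    unfolding theta_per_def by (rule uniform_limit_add[OF uniform_limit_const u0])
  show ?thesis
    by (rule uniform_lim_mult[OF u1 uniform_limit_const b2 b])
qed

text \<open>Since cos (2 pi k u) is invariant under integer shifts, the partial sum integrated over
  one period is the single Gaussian integrated over [-(M + 1/2), M + 1/2]. Uniform convergence on
  one side and dominated convergence on the other give the Gaussian integral over the line.\<close>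

lemma theta_fourier_coeff:
  fixes x :: real and k :: nat
  assumes x: "x > 0"
  shows "((\<lambda>u. theta_per x (of_real u) * of_real (cos (2 * pi * k * u))) has_integral
           of_real (exp (- pi * (real k)\<^sup>2 / x) / sqrt x)) {-1/2..1/2}"
proof -
  define f :: "real \<Rightarrow> complex" where "f = (\<lambda>u. of_real (exp (- pi * x * u\<^sup>2) * cos (2 * pi * k * u)))"
  define h where "h = (\<lambda>M u. (exp (- of_real (pi * x) * (of_real u)\<^sup>2) + (\<Sum>n<M. theta_term x n (of_real u))) * of_real (cos (2 * pi * k * u)))"
  have fi: "f integrable_on {a..b}" for a b
    unfolding f_def by (intro integrable_continuous_interval continuous_intros)
  have ul: "uniform_limit {-1/2..1/2} h (\<lambda>u. theta_per x (of_real u) * of_real (cos (2 * pi * k * u))) sequentially"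
    unfolding h_def by (rule theta_partial_sums_uniform[OF x])
  have ch: "continuous_on {-1/2..1/2} (h M)" for M
    unfolding h_def theta_term_def by (intro continuous_intros)
  obtain I J where I: "\<And>n. (h n has_integral I n) {-1/2..1/2}" and J: "((\<lambda>u. theta_per x (of_real u) * of_real (cos (2 * pi * k * u))) has_integral J) {-1/2..1/2}"
    and IJ: "I \<longlonglongrightarrow> J"
    using uniform_limit_integral[OF ul ch] by auto
  have hI: "(h M has_integral integral {-(real M + 1/2)..real M + 1/2} f) {-1/2..1/2}" for M
  proof (induction M)
    case 0
    have "h 0 = f" unfolding h_def f_def by (rule ext) (simp flip: exp_of_real)
    thus ?case using integrable_integral[OF fi[of "-1/2" "1/2"]] by simp
  next
    case (Suc M)
    let ?m = "real (Suc M)"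
    have per: "cos (2 * pi * k * (u + ?m)) = cos (2 * pi * k * u)" "cos (2 * pi * k * (u - ?m)) = cos (2 * pi * k * u)" for u
    proof -
      have "2 * pi * k * (u + ?m) = 2 * pi * k * u + 2 * real (k * Suc M) * pi" by (simp add: algebra_simps)
      thus "cos (2 * pi * k * (u + ?m)) = cos (2 * pi * k * u)"
        using cos.plus_of_nat[of "2 * pi * k * u" "k * Suc M"] by (simp only: mult_ac of_real_eq_id id_apply)
      have "2 * pi * k * u = 2 * pi * k * (u - ?m) + 2 * real (k * Suc M) * pi" by (simp add: algebra_simps)
      thus "cos (2 * pi * k * (u - ?m)) = cos (2 * pi * k * u)"
        using cos.plus_of_nat[of "2 * pi * k * (u - ?m)" "k * Suc M"] by (simp only: mult_ac of_real_eq_id id_apply)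
    qed
    have e: "h (Suc M) u = h M u + (f (u + ?m) + f (u - ?m))" for u
    proof -
      have ee: "exp (- of_real (pi * x) * (of_real v)\<^sup>2) = complex_of_real (exp (- pi * x * v\<^sup>2))" for v
        by (simp flip: exp_of_real)
      have "theta_term x M (of_real u) = of_real (exp (- pi * x * (u + ?m)\<^sup>2)) + of_real (exp (- pi * x * (u - ?m)\<^sup>2))"
        unfolding theta_term_def ee[symmetric] by (simp only: of_real_add of_real_diff of_real_of_nat_eq)
      thus ?thesis unfolding f_def per h_def
        by (simp only: sum.lessThan_Suc of_real_mult distrib_right add.assoc)
    qed
    have s1: "((\<lambda>u. f (u + ?m)) has_integral integral {real M + 1/2..?m+1/2} f) {-1/2..1/2}"
    proof -
      have b: "{real M + 1/2..?m+1/2} = {-1/2 + ?m..1/2 + ?m}" by simp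
      have "((f \<circ> (+) ?m) has_integral integral {-1/2 + ?m..1/2 + ?m} f) {-1/2..1/2}"
        unfolding has_integral_shift_Icc_real by (rule integrable_integral[OF fi])
      thus ?thesis unfolding b o_def by (simp only: add.commute[of ?m])
    qed
    have s2: "((\<lambda>u. f (u - ?m)) has_integral integral {-(?m + 1/2)..-(real M+1/2)} f) {-1/2..1/2}"
    proof -
      have b: "{-(?m + 1/2)..-(real M+1/2)} = {-1/2 + (-?m)..1/2 + (-?m)}" by simp
      have "((f \<circ> (+) (-?m)) has_integral integral {-1/2 + (-?m)..1/2 + (-?m)} f) {-1/2..1/2}"
        unfolding has_integral_shift_Icc_real by (rule integrable_integral[OF fi])
      thus ?thesis unfolding b o_def by (simp only: add.commute[of "-?m"] diff_conv_add_uminus)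
    qed
    have c1: "integral {-(?m + 1/2)..-(real M+1/2)} f + integral {-(real M+1/2)..?m+1/2} f = integral {-(?m+1/2)..?m+1/2} f"
      by (rule Henstock_Kurzweil_Integration.integral_combine) (use fi in auto)
    have c2: "integral {-(real M+1/2)..real M+1/2} f + integral {real M+1/2..?m+1/2} f = integral {-(real M+1/2)..?m+1/2} f"
      by (rule Henstock_Kurzweil_Integration.integral_combine) (use fi in auto)
    have "(h (Suc M) has_integral (integral {-(real M + 1/2)..real M + 1/2} f + (integral {real M + 1/2..?m+1/2} f + integral {-(?m + 1/2)..-(real M+1/2)} f))) {-1/2..1/2}"
      using has_integral_add[OF Suc has_integral_add[OF s1 s2]] unfolding e[abs_def, symmetric] by simp
    moreover have "integral {-(real M + 1/2)..real M + 1/2} f + (integral {real M + 1/2..?m+1/2} f + integral {-(?m + 1/2)..-(real M+1/2)} f) = integral {-(?m+1/2)..?m+1/2} f"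
      unfolding c1[symmetric] c2[symmetric] by (simp only: add_ac)
    ultimately show ?case by (simp only:)
  qed
  have If: "I M = integral {-(real M + 1/2)..real M + 1/2} f" for M
    using I[of M] hI[of M] has_integral_unique by blast
  have int: "integrable lborel f" 
    unfolding f_def using gaussian_cos_integral(1)[OF x, of k] by (rule integrable_of_real)
  have si: "set_integrable lborel {a..b} f" for a b
    unfolding set_integrable_def
    by (rule integrable_mult_indicator) (simp, rule int)
  have LI: "(LINT u:{a..b}|lborel. f u) = integral {a..b} f" for a b
    using set_borel_integral_eq_integral(2)[OF si] .
  have "(\<lambda>M. LINT u:{-(real M + 1/2)..real M + 1/2}|lborel. f u) \<longlonglongrightarrow> (LINT u|lborel. f u)"
    unfolding set_lebesgue_integral_def
  proof (rule integral_dominated_convergence[where M = lborel and w = "\<lambda>u. norm (f u)" and f = f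
        and s = "\<lambda>M u. indicator {-(real M + 1/2)..real M + 1/2} u *\<^sub>R f u"])
    show "f \<in> borel_measurable lborel" using int by (rule borel_measurable_integrable)
    show "(\<lambda>u. indicator {-(real M + 1/2)..real M + 1/2} u *\<^sub>R f u) \<in> borel_measurable lborel" for M
      using \<open>f \<in> borel_measurable lborel\<close> by (intro borel_measurable_scaleR borel_measurable_indicator) simp_all
    show "integrable lborel (\<lambda>u. norm (f u))" using int by (rule integrable_norm)
    show "AE u in lborel. (\<lambda>M. indicator {-(real M + 1/2)..real M + 1/2} u *\<^sub>R f u) \<longlonglongrightarrow> f u"
    proof (rule AE_I2)
      fix u
      have "\<forall>\<^sub>F M in sequentially. indicator {-(real M + 1/2)..real M + 1/2} u *\<^sub>R f u = f u"
        using eventually_ge_at_top[of "nat \<lceil>\<bar>u\<bar>\<rceil>"]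
        by eventually_elim (auto simp: indicator_def)
      thus "(\<lambda>M. indicator {-(real M + 1/2)..real M + 1/2} u *\<^sub>R f u) \<longlonglongrightarrow> f u"
        by (rule tendsto_eventually)
    qed
    show "AE u in lborel. norm (indicat_real {-(real M + 1/2)..real M + 1/2} u *\<^sub>R f u) \<le> norm (f u)" for M
      by (rule AE_I2) (auto simp: indicator_def)
  qed
  moreover have "(LINT u:{-(real M + 1/2)..real M + 1/2}|lborel. f u) = I M" for M
    unfolding LI If ..
  moreover have "(LINT u|lborel. f u) = of_real (exp (- pi * (real k)\<^sup>2 / x) / sqrt x)"
  proof -
    have "(LINT u|lborel. f u) = of_real (LINT u|lborel. exp (- pi * x * u\<^sup>2) * cos (2 * pi * k * u))"
      unfolding f_def by (rule integral_complex_of_real)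
    thus ?thesis by (simp only: gaussian_cos_integral(2)[OF x])
  qed
  ultimately have "I \<longlonglongrightarrow> of_real (exp (- pi * (real k)\<^sup>2 / x) / sqrt x)" by (simp only:)
  hence "J = of_real (exp (- pi * (real k)\<^sup>2 / x) / sqrt x)" by (rule LIMSEQ_unique[OF IJ])
  with J show ?thesis by (simp only:)
qed

text \<open>The Riemann-Lebesgue lemma by a single integration by parts, which gives a bound of
  order 1 / l n; holomorphy of q makes its derivative bounded on the interval.\<close>

lemma oscillatory_integral_tendsto_0:
  fixes q :: "complex \<Rightarrow> complex" and a b :: real and l :: "nat \<Rightarrow> real"
  assumes q: "q holomorphic_on V" "open V" "of_real ` {a..b} \<subseteq> V" and "a \<le> b"
    and l: "filterlim l at_top sequentially"
  shows "(\<lambda>n. integral {a..b} (\<lambda>u. q (of_real u) * of_real (sin (l n * u)))) \<longlonglongrightarrow> 0"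
proof -
  have dq: "deriv q holomorphic_on V" by (rule holomorphic_deriv[OF q(1,2)])
  have c: "continuous_on {a..b} (\<lambda>u. q (of_real u))" "continuous_on {a..b} (\<lambda>u. deriv q (of_real u))"
    by (rule continuous_on_compose2[OF holomorphic_on_imp_continuous_on[OF q(1)] continuous_on_of_real_id q(3)],
        rule continuous_on_compose2[OF holomorphic_on_imp_continuous_on[OF dq] continuous_on_of_real_id q(3)])
  obtain K1 where K1: "\<And>u. u \<in> {a..b} \<Longrightarrow> norm (q (of_real u)) \<le> K1"
    using compact_continuous_image[OF c(1)] by (metis bounded_iff compact_Icc compact_imp_bounded imageI)
  obtain K2 where K2: "\<And>u. u \<in> {a..b} \<Longrightarrow> norm (deriv q (of_real u)) \<le> K2"
    using compact_continuous_image[OF c(2)] by (metis bounded_iff compact_Icc compact_imp_bounded imageI)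
  have bnd: "norm (integral {a..b} (\<lambda>u. q (of_real u) * of_real (sin (l n * u)))) \<le> (2 * K1 + K2 * (b - a)) / l n"
    if ln: "l n > 0" for n
  proof -
    define F where "F = (\<lambda>u. - q (of_real u) * of_real (cos (l n * u) / l n))"
    define g where "g = (\<lambda>u. deriv q (of_real u) * of_real (cos (l n * u) / l n))"
    have der: "(F has_vector_derivative (q (of_real u) * of_real (sin (l n * u)) - g u)) (at u within {a..b})" if "u \<in> {a..b}" for u
    proof -
      have "(q has_field_derivative deriv q (of_real u)) (at (of_real u))"
        by (rule holomorphic_derivI[OF q(1,2)]) (use q(3) that in blast)
      hence 1: "((\<lambda>u. q (of_real u)) has_vector_derivative deriv q (of_real u)) (at u within {a..b})"
        by (rule has_vector_derivative_real_field)
      have 2: "((\<lambda>u. cos (l n * u) / l n) has_real_derivative - sin (l n * u)) (at u within {a..b})"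
        using ln by (auto intro!: derivative_eq_intros)
      have 3: "((\<lambda>u. complex_of_real (cos (l n * u) / l n)) has_vector_derivative of_real (- sin (l n * u))) (at u within {a..b})"
        by (rule has_vector_derivative_of_real) (rule 2)
      show ?thesis unfolding F_def g_def
        using has_vector_derivative_minus[OF has_vector_derivative_mult[OF 1 3]] by (simp add: algebra_simps)
    qed
    have int: "((\<lambda>u. q (of_real u) * of_real (sin (l n * u)) - g u) has_integral F b - F a) {a..b}"
      using \<open>a \<le> b\<close> der by (rule fundamental_theorem_of_calculus)
    have gi: "g integrable_on {a..b}"
      unfolding g_def using ln by (intro integrable_continuous_interval continuous_intros c) auto
    have "((\<lambda>u. q (of_real u) * of_real (sin (l n * u))) has_integral (F b - F a + integral {a..b} g)) {a..b}"
      using has_integral_add[OF int integrable_integral[OF gi]] by simp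
    hence eq: "integral {a..b} (\<lambda>u. q (of_real u) * of_real (sin (l n * u))) = F b - F a + integral {a..b} g"
      by (rule integral_unique)
    have nF: "norm (F u) \<le> K1 / l n" if "u \<in> {a..b}" for u
    proof -
      have "norm (F u) = norm (q (of_real u)) * (\<bar>cos (l n * u)\<bar> / l n)"
        using ln by (simp add: F_def norm_mult norm_divide del: cos_of_real)
      also have "\<dots> \<le> K1 * (1 / l n)"
        using ln K1[OF that] by (intro mult_mono divide_right_mono) (auto intro: order.trans[OF norm_ge_zero])
      finally show ?thesis by simp
    qed
    have ng: "norm (g u) \<le> K2 / l n" if "u \<in> {a..b}" for u
    proof -
      have "norm (g u) = norm (deriv q (of_real u)) * (\<bar>cos (l n * u)\<bar> / l n)"
        using ln by (simp add: g_def norm_mult norm_divide del: cos_of_real)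
      also have "\<dots> \<le> K2 * (1 / l n)"
        using ln K2[OF that] by (intro mult_mono divide_right_mono) (auto intro: order.trans[OF norm_ge_zero])
      finally show ?thesis by simp
    qed
    have "norm (integral {a..b} g) \<le> integral {a..b} (\<lambda>u. K2 / l n)"
      using gi ng by (intro integral_norm_bound_integral) auto
    hence "norm (integral {a..b} g) \<le> K2 / l n * (b - a)" using \<open>a \<le> b\<close> by (simp add: mult.commute)
    moreover have "norm (F b - F a) \<le> K1 / l n + K1 / l n"
      by (rule order.trans[OF norm_triangle_ineq4]) (intro add_mono nF; use \<open>a \<le> b\<close> in simp)
    ultimately have "norm (F b - F a + integral {a..b} g) \<le> K1 / l n + K1 / l n + K2 / l n * (b - a)"
      by (intro order.trans[OF norm_triangle_ineq] add_mono)
    thus ?thesis unfolding eq by (simp add: add_divide_distrib)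
  qed
  have ev: "\<forall>\<^sub>F n in sequentially. l n > 0"
    using l by (simp add: filterlim_at_top_dense)
  show ?thesis
  proof (rule Lim_null_comparison)
    show "\<forall>\<^sub>F n in sequentially. norm (integral {a..b} (\<lambda>u. q (of_real u) * of_real (sin (l n * u)))) \<le> (2 * K1 + K2 * (b - a)) / l n"
      using ev by eventually_elim (rule bnd)
    show "(\<lambda>n. (2 * K1 + K2 * (b - a)) / l n) \<longlonglongrightarrow> 0"
      using l by (intro tendsto_divide_0[OF tendsto_const] filterlim_at_top_imp_at_infinity)
  qed
qed

text \<open>The closed form of the Dirichlet kernel, multiplied by sin (pi u) so that no division
  occurs at u = 0.\<close>

lemma Dirichlet_kernel:
  "sin (pi * u) * (1 + 2 * (\<Sum>k<N. cos (2 * pi * real (Suc k) * u))) = sin ((2 * real N + 1) * pi * u)"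
proof (induction N)
  case (Suc N)
  have "2 * (sin (pi * u) * cos (2 * pi * real (Suc N) * u)) = sin (pi * u + 2 * pi * real (Suc N) * u) + sin (pi * u - 2 * pi * real (Suc N) * u)"
    by (simp only: sin_add sin_diff)
  also have "pi * u - 2 * pi * real (Suc N) * u = - ((2 * real N + 1) * pi * u)" by (simp add: algebra_simps)
  also have "pi * u + 2 * pi * real (Suc N) * u = (2 * real (Suc N) + 1) * pi * u" by (simp add: algebra_simps)
  finally have "2 * (sin (pi * u) * cos (2 * pi * real (Suc N) * u)) = sin ((2 * real (Suc N) + 1) * pi * u) - sin ((2 * real N + 1) * pi * u)"
    by (simp only: sin_minus minus_minus add_uminus_conv_diff)
  thus ?case using Suc by (simp add: distrib_left del: of_nat_Suc)
qed auto

definition omega :: "real \<Rightarrow> real" where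
  "omega x = (\<Sum>n. exp (- pi * (real (Suc n))\<^sup>2 * x))"

lemma summable_omega:
  assumes "x > 0" shows "summable (\<lambda>n. exp (- pi * (real (Suc n))\<^sup>2 * x))"
proof (rule summable_comparison_test')
  show "summable (\<lambda>n. exp (- (pi * x) * real (Suc n)))"
    using assms by (intro summable_exp_linear) auto
  fix n :: nat
  have "real (Suc n) * 1 \<le> real (Suc n) * real (Suc n)" by (intro mult_left_mono) simp_all
  hence "pi * x * real (Suc n) \<le> pi * x * (real (Suc n))\<^sup>2"
    using assms by (intro mult_left_mono) (auto simp: power2_eq_square simp del: of_nat_Suc)
  thus "norm (exp (- pi * (real (Suc n))\<^sup>2 * x)) \<le> exp (- (pi * x) * real (Suc n))"
    by (simp add: mult_ac del: of_nat_Suc)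
qed

lemma theta_per_0:
  assumes "x > 0" shows "theta_per x 0 = of_real (1 + 2 * omega x)"
proof -
  have "(\<lambda>n. theta_term x n 0) = (\<lambda>n. 2 * of_real (exp (- pi * (real (Suc n))\<^sup>2 * x)))"
    by (auto simp: theta_term_def fun_eq_iff exp_of_real[symmetric] mult_ac simp del: of_nat_Suc)
  moreover have "(\<Sum>n. 2 * complex_of_real (exp (- pi * (real (Suc n))\<^sup>2 * x))) = 2 * of_real (omega x)"
    unfolding omega_def suminf_of_real[OF summable_omega[OF assms]]
    by (intro suminf_mult summable_of_real summable_omega assms)
  ultimately show ?thesis by (simp add: theta_per_def)
qed

text \<open>Poisson summation for the Gaussian: the Fourier series of \<open>theta_per x\<close> is
  evaluated at 0. The error of its N-th partial sum is the integral of (theta_per(u) - theta_per(0))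
  / sin (pi u) against sin ((2 N + 1) pi u), which tends to 0 because the quotient is holomorphic
  near the interval.\<close>

theorem omega_functional_equation:
  assumes x: "x > 0"
  shows "1 + 2 * omega (1 / x) = sqrt x * (1 + 2 * omega x)"
proof -
  \<comment> \<open>In this strip sin (pi z) vanishes only at 0, so the quotient \<open>m\<close>
    below has no zero there.\<close>
  define V where "V = {z :: complex. Re z > -1} \<inter> {z. Re z < 1}"
  have V: "open V" unfolding V_def by (intro open_Int open_halfspace_Re_gt open_halfspace_Re_lt)
  \<comment> \<open>Both difference quotients at 0 have removable singularities;
    \<open>k / m\<close> is then the quotient of theta_per(z) - theta_per(0) by sin (pi z), with the
    value at 0 filled in.\<close>
  define k where "k = (\<lambda>z. if z = 0 then deriv (theta_per x) 0 else (theta_per x z - theta_per x 0) / (z - 0))"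
  define m where "m = (\<lambda>z. if z = 0 then deriv (\<lambda>z. sin (of_real pi * z)) 0 else (sin (of_real pi * z) - sin (of_real pi * 0)) / (z - 0) :: complex)"
  have k: "k holomorphic_on UNIV" unfolding k_def
    by (rule pole_lemma[OF theta_per_holomorphic[OF x]]) simp
  have m: "m holomorphic_on UNIV" unfolding m_def
    by (rule pole_lemma) (auto intro!: holomorphic_intros)
  have m0: "m z \<noteq> 0" if "z \<in> V" for z
  proof (cases "z = 0")
    case True
    have "((\<lambda>z. sin (of_real pi * z)) has_field_derivative of_real pi) (at (0::complex))"
      by (auto intro!: derivative_eq_intros)
    thus ?thesis using True by (simp add: m_def DERIV_imp_deriv)
  next
    case False
    have "sin (of_real pi * z) \<noteq> 0"
    proof
      assume "sin (of_real pi * z) = 0"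
      then obtain n where "of_real pi * z = of_real (of_int n * pi)" by (auto simp: Complex_Transcendental.sin_eq_0)
      hence "z = of_int n" by (simp add: field_simps)
      thus False using that False by (auto simp: V_def)
    qed
    thus ?thesis using False by (simp add: m_def)
  qed
  have q: "(\<lambda>z. k z / m z) holomorphic_on V"
    by (intro holomorphic_intros m0 holomorphic_on_subset[OF k] holomorphic_on_subset[OF m]) auto
  define c where "c = (\<lambda>j. complex_of_real (exp (- pi * (real j)\<^sup>2 / x) / sqrt x))"
  have I: "integral {-1/2..1/2} (\<lambda>u. k (of_real u) / m (of_real u) * of_real (sin ((2 * real N + 1) * pi * u)))
      = c 0 + 2 * (\<Sum>j<N. c (Suc j)) - theta_per x 0" for N
  proof -
    have ci: "((\<lambda>u. of_real (cos (2 * pi * real (Suc j) * u))) has_integral (0::complex)) {-1/2..1/2}" for j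
    proof -
      have "((\<lambda>u. cos (2 * pi * real (Suc j) * u)) has_integral 
           (sin (2 * pi * real (Suc j) * (1/2)) / (2 * pi * real (Suc j)) - sin (2 * pi * real (Suc j) * (-1/2)) / (2 * pi * real (Suc j)))) {-1/2..1/2}"
        by (rule fundamental_theorem_of_calculus)
          (auto intro!: derivative_eq_intros simp: has_real_derivative_iff_has_vector_derivative[symmetric] simp del: of_nat_Suc)
      moreover have "sin (2 * pi * real (Suc j) * (1/2)) = 0" using sin_npi2[of "Suc j"] by (simp del: of_nat_Suc)
      moreover have "sin (2 * pi * real (Suc j) * (-1/2)) = 0" using sin_npi2[of "Suc j"] by (simp del: of_nat_Suc)
      ultimately have "((\<lambda>u. cos (2 * pi * real (Suc j) * u)) has_integral 0) {-1/2..1/2}" by simp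
      from has_integral_of_real[OF this] show ?thesis by simp
    qed
    let ?D = "\<lambda>u. 1 + 2 * (\<Sum>j<N. complex_of_real (cos (2 * pi * real (Suc j) * u)))"
    have s: "of_real (sin ((2 * real N + 1) * pi * u)) = sin (of_real pi * of_real u) * ?D u" for u
      by (subst Dirichlet_kernel[symmetric]) (simp flip: sin_of_real)
    have eq: "k (of_real u) / m (of_real u) * of_real (sin ((2 * real N + 1) * pi * u)) = 
        (theta_per x (of_real u) - theta_per x 0) * ?D u" if "u \<in> {-1/2..1/2}" for u
    proof (cases "u = 0")
      case False
      have "of_real u \<in> V" using that by (auto simp: V_def)
      from m0[OF this] False have "sin (of_real pi * complex_of_real u) \<noteq> 0" by (auto simp: m_def)
      thus ?thesis using False unfolding s by (simp add: k_def m_def)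
    qed (simp add: Dirichlet_kernel)
    have "((\<lambda>u. theta_per x (of_real u) * of_real (cos (2 * pi * real 0 * u)) 
       + 2 * (\<Sum>j<N. theta_per x (of_real u) * of_real (cos (2 * pi * real (Suc j) * u)))
       - theta_per x 0 * (1 + 2 * (\<Sum>j<N. of_real (cos (2 * pi * real (Suc j) * u))))) has_integral
        (c 0 + 2 * (\<Sum>j<N. c (Suc j)) - theta_per x 0 * (((1/2) - (-1/2)) *\<^sub>R 1 + 2 * (\<Sum>j<N. 0)))) {-1/2..1/2}"
      unfolding c_def
      by (intro has_integral_diff has_integral_add has_integral_mult_right has_integral_sum theta_fourier_coeff[OF x] ci
           has_integral_const_real[of 1 "-1/2" "1/2" , simplified content_real] finite_lessThan)
    also have "(\<lambda>u. theta_per x (of_real u) * of_real (cos (2 * pi * real 0 * u)) 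
       + 2 * (\<Sum>j<N. theta_per x (of_real u) * of_real (cos (2 * pi * real (Suc j) * u)))
       - theta_per x 0 * ?D u) = (\<lambda>u. (theta_per x (of_real u) - theta_per x 0) * ?D u)"
      by (simp add: fun_eq_iff ring_distribs sum_distrib_left sum_distrib_right sum_subtractf mult_ac del: of_nat_Suc)
    finally have "((\<lambda>u. (theta_per x (of_real u) - theta_per x 0) * ?D u) has_integral
        (c 0 + 2 * (\<Sum>j<N. c (Suc j)) - theta_per x 0)) {-1/2..1/2}" by simp
    hence "((\<lambda>u. k (of_real u) / m (of_real u) * of_real (sin ((2 * real N + 1) * pi * u))) has_integral
        (c 0 + 2 * (\<Sum>j<N. c (Suc j)) - theta_per x 0)) {-1/2..1/2}"
      by (rule has_integral_eq[rotated]) (simp only: eq)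
    thus ?thesis by (rule integral_unique)
  qed
  have "(\<lambda>N. integral {-1/2..1/2} (\<lambda>u. k (of_real u) / m (of_real u) * of_real (sin ((2 * real N + 1) * pi * u)))) \<longlonglongrightarrow> 0"
  proof (rule oscillatory_integral_tendsto_0[OF q V])
    show "filterlim (\<lambda>N. (2 * real N + 1) * pi) at_top sequentially" by real_asymp
  qed (auto simp: V_def)
  hence l1: "(\<lambda>N. c 0 + 2 * (\<Sum>j<N. c (Suc j)) - theta_per x 0) \<longlonglongrightarrow> 0" unfolding I .
  have "(\<lambda>N. c 0 + 2 * (\<Sum>j<N. c (Suc j)) - theta_per x 0) \<longlonglongrightarrow> c 0 + 2 * (of_real (omega (1/x) / sqrt x)) - theta_per x 0"
  proof (intro tendsto_intros)
    have "(\<lambda>j. exp (- pi * (real (Suc j))\<^sup>2 * (1/x))) sums omega (1/x)"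
      unfolding omega_def using summable_omega[of "1/x"] x by (intro summable_sums) auto
    from sums_of_real[OF sums_divide[OF this, of "sqrt x"], where 'a = complex]
    have "(\<lambda>j. c (Suc j)) sums of_real (omega (1/x) / sqrt x)"
      by (simp add: c_def del: of_nat_Suc)
    thus "(\<lambda>N. \<Sum>j<N. c (Suc j)) \<longlonglongrightarrow> of_real (omega (1/x) / sqrt x)" by (simp add: sums_def)
  qed
  from LIMSEQ_unique[OF this l1] have "c 0 + 2 * (of_real (omega (1/x) / sqrt x)) = of_real (1 + 2 * omega x)"
    by (simp add: theta_per_0[OF x])
  hence "complex_of_real (1 / sqrt x + 2 * (omega (1/x) / sqrt x)) = of_real (1 + 2 * omega x)"
    by (simp add: c_def)
  hence "1 / sqrt x + 2 * (omega (1/x) / sqrt x) = 1 + 2 * omega x" by (simp only: of_real_eq_iff)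
  thus ?thesis using x by (simp add: field_simps)
qed

subsection \<open>Mellin transforms of the theta series\<close>

lemma exp_minus_1_minus_self_bound:
  fixes w :: complex
  shows "norm (exp w - 1 - w) \<le> exp \<bar>Re w\<bar> * (norm w)\<^sup>2"
  using Taylor_exp[of w 1] by (simp add: algebra_simps power2_eq_square)

lemma Gamma_integral_scaled:
  fixes c z :: real
  assumes "c > 0" "z > 0"
  shows "((\<lambda>x. x powr (z - 1) * exp (- c * x)) has_integral Gamma z * c powr (- z)) {0<..}"
    and "(\<lambda>x. x powr (z - 1) * exp (- c * x)) absolutely_integrable_on {0<..}"
proof -
  define f where "f = (\<lambda>t. t powr (z - 1) * exp (- t))"
  have 1: "(f has_integral Gamma z) {0<..}"
  proof -
    have "((\<lambda>t. t powr (z - 1) / exp t) has_integral Gamma z) {0<..}"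
      by (rule has_integral_spike_set_eq[THEN iffD1, OF _ _ Gamma_integral_real[OF assms(2)]])
        (auto intro: negligible_subset[of "{0}"])
    thus ?thesis unfolding f_def exp_minus divide_inverse .
  qed
  have abs1: "f absolutely_integrable_on {0<..}"
    by (rule nonnegative_absolutely_integrable_1[OF has_integral_integrable[OF 1]]) (simp add: f_def)
  have im: "(*) c ` {0<..} = {0<..}"
  proof (intro equalityI subsetI)
    fix x :: real assume "x \<in> {0<..}"
    hence "x = c * (x / c)" "x / c \<in> {0<..}" using assms by auto
    thus "x \<in> (*) c ` {0<..}" by blast
  qed (use assms in auto)
  have d: "((*) c has_real_derivative c) (at x within {0<..})" for x
    by (auto intro!: derivative_eq_intros)
  have inj: "inj_on ((*) c) {0<..}" using assms by (auto simp: inj_on_def)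
  have iff: "(\<lambda>x. \<bar>c\<bar> * f (c * x)) absolutely_integrable_on {0<..} \<and> integral {0<..} (\<lambda>x. \<bar>c\<bar> * f (c * x)) = Gamma z
     \<longleftrightarrow> f absolutely_integrable_on ((*) c ` {0<..}) \<and> integral ((*) c ` {0<..}) f = Gamma z"
    by (rule has_absolute_integral_change_of_variables_1'[where g = "(*) c" and g' = "\<lambda>_. c", OF _ d inj]) simp
  have *: "(\<lambda>x. \<bar>c\<bar> * f (c * x)) absolutely_integrable_on {0<..}" "integral {0<..} (\<lambda>x. \<bar>c\<bar> * f (c * x)) = Gamma z"
    using iff abs1 integral_unique[OF 1] unfolding im by (simp_all only: simp_thms)
  have eq: "\<bar>c\<bar> * f (c * x) = c powr z * (x powr (z - 1) * exp (- c * x))" if "x \<in> {0<..}" for x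
    using assms that by (simp add: f_def powr_mult powr_diff)
  have cp: "c powr z \<noteq> 0" "c powr z > 0" using assms by auto
  have 2: "(\<lambda>x. c powr z * (x powr (z - 1) * exp (- c * x))) absolutely_integrable_on {0<..}"
    by (rule absolutely_integrable_spike[OF *(1) negligible_empty]) (rule eq[symmetric], simp)
  have 3: "integral {0<..} (\<lambda>x. c powr z * (x powr (z - 1) * exp (- c * x))) = Gamma z"
    using *(2) by (simp only: Henstock_Kurzweil_Integration.integral_cong[OF eq])
  show abs2: "(\<lambda>x. x powr (z - 1) * exp (- c * x)) absolutely_integrable_on {0<..}"
    using 2 cp by (simp only: set_integrable_mult_right_iff[OF cp(1)])
  have "integral {0<..} (\<lambda>x. x powr (z - 1) * exp (- c * x)) = Gamma z / c powr z"
    using 3 cp by (simp add: field_simps)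
  moreover have "(\<lambda>x. x powr (z - 1) * exp (- c * x)) integrable_on {0<..}"
    using abs2 by (rule set_lebesgue_integral_eq_integral(1))
  ultimately show "((\<lambda>x. x powr (z - 1) * exp (- c * x)) has_integral Gamma z * c powr (- z)) {0<..}"
    by (simp add: has_integral_iff powr_minus_divide)
qed

lemma omega_nonneg: "x > 0 \<Longrightarrow> omega x \<ge> 0"
  unfolding omega_def by (intro suminf_nonneg summable_omega) auto

lemma omega_ge:
  assumes "x > 0" shows "omega x \<ge> exp (- pi * x)"
proof -
  have "(\<Sum>n<1. exp (- pi * (real (Suc n))\<^sup>2 * x)) \<le> omega x"
    unfolding omega_def by (intro sum_le_suminf summable_omega assms) auto
  thus ?thesis by simp
qed

text \<open>For x >= 1 one has (n + 1)^2 x >= x + 3 n, because n^2 + 2 n >= 3 n for integers; the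
  series is dominated by a geometric one of ratio exp (-3 pi).\<close>

lemma omega_le:
  assumes "x \<ge> 1" shows "omega x \<le> exp (- pi * x) / (1 - exp (- 3 * pi))"
proof -
  have q: "exp (- 3 * pi) < 1" by simp
  have s: "(\<lambda>n. exp (- pi * x) * exp (- 3 * pi) ^ n) sums (exp (- pi * x) * (1 / (1 - exp (- 3 * pi))))"
    using q by (intro sums_mult geometric_sums) simp
  have "omega x \<le> (\<Sum>n. exp (- pi * x) * exp (- 3 * pi) ^ n)"
    unfolding omega_def
  proof (intro suminf_le summable_omega)
    fix n :: nat
    have "real (3 * n) \<le> real (n\<^sup>2 + 2 * n)"
      by (cases n) (auto simp: power2_eq_square)
    hence "3 * real n \<le> (real n)\<^sup>2 + 2 * real n" by simp
    also have "\<dots> = ((real n)\<^sup>2 + 2 * real n) * 1" by simp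
    also have "\<dots> \<le> ((real n)\<^sup>2 + 2 * real n) * x" using assms by (intro mult_left_mono) auto
    finally have "x + 3 * real n \<le> (real (Suc n))\<^sup>2 * x" by (simp add: power2_eq_square algebra_simps)
    hence "pi * (x + 3 * real n) \<le> pi * ((real (Suc n))\<^sup>2 * x)" by (intro mult_left_mono) auto
    moreover have "exp (- pi * x) * exp (- 3 * pi) ^ n = exp (- (pi * (x + 3 * real n)))"
      by (simp add: exp_of_nat_mult[symmetric] exp_add[symmetric] algebra_simps)
    ultimately show "exp (- pi * (real (Suc n))\<^sup>2 * x) \<le> exp (- pi * x) * exp (- 3 * pi) ^ n"
      by (simp add: mult.assoc del: of_nat_Suc)
  qed (use assms s in \<open>auto simp: sums_iff\<close>)
  also have "\<dots> = exp (- pi * x) / (1 - exp (- 3 * pi))" using s by (simp add: sums_iff)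
  finally show ?thesis .
qed

lemma omega_le':
  assumes "x \<ge> 1" shows "omega x \<le> 2 * exp (- pi * x)"
proof -
  have "exp (- 3 * pi) \<le> exp (- 1)" using pi_ge_two by (subst exp_le_cancel_iff) linarith
  moreover have "exp (- 1 :: real) \<le> 1 / 2" using exp_ge_add_one_self[of 1] by (simp add: exp_minus field_simps)
  ultimately have "1 - exp (- 3 * pi) \<ge> 1 / 2" by linarith
  hence "exp (- pi * x) / (1 - exp (- 3 * pi)) \<le> exp (- pi * x) / (1 / 2)"
    by (intro divide_left_mono) auto
  with omega_le[OF assms] show ?thesis by simp
qed

lemma omega_measurable [measurable]: "omega \<in> borel_measurable borel"
  unfolding omega_def by measurable

lemma absolutely_integrable_decay:
  fixes f :: "real \<Rightarrow> 'a :: euclidean_space"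
  assumes [measurable]: "f \<in> borel_measurable borel"
    and le: "\<And>x. x \<ge> 1 \<Longrightarrow> norm (f x) \<le> C * (x powr p * exp (- x))"
  shows "f absolutely_integrable_on {1..}"
proof (rule measurable_bounded_by_integrable_imp_absolutely_integrable)
  show "f \<in> borel_measurable (lebesgue_on {1..})"
    using assms(1) by (intro measurable_restrict_space1 measurable_completion) simp
  \<comment> \<open>The exponent \<open>r - 1\<close> is at least 0, so the Gamma integral used as
    majorant also converges at 0, and at least \<open>p\<close>, so it dominates on x >= 1.\<close>
  define r where "r = max p 0 + 1"
  have "(\<lambda>x. x powr (r - 1) * exp (- 1 * x)) absolutely_integrable_on {0<..}"
    by (rule Gamma_integral_scaled(2)) (auto simp: r_def)
  hence "(\<lambda>x. x powr (r - 1) * exp (- 1 * x)) absolutely_integrable_on {1..}"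
    by (rule set_integrable_subset) auto
  hence "(\<lambda>x. x powr (r - 1) * exp (- 1 * x)) integrable_on {1..}"
    by (rule set_lebesgue_integral_eq_integral(1))
  thus "(\<lambda>x. \<bar>C\<bar> * (x powr (r - 1) * exp (- 1 * x))) integrable_on {1..}"
    by (rule integrable_on_mult_right)
  fix x :: real assume "x \<in> {1..}"
  hence x: "x \<ge> 1" by simp
  have "norm (f x) \<le> C * (x powr p * exp (- x))" by (rule le[OF x])
  also have "\<dots> \<le> \<bar>C\<bar> * (x powr p * exp (- x))" by (intro mult_right_mono) auto
  also have "\<dots> \<le> \<bar>C\<bar> * (x powr (r - 1) * exp (- 1 * x))"
    using x by (intro mult_left_mono mult_mono powr_mono) (auto simp: r_def)
  finally show "norm (f x) \<le> \<bar>C\<bar> * (x powr (r - 1) * exp (- 1 * x))" .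
qed auto

text \<open>The part over [1, oo) of the Mellin transform of \<open>omega\<close>, differentiated k
  times in z. It is entire, unlike the full transform.\<close>

definition omega_mellin :: "nat \<Rightarrow> complex \<Rightarrow> complex" where
  "omega_mellin k z = integral {1..} (\<lambda>x. of_real (omega x * ln x ^ k) * exp ((z - 1) * of_real (ln x)))"

lemma omega_mellin_integrand_bound:
  assumes x: "x \<ge> 1"
  shows "omega x * ln x ^ k * x powr p \<le> 2 * (x powr (p + real k) * exp (- x))"
proof -
  have "omega x * (ln x ^ k * x powr p) \<le> (2 * exp (- pi * x)) * (x ^ k * x powr p)"
    using x omega_le'[OF x] ln_bound[of x] by (intro mult_mono power_mono) auto
  also have "\<dots> = 2 * exp (- pi * x) * x powr (p + real k)"
    using x by (simp add: powr_add powr_realpow)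
  also have "\<dots> \<le> 2 * exp (- x) * x powr (p + real k)"
  proof -
    have "1 * x \<le> pi * x" using x pi_ge_two by (intro mult_right_mono) auto
    thus ?thesis by (intro mult_right_mono mult_left_mono) auto
  qed
  finally show ?thesis by (simp add: mult_ac)
qed

lemma norm_omega_mellin_integrand:
  assumes "x \<ge> 1"
  shows "norm (of_real (omega x * ln x ^ k) * exp ((z - 1) * of_real (ln x)) :: complex) = omega x * ln x ^ k * x powr (Re z - 1)"
  using assms omega_nonneg[of x] by (simp add: norm_mult norm_power powr_def)

lemma omega_mellin_abs_integrable:
  "(\<lambda>x. of_real (omega x * ln x ^ k) * exp ((z - 1) * of_real (ln x)) :: complex) absolutely_integrable_on {1..}"
  by (rule absolutely_integrable_decay[where C = 2 and p = "Re z - 1 + real k"])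
     (measurable, use norm_omega_mellin_integrand omega_mellin_integrand_bound in simp)

lemma omega_mellin_has_integral:
  "((\<lambda>x. of_real (omega x * ln x ^ k) * exp ((z - 1) * of_real (ln x))) has_integral omega_mellin k z) {1..}"
  unfolding omega_mellin_def
  by (intro integrable_integral set_lebesgue_integral_eq_integral(1)[OF omega_mellin_abs_integrable])

lemma omega_moment_abs_integrable:
  "(\<lambda>x. omega x * ln x ^ k * x powr p) absolutely_integrable_on {1..}"
proof (rule absolutely_integrable_decay[where C = 2 and p = "p + real k"])
  fix x :: real assume x: "x \<ge> 1"
  have "norm (omega x * ln x ^ k * x powr p) = omega x * ln x ^ k * x powr p"
    using x omega_nonneg[of x] by simp
  thus "norm (omega x * ln x ^ k * x powr p) \<le> 2 * (x powr (p + real k) * exp (- x))"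
    using omega_mellin_integrand_bound[OF x] by simp
qed measurable

text \<open>Differentiation under the integral with an explicit remainder: w = h ln x with |h| <= 1
  satisfies exp |Re w| <= x, so the second-order remainder of exp w costs only one power of x and an
  integrable factor (ln x)^2.\<close>

lemma omega_mellin_has_derivative:
  "(omega_mellin k has_field_derivative omega_mellin (Suc k) z) (at z)"
proof -
  define C where "C = integral {1..} (\<lambda>x. omega x * ln x ^ (k + 2) * x powr (Re z))"
  have bound: "norm (omega_mellin k (z + h) - omega_mellin k z - h * omega_mellin (Suc k) z) \<le> C * (norm h)\<^sup>2"
    if h: "norm h \<le> 1" for h
  proof -
    have I: "((\<lambda>x. of_real (omega x * ln x ^ k) * exp ((z + h - 1) * of_real (ln x)) - of_real (omega x * ln x ^ k) * exp ((z - 1) * of_real (ln x)) 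
        - h * (of_real (omega x * ln x ^ Suc k) * exp ((z - 1) * of_real (ln x)))) has_integral
       (omega_mellin k (z + h) - omega_mellin k z - h * omega_mellin (Suc k) z)) {1..}"
      by (intro has_integral_diff has_integral_mult_right omega_mellin_has_integral)
    have J: "((\<lambda>x. (norm h)\<^sup>2 * (omega x * ln x ^ (k + 2) * x powr (Re z))) has_integral (norm h)\<^sup>2 * C) {1..}"
      unfolding C_def
      by (intro has_integral_mult_right integrable_integral set_lebesgue_integral_eq_integral(1)[OF omega_moment_abs_integrable])
    have "norm (integral {1..} (\<lambda>x. of_real (omega x * ln x ^ k) * exp ((z + h - 1) * of_real (ln x)) - of_real (omega x * ln x ^ k) * exp ((z - 1) * of_real (ln x)) 
        - h * (of_real (omega x * ln x ^ Suc k) * exp ((z - 1) * of_real (ln x))))) \<le> integral {1..} (\<lambda>x. (norm h)\<^sup>2 * (omega x * ln x ^ (k + 2) * x powr (Re z)))"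
    proof (rule Henstock_Kurzweil_Integration.integral_norm_bound_integral)
      fix x :: real assume "x \<in> {1..}"
      hence x: "x \<ge> 1" by simp
      let ?L = "complex_of_real (ln x)"
      have l: "ln x \<ge> 0" using x by simp
      have "of_real (omega x * ln x ^ k) * exp ((z + h - 1) * ?L) - of_real (omega x * ln x ^ k) * exp ((z - 1) * ?L) 
        - h * (of_real (omega x * ln x ^ Suc k) * exp ((z - 1) * ?L))
        = of_real (omega x * ln x ^ k) * exp ((z - 1) * ?L) * (exp (h * ?L) - 1 - h * ?L)"
      proof -
        have e: "(z + h - 1) * ?L = (z - 1) * ?L + h * ?L" by (simp add: algebra_simps)
        show ?thesis unfolding e exp_add by (simp add: algebra_simps)
      qed
      hence "norm (of_real (omega x * ln x ^ k) * exp ((z + h - 1) * ?L) - of_real (omega x * ln x ^ k) * exp ((z - 1) * ?L) 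
        - h * (of_real (omega x * ln x ^ Suc k) * exp ((z - 1) * ?L)))
        = omega x * ln x ^ k * x powr (Re z - 1) * norm (exp (h * ?L) - 1 - h * ?L)"
        using norm_omega_mellin_integrand[OF x, of k z] by (simp only: norm_mult)
      also have "\<dots> \<le> omega x * ln x ^ k * x powr (Re z - 1) * (x * (norm h * ln x)\<^sup>2)"
      proof (intro mult_left_mono)
        have "\<bar>Re (h * ?L)\<bar> = \<bar>Re h\<bar> * ln x" using l by (simp add: abs_mult)
        also have "\<dots> \<le> 1 * ln x" using h abs_Re_le_cmod[of h] l by (intro mult_right_mono) auto
        finally have "exp \<bar>Re (h * ?L)\<bar> \<le> x" using x by (metis exp_le_cancel_iff exp_ln less_le_trans mult_1 zero_less_one)
        hence "exp \<bar>Re (h * ?L)\<bar> * (norm (h * ?L))\<^sup>2 \<le> x * (norm (h * ?L))\<^sup>2" by (intro mult_right_mono) auto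
        with exp_minus_1_minus_self_bound[of "h * ?L"]
        have "norm (exp (h * ?L) - 1 - h * ?L) \<le> x * (norm (h * ?L))\<^sup>2" by (rule order.trans)
        moreover have "norm (h * ?L) = norm h * ln x" using l by (simp add: norm_mult)
        ultimately show "norm (exp (h * ?L) - 1 - h * ?L) \<le> x * (norm h * ln x)\<^sup>2" by (simp only:)
      qed (use x l omega_nonneg[of x] in simp)
      also have "\<dots> = (norm h)\<^sup>2 * (omega x * ln x ^ (k + 2) * (x * x powr (Re z - 1)))"
        by (simp add: power_mult_distrib power_add mult_ac power2_eq_square)
      also have "x * x powr (Re z - 1) = x powr (Re z)" using x by (simp add: powr_diff)
      finally show "norm (of_real (omega x * ln x ^ k) * exp ((z + h - 1) * ?L) - of_real (omega x * ln x ^ k) * exp ((z - 1) * ?L) 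
        - h * (of_real (omega x * ln x ^ Suc k) * exp ((z - 1) * ?L))) \<le> (norm h)\<^sup>2 * (omega x * ln x ^ (k + 2) * x powr (Re z))" .
    qed (use I J in \<open>auto simp: has_integral_integrable\<close>)
    thus ?thesis by (simp only: integral_unique[OF I] integral_unique[OF J] mult.commute[of C])
  qed
  have "((\<lambda>h. (omega_mellin k (z + h) - omega_mellin k z) / h - omega_mellin (Suc k) z) \<longlongrightarrow> 0) (at 0)"
  proof (rule Lim_null_comparison)
    show "\<forall>\<^sub>F h in at 0. norm ((omega_mellin k (z + h) - omega_mellin k z) / h - omega_mellin (Suc k) z) \<le> C * norm h"
      unfolding eventually_at
    proof (intro exI[of _ 1] conjI ballI impI)
      fix h :: complex assume "h \<noteq> 0 \<and> dist h 0 < 1"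
      hence h: "h \<noteq> 0" "norm h \<le> 1" by auto
      have "(omega_mellin k (z + h) - omega_mellin k z) / h - omega_mellin (Suc k) z = (omega_mellin k (z + h) - omega_mellin k z - h * omega_mellin (Suc k) z) / h"
        using h by (simp add: field_simps)
      thus "norm ((omega_mellin k (z + h) - omega_mellin k z) / h - omega_mellin (Suc k) z) \<le> C * norm h"
        using bound[OF h(2)] h(1) by (simp add: norm_divide field_simps power2_eq_square)
    qed auto
    show "((\<lambda>h. C * norm h) \<longlongrightarrow> 0) (at (0::complex))" by (auto intro!: tendsto_eq_intros)
  qed
  thus ?thesis unfolding DERIV_def by (simp add: LIM_zero_iff)
qed

lemma omega_mellin_cnj: "omega_mellin k (cnj z) = cnj (omega_mellin k z)"
proof -
  have "((\<lambda>x. cnj (of_real (omega x * ln x ^ k) * exp ((z - 1) * of_real (ln x)))) has_integral cnj (omega_mellin k z)) {1..}"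
    using has_integral_linear[OF omega_mellin_has_integral bounded_linear_cnj] by (simp only: o_def)
  hence "((\<lambda>x. of_real (omega x * ln x ^ k) * exp ((cnj z - 1) * of_real (ln x))) has_integral cnj (omega_mellin k z)) {1..}"
    by (simp add: exp_cnj)
  thus ?thesis using omega_mellin_has_integral[of k "cnj z"] has_integral_unique by blast
qed

lemma omega_mellin_of_real:
  "omega_mellin k (of_real p) = of_real (integral {1..} (\<lambda>x. omega x * ln x ^ k * x powr (p - 1)))"
proof -
  have "((\<lambda>x. omega x * ln x ^ k * x powr (p - 1)) has_integral integral {1..} (\<lambda>x. omega x * ln x ^ k * x powr (p - 1))) {1..}"
    by (intro integrable_integral set_lebesgue_integral_eq_integral(1)[OF omega_moment_abs_integrable])
  hence "((\<lambda>x. complex_of_real (omega x * ln x ^ k * x powr (p - 1))) has_integral of_real (integral {1..} (\<lambda>x. omega x * ln x ^ k * x powr (p - 1)))) {1..}"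
    by (rule has_integral_of_real)
  hence "((\<lambda>x. of_real (omega x * ln x ^ k) * exp ((of_real p - 1) * of_real (ln x))) has_integral complex_of_real (integral {1..} (\<lambda>x. omega x * ln x ^ k * x powr (p - 1)))) {1..}"
    by (rule has_integral_eq[rotated]) (simp add: powr_def flip: exp_of_real)
  thus ?thesis using omega_mellin_has_integral has_integral_unique by blast
qed

lemma omega_inverse:
  assumes "y > 0" shows "omega (1 / y) = sqrt y * omega y + (sqrt y - 1) / 2"
  using omega_functional_equation[OF assms] by (simp add: field_simps)

text \<open>The substitution x = 1 / y and the functional equation send the part over (0, 1] to one
  over [1, oo) at 1/2 - z. The elementary term (sqrt y - 1) / 2 contributes the two rational
  summands; its integral converges because z > 1/2.\<close>

lemma omega_mellin_01:
  fixes z :: real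
  assumes z: "z > 1/2"
  defines "m \<equiv> integral {1..} (\<lambda>x. omega x * ln x ^ 0 * x powr ((1/2 - z) - 1))"
  shows "((\<lambda>x. omega x * x powr (z - 1)) has_integral (m + 1 / (2 * z - 1) - 1 / (2 * z))) {0<..1}"
proof -
  define f where "f = (\<lambda>x. omega x * x powr (z - 1))"
  have im: "(\<lambda>y. 1 / y) ` {1..} = {0<..(1::real)}"
  proof (intro equalityI subsetI)
    fix x :: real assume "x \<in> {0<..1}"
    hence "x = 1 / (1 / x)" "1 / x \<in> {1..}" by auto
    thus "x \<in> (\<lambda>y. 1 / y) ` {1..}" by blast
  qed auto
  have d: "((\<lambda>y. 1 / y) has_real_derivative (- 1 / x^2)) (at x within {1..})" if "x \<in> {1..}" for x :: real
    using that by (auto intro!: derivative_eq_intros simp: power2_eq_square)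

  have inj: "inj_on (\<lambda>y::real. 1 / y) {1..}" by (auto simp: inj_on_def)
  define h where "h = (\<lambda>y. omega y * ln y ^ 0 * y powr ((1/2 - z) - 1) + (1/2) * y powr (- 1/2 - z) - (1/2) * y powr (- 1 - z))"
  have p1: "((\<lambda>y. y powr (- 1/2 - z)) has_integral 1 / (z - 1/2)) {1..}"
  proof -
    have "- (1 powr ((- 1/2 - z) + 1)) / ((- 1/2 - z) + 1) = 1 / (z - 1/2)" using z by (simp add: divide_simps)
    thus ?thesis using has_integral_powr_to_inf[of "- 1/2 - z" 1] z by simp
  qed
  have p2: "((\<lambda>y. y powr (- 1 - z)) has_integral 1 / z) {1..}"
  proof -
    have "- (1 powr ((- 1 - z) + 1)) / ((- 1 - z) + 1) = 1 / z" using z by (simp add: divide_simps)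
    thus ?thesis using has_integral_powr_to_inf[of "- 1 - z" 1] z by simp
  qed
  have hI: "(h has_integral (m + 1/2 * (1 / (z - 1/2)) - 1/2 * (1 / z))) {1..}"
    unfolding h_def m_def
    by (intro has_integral_diff has_integral_add has_integral_mult_right p1 p2
         integrable_integral set_lebesgue_integral_eq_integral(1)[OF omega_moment_abs_integrable])
  have pa: "(\<lambda>y. y powr (- 1/2 - z)) absolutely_integrable_on {1..}" "(\<lambda>y. y powr (- 1 - z)) absolutely_integrable_on {1..}"
    using p1 p2 by (auto intro!: nonnegative_absolutely_integrable_1 has_integral_integrable)
  have ha: "h absolutely_integrable_on {1..}"
    unfolding h_def by (intro set_integral_diff(1) set_integral_add(1) omega_moment_abs_integrable set_integrable_mult_right pa)
  have eq: "\<bar>- 1 / y^2\<bar> * f (1 / y) = h y" if "y \<in> {1..}" for y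
  proof -
    have y: "y \<ge> 1" "y > 0" using that by auto
    have "\<bar>- 1 / y^2\<bar> * (1 / y) powr (z - 1) = y powr (- 1 - z)"
    proof -
      have "1 / y^2 = y powr (-2)" using y by (simp add: powr_minus powr_numeral field_simps)
      moreover have "(1 / y) powr (z - 1) = y powr (- (z - 1))"
        using y by (simp only: powr_minus_divide powr_divide powr_one_eq_one)
      ultimately have "\<bar>- 1 / y^2\<bar> * (1 / y) powr (z - 1) = y powr (-2 + - (z - 1))" using y by (simp only: powr_add) simp
      thus ?thesis by (simp add: algebra_simps)
    qed
    hence "\<bar>- 1 / y^2\<bar> * f (1 / y) = (sqrt y * omega y + (sqrt y - 1) / 2) * y powr (- 1 - z)"
      unfolding f_def omega_inverse[OF y(2)] by (metis mult.assoc mult.commute)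
    also have "\<dots> = omega y * (y powr (1/2) * y powr (- 1 - z)) + (1/2) * (y powr (1/2) * y powr (- 1 - z)) - (1/2) * y powr (- 1 - z)"
      using y by (simp add: powr_half_sqrt field_simps)
    also have "y powr (1/2) * y powr (- 1 - z) = y powr (- 1/2 - z)" by (simp flip: powr_add)
    finally show ?thesis by (simp add: h_def)
  qed
  have iff: "(\<lambda>y. \<bar>- 1 / y^2\<bar> * f (1 / y)) absolutely_integrable_on {1..} \<and> integral {1..} (\<lambda>y. \<bar>- 1 / y^2\<bar> * f (1 / y)) = integral {1..} h
     \<longleftrightarrow> f absolutely_integrable_on ((\<lambda>y. 1 / y) ` {1..}) \<and> integral ((\<lambda>y. 1 / y) ` {1..}) f = integral {1..} h"
    by (rule has_absolute_integral_change_of_variables_1'[where g = "\<lambda>y. 1 / y" and g' = "\<lambda>y. - 1 / y^2", OF _ d inj]) simp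
  have a: "(\<lambda>y. \<bar>- 1 / y^2\<bar> * f (1 / y)) absolutely_integrable_on {1..}"
    by (rule absolutely_integrable_spike[OF ha negligible_empty]) (rule eq, simp)
  have b: "integral {1..} (\<lambda>y. \<bar>- 1 / y^2\<bar> * f (1 / y)) = integral {1..} h"
    by (rule Henstock_Kurzweil_Integration.integral_cong[OF eq])
  from iff a b have "f absolutely_integrable_on {0<..1}" "integral {0<..1} f = integral {1..} h"
    unfolding im by blast+
  hence "(f has_integral integral {1..} h) {0<..1}"
    by (metis integrable_integral set_lebesgue_integral_eq_integral(1))
  thus ?thesis using z unfolding integral_unique[OF hI] f_def by (simp add: field_simps)
qed

lemma omega_mellin_full:
  fixes z :: real
  assumes z: "z > 1/2"
  shows "((\<lambda>x. omega x * x powr (z - 1)) has_integral 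
     (integral {1..} (\<lambda>x. omega x * ln x ^ 0 * x powr ((1/2 - z) - 1)) + 1 / (2 * z - 1) - 1 / (2 * z)
      + integral {1..} (\<lambda>x. omega x * ln x ^ 0 * x powr (z - 1)))) {0<..}"
proof -
  have "((\<lambda>x. omega x * ln x ^ 0 * x powr (z - 1)) has_integral integral {1..} (\<lambda>x. omega x * ln x ^ 0 * x powr (z - 1))) {1..}"
    by (intro integrable_integral set_lebesgue_integral_eq_integral(1)[OF omega_moment_abs_integrable])
  hence 1: "((\<lambda>x. omega x * x powr (z - 1)) has_integral integral {1..} (\<lambda>x. omega x * ln x ^ 0 * x powr (z - 1))) {1..}"
    by simp

  have u: "{0<..} = {0<..1} \<union> {1::real..}" by auto
  show ?thesis unfolding u
    by (rule has_integral_Un[OF omega_mellin_01[OF z] 1]) (rule negligible_subset[of "{1}"], auto)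
qed

text \<open>Termwise integration: each term is a Gamma integral and the partial sums are dominated
  by \<open>omega\<close> itself. At z = s / 2 this is Riemann's integral formula for pi^(-s/2)
  Gamma(s/2) zeta(s).\<close>

lemma omega_mellin_series:
  fixes z :: real
  assumes z: "z > 1/2"
  shows "(\<lambda>n. Gamma z * pi powr (- z) * real (Suc n) powr (- 2 * z)) sums
     (integral {1..} (\<lambda>x. omega x * ln x ^ 0 * x powr ((1/2 - z) - 1)) + 1 / (2 * z - 1) - 1 / (2 * z)
      + integral {1..} (\<lambda>x. omega x * ln x ^ 0 * x powr (z - 1)))"
proof -
  define F where "F = (\<lambda>N x. \<Sum>n<N. x powr (z - 1) * exp (- (pi * (real (Suc n))\<^sup>2) * x))"
  have FI: "(F N has_integral (\<Sum>n<N. Gamma z * (pi * (real (Suc n))\<^sup>2) powr (- z))) {0<..}" for N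
    unfolding F_def by (intro has_integral_sum Gamma_integral_scaled) (use z in auto)
  have lim: "(\<lambda>N. F N x) \<longlonglongrightarrow> omega x * x powr (z - 1)" if x: "x \<in> {0<..}" for x
  proof -
    have "(\<lambda>n. exp (- pi * (real (Suc n))\<^sup>2 * x)) sums omega x"
      unfolding omega_def using x by (intro summable_sums summable_omega) auto
    from sums_mult2[OF this, of "x powr (z - 1)"] show ?thesis
      unfolding F_def sums_def by (simp add: mult.commute[of "x powr (z - 1)"] mult.commute[of x] mult.assoc del: of_nat_Suc)
  qed
  have le: "norm (F N x) \<le> omega x * x powr (z - 1)" if x: "x \<in> {0<..}" for N x
  proof -
    have "(\<Sum>n<N. exp (- pi * (real (Suc n))\<^sup>2 * x)) \<le> omega x"
      unfolding omega_def using x by (intro sum_le_suminf summable_omega) auto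
    hence "(\<Sum>n<N. exp (- pi * (real (Suc n))\<^sup>2 * x)) * x powr (z - 1) \<le> omega x * x powr (z - 1)"
      by (intro mult_right_mono) auto
    moreover have "F N x = (\<Sum>n<N. exp (- pi * (real (Suc n))\<^sup>2 * x)) * x powr (z - 1)"
      by (simp add: F_def sum_distrib_right mult_ac sum_distrib_left del: of_nat_Suc)
    moreover have "F N x \<ge> 0" unfolding F_def by (intro sum_nonneg) auto
    ultimately show ?thesis by simp
  qed
  have "(\<lambda>N. integral {0<..} (F N)) \<longlonglongrightarrow> integral {0<..} (\<lambda>x. omega x * x powr (z - 1))"
    by (rule dominated_convergence(2)[OF has_integral_integrable[OF FI] has_integral_integrable[OF omega_mellin_full[OF z]]])
       (use le lim in auto)
  moreover have "(pi * (real (Suc n))\<^sup>2) powr (- z) = pi powr (- z) * real (Suc n) powr (- 2 * z)" for n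
  proof -
    have "(pi * (real (Suc n))\<^sup>2) powr (- z) = pi powr (- z) * (real (Suc n) powr 2) powr (- z)"
      by (simp add: powr_mult powr_numeral del: of_nat_Suc)
    thus ?thesis by (simp only: powr_powr) simp
  qed
  ultimately show ?thesis
    unfolding integral_unique[OF FI] integral_unique[OF omega_mellin_full[OF z]] sums_def
    by (simp only: mult.assoc)
qed

subsection \<open>The continuation of zeta\<close>

text \<open>Riemann's xi function s (s - 1) / 2 * pi^(-s/2) Gamma(s/2) zeta(s). The pole terms 1 /
  (s - 1) - 1 / s of the Mellin formula, multiplied by s (s - 1), become the summand 1, so the
  expression is visibly entire and symmetric.\<close>

definition xi :: "complex \<Rightarrow> complex" where
  "xi s = (s * (s - 1) * (omega_mellin 0 (s / 2) + omega_mellin 0 ((1 - s) / 2)) + 1) / 2"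

lemma xi_symmetric: "xi (1 - s) = xi s"
  by (simp add: xi_def algebra_simps)

lemma omega_mellin_holomorphic: "omega_mellin k holomorphic_on A"
  using omega_mellin_has_derivative by (auto simp: holomorphic_on_def field_differentiable_def intro: DERIV_subset)

lemma omega_mellin_holomorphic' [holomorphic_intros]:
  "f holomorphic_on A \<Longrightarrow> (\<lambda>z. omega_mellin k (f z)) holomorphic_on A"
  using holomorphic_on_compose[OF _ omega_mellin_holomorphic] by (simp add: o_def)

lemma xi_holomorphic [holomorphic_intros]: "xi holomorphic_on A"
  unfolding xi_def[abs_def] by (intro holomorphic_intros) auto

lemma xi_cnj: "xi (cnj s) = cnj (xi s)"
proof -
  have "cnj s / 2 = cnj (s / 2)" "(1 - cnj s) / 2 = cnj ((1 - s) / 2)" by simp_all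
  thus ?thesis unfolding xi_def by (simp only: omega_mellin_cnj) simp
qed

section \<open>Comparison with the Dirichlet series\<close>

lemma Dirichlet_series_holomorphic:
  "(\<lambda>s. \<Sum>n. of_nat (Suc n) powr (- s)) holomorphic_on {s. Re s > 1}"
proof (rule holomorphic_suminf)
  show "open {s. 1 < Re s}" by (rule open_halfspace_Re_gt)
  show "(\<lambda>s. of_nat (Suc n) powr (- s)) holomorphic_on {s. 1 < Re s}" for n
    by (intro holomorphic_intros) (simp_all del: of_nat_Suc)
next
  fix z :: complex assume z: "z \<in> {s. 1 < Re s}"
  define d where "d = (Re z - 1) / 2"
  have d: "d > 0" using z by (simp add: d_def)
  have re: "Re w \<ge> 1 + d" if "w \<in> cball z d" for w
  proof -
    have "\<bar>Re z - Re w\<bar> \<le> d" using that abs_Re_le_cmod[of "z - w"] by (simp add: dist_norm)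
    thus ?thesis unfolding d_def by argo
  qed
  show "\<exists>d>0. \<exists>b. cball z d \<subseteq> {s. 1 < Re s} \<and> summable b \<and> (\<forall>n. \<forall>w\<in>cball z d. norm (of_nat (Suc n) powr (- w) :: complex) \<le> b n)"
  proof (intro exI conjI allI ballI)
    show "d > 0" by (rule d)
    show "cball z d \<subseteq> {s. 1 < Re s}" using re d by force
    show "summable (\<lambda>n. real (Suc n) powr (- (1 + d)))"
      using d by (subst summable_Suc_iff) (simp add: summable_real_powr_iff)
    fix n w assume "w \<in> cball z d"
    from re[OF this] have "real (Suc n) powr (- Re w) \<le> real (Suc n) powr (- (1 + d))"
      by (intro powr_mono) simp_all
    moreover have "norm (of_nat (Suc n) powr (- w) :: complex) = real (Suc n) powr (- Re w)"
      using norm_powr_real_powr[of "of_nat (Suc n)" "- w"] by (simp del: of_nat_Suc)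
    ultimately show "norm (of_nat (Suc n) powr (- w) :: complex) \<le> real (Suc n) powr (- (1 + d))" by simp
  qed
qed

lemma Dirichlet_series_summable:
  assumes "Re s > 1" shows "summable (\<lambda>n. of_nat (Suc n) powr (- s) :: complex)"
proof (rule summable_norm_cancel)
  have "norm (of_nat (Suc n) powr (- s) :: complex) = real (Suc n) powr (- Re s)" for n
    using norm_powr_real_powr[of "of_nat (Suc n)" "- s"] by (simp del: of_nat_Suc)
  moreover have "summable (\<lambda>n. real (Suc n) powr (- Re s))"
    using assms by (subst summable_Suc_iff) (simp add: summable_real_powr_iff)
  ultimately show "summable (\<lambda>n. norm (of_nat (Suc n) powr (- s) :: complex))" by simp
qed

text \<open>The definition of \<open>xi\<close> solved for zeta. Since s / 2 * Gamma(s/2) =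
  Gamma(s/2 + 1), taking the reciprocal Gamma function at s / 2 + 1 leaves s - 1 as the only
  denominator.\<close>

definition zeta_formula :: "complex \<Rightarrow> complex" where
  "zeta_formula s = xi s * of_real pi powr (s / 2) * rGamma (s / 2 + 1) / (s - 1)"

lemma zeta_formula_holomorphic: "zeta_formula holomorphic_on - {1}"
  unfolding zeta_formula_def[abs_def] by (intro holomorphic_intros) auto

lemma zeta_formula_real:
  fixes \<sigma> :: real assumes "\<sigma> > 1"
  shows "zeta_formula (of_real \<sigma>) = (\<Sum>n. of_nat (Suc n) powr (- of_real \<sigma>))"
proof -
  define z where "z = \<sigma> / 2"
  have z: "z > 1/2" "\<sigma> = 2 * z" using assms by (auto simp: z_def)
  define m1 where "m1 = integral {1..} (\<lambda>x. omega x * ln x ^ 0 * x powr ((1/2 - z) - 1))"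
  define m2 where "m2 = integral {1..} (\<lambda>x. omega x * ln x ^ 0 * x powr (z - 1))"
  have G: "Gamma z > 0" using z by (intro Gamma_real_pos) auto
  have P: "pi powr z > 0" by simp
  have s: "(\<lambda>n. Gamma z * pi powr (- z) * real (Suc n) powr (- 2 * z)) sums (m1 + 1 / (2 * z - 1) - 1 / (2 * z) + m2)"
    unfolding m1_def m2_def by (rule omega_mellin_series[OF z(1)])
  define W where "W = (m1 + 1 / (2 * z - 1) - 1 / (2 * z) + m2) * (pi powr z / Gamma z)"
  have "(\<lambda>n. Gamma z * pi powr (- z) * real (Suc n) powr (- 2 * z) * (pi powr z / Gamma z)) sums W"
    unfolding W_def by (rule sums_mult2[OF s])
  moreover have "Gamma z * pi powr (- z) * real (Suc n) powr (- 2 * z) * (pi powr z / Gamma z) = real (Suc n) powr (- \<sigma>)" for n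
    using G z(2) P by (simp add: powr_minus less_imp_neq[THEN not_sym] del: of_nat_Suc)
  ultimately have "(\<lambda>n. real (Suc n) powr (- \<sigma>)) sums W" by simp
  from sums_of_real[OF this, where 'a = complex]
  have "(\<lambda>n. of_nat (Suc n) powr (- of_real \<sigma>) :: complex) sums of_real W"
    by (simp add: powr_of_real[symmetric] del: of_nat_Suc)
  hence 1: "(\<Sum>n. of_nat (Suc n) powr (- of_real \<sigma>)) = complex_of_real W" by (simp add: sums_iff)
  have "xi (of_real \<sigma>) = of_real ((2 * z) * (2 * z - 1) * (m2 + m1) + 1) / 2"
  proof -
    have "complex_of_real \<sigma> / 2 = of_real z" "(1 - complex_of_real \<sigma>) / 2 = of_real (1/2 - z)" by (simp_all add: z(2) field_simps)
    thus ?thesis unfolding xi_def by (simp only: omega_mellin_of_real m1_def m2_def) (simp add: z(2))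
  qed
  hence "zeta_formula (of_real \<sigma>) = of_real (((2 * z) * (2 * z - 1) * (m2 + m1) + 1) / 2 * pi powr z * rGamma (z + 1) / (2 * z - 1))"
  proof -
    have e: "complex_of_real \<sigma> / 2 = of_real z" by (simp add: z(2))
    have e2: "complex_of_real \<sigma> - 1 = of_real (2 * z - 1)" by (simp add: z(2))
    have e3: "complex_of_real z + 1 = of_real (z + 1)" by simp
    assume "xi (of_real \<sigma>) = of_real ((2 * z) * (2 * z - 1) * (m2 + m1) + 1) / 2"
    thus ?thesis unfolding zeta_formula_def e e2 e3
      by (simp only: rGamma_complex_of_real powr_of_real pi_ge_zero of_real_mult of_real_divide of_real_numeral)
  qed
  also have "((2 * z) * (2 * z - 1) * (m2 + m1) + 1) / 2 * pi powr z * rGamma (z + 1) / (2 * z - 1) = W"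
  proof -
    have "Gamma (z + 1) = z * Gamma z" using z by (intro Gamma_plus1) (auto elim!: nonpos_Ints_cases)
    hence "rGamma (z + 1) = 1 / (z * Gamma z)" by (simp add: rGamma_inverse_Gamma divide_inverse)
    hence "pi powr z * rGamma (z + 1) = pi powr z / Gamma z / z" by simp
    moreover have "((2 * z) * (2 * z - 1) * (m2 + m1) + 1) / 2 * (p / z) / (2 * z - 1) = (m1 + 1 / (2 * z - 1) - 1 / (2 * z) + m2) * p" for p
      using z by (simp add: divide_simps) (simp add: algebra_simps)
    ultimately show ?thesis unfolding W_def by (simp only: mult.assoc[of _ "pi powr z" "rGamma (z + 1)"])
  qed
  finally show ?thesis using 1 by simp
qed

lemma holomorphic_eq_on_connected:
  assumes "f holomorphic_on A" "g holomorphic_on A" "open A" "connected A" "U \<subseteq> A" "p \<in> A" "p islimpt U"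
    and "\<And>z. z \<in> U \<Longrightarrow> f z = g z" "w \<in> A"
  shows "f w = g w"
  using analytic_continuation[of "\<lambda>z. f z - g z" A U p w] assms
  by (auto intro: holomorphic_intros)

text \<open>The Mellin transform was computed for real arguments only; the identity theorem carries
  the formula from a real ray to the half-plane.\<close>

lemma zeta_formula_Dirichlet:
  assumes "Re s > 1"
  shows "zeta_formula s = (\<Sum>n. of_nat (Suc n) powr (- s))"
proof (rule holomorphic_eq_on_connected[where f = zeta_formula and g = "\<lambda>s. \<Sum>n. of_nat (Suc n) powr (- s)" and A = "{s. Re s > 1}" and U = "of_real ` {2<..}" and p = "of_real 3"])
  show "zeta_formula holomorphic_on {s. 1 < Re s}" by (rule holomorphic_on_subset[OF zeta_formula_holomorphic]) auto
  show "open {s. 1 < Re s}" by (rule open_halfspace_Re_gt)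
  show "connected {s. 1 < Re s}" by (intro convex_connected convex_halfspace_Re_gt)
  show "complex_of_real 3 islimpt of_real ` {2<..}"
    unfolding islimpt_approachable
  proof (intro allI impI)
    fix e :: real assume "e > 0"
    show "\<exists>x'\<in>complex_of_real ` {2<..}. x' \<noteq> of_real 3 \<and> dist x' (of_real 3) < e"
    proof (intro bexI conjI)
      show "complex_of_real (3 + e / 2) \<noteq> of_real 3" unfolding of_real_eq_iff using \<open>e > 0\<close> by simp
      show "dist (complex_of_real (3 + e / 2)) (of_real 3) < e" unfolding dist_of_real using \<open>e > 0\<close> by (simp add: dist_real_def)
      show "complex_of_real (3 + e / 2) \<in> of_real ` {2<..}" using \<open>e > 0\<close> by (intro imageI) simp
    qed
  qed
  show "(\<lambda>s. \<Sum>n. of_nat (Suc n) powr (- s)) holomorphic_on {s. 1 < Re s}" by (rule Dirichlet_series_holomorphic)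
  show "zeta_formula z = (\<Sum>n. of_nat (Suc n) powr (- z))" if "z \<in> of_real ` {2<..}" for z
  proof -
    from that obtain x where x: "z = of_real x" "x \<in> {2<..}" by (rule imageE)
    hence "x > 1" by simp
    thus ?thesis unfolding x(1) by (rule zeta_formula_real)
  qed
  show "of_real ` {2<..} \<subseteq> {s. 1 < Re s}" by (rule image_subsetI) simp
  show "complex_of_real 3 \<in> {s. 1 < Re s}" by simp
  show "s \<in> {s. 1 < Re s}" using assms by simp
qed

theorem zeta_eq: "zeta = (\<lambda>s. if s = 1 then 0 else zeta_formula s)"
  unfolding zeta_def
proof (rule the_equality, intro conjI allI impI)
  let ?f = "\<lambda>s. if s = 1 then 0 else zeta_formula s"
  show "?f holomorphic_on - {1}"
    by (rule holomorphic_transform[OF zeta_formula_holomorphic]) auto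
  show "(\<lambda>n. of_nat (Suc n) powr (- s)) sums ?f s" if "Re s > 1" for s
    using that Dirichlet_series_summable[OF that] zeta_formula_Dirichlet[OF that] by (auto simp: sums_iff)
  show "?f 1 = 0" by simp
next
  fix f assume f: "f holomorphic_on - {1} \<and> (\<forall>s. Re s > 1 \<longrightarrow> (\<lambda>n. of_nat (Suc n) powr (- s)) sums f s) \<and> f 1 = 0"
  have "f s = zeta_formula s" if "s \<noteq> 1" for s
  proof (rule holomorphic_eq_on_connected[where f = f and g = zeta_formula and A = "- {1}" and U = "{s. Re s > 1}" and p = 3])
    show "f holomorphic_on - {1}" using f by blast
    show "connected (- {1 :: complex})" by (intro connected_punctured_universe) auto
    show "3 islimpt {s. 1 < Re s}" by (rule open_imp_islimpt) (auto intro: open_halfspace_Re_gt)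
    show "f z = zeta_formula z" if "z \<in> {s. 1 < Re s}" for z
      using f that zeta_formula_Dirichlet[of z] by (auto simp: sums_iff)
    show "s \<in> - {1}" using that by simp
  qed (use zeta_formula_holomorphic in auto)
  thus "f = (\<lambda>s. if s = 1 then 0 else zeta_formula s)" using f by auto
qed

subsection \<open>Real analytic functions\<close>

text \<open>A holomorphic extension to a complex disc around x. Real analyticity is equivalent to
  its existence at every point, so closure properties reduce to those of holomorphic
  functions.\<close>

definition extends_near :: "(real \<Rightarrow> real) \<Rightarrow> real \<Rightarrow> real \<Rightarrow> (complex \<Rightarrow> complex) \<Rightarrow> bool" where
  "extends_near f x r F \<longleftrightarrow> r > 0 \<and> F holomorphic_on ball (of_real x) r \<and> (\<forall>y. \<bar>y - x\<bar> < r \<longrightarrow> F (of_real y) = of_real (f y))"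

lemma of_real_mem_ball: "complex_of_real y \<in> ball (of_real x) r \<longleftrightarrow> \<bar>y - x\<bar> < r"
  by (simp add: dist_norm abs_minus_commute flip: of_real_diff)

lemma extends_near_mono:
  assumes "extends_near f x r F" "0 < r'" "r' \<le> r"
  shows "extends_near f x r' F"
proof -
  have "ball (complex_of_real x) r' \<subseteq> ball (of_real x) r" using assms(3) by (rule subset_ball)
  thus ?thesis using assms unfolding extends_near_def by (meson holomorphic_on_subset less_le_trans)
qed

lemma real_analyticD:
  assumes "real_analytic f" shows "\<exists>r F. extends_near f x r F"
proof -
  have "\<exists>r>0. \<exists>a. \<forall>y. \<bar>y - x\<bar> < r \<longrightarrow> (\<lambda>n. a n * (y - x) ^ n) sums f y"
    using assms unfolding real_analytic_def by (rule spec)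
  then obtain r a where r: "r > 0" and a: "\<And>y. \<bar>y - x\<bar> < r \<Longrightarrow> (\<lambda>n. a n * (y - x) ^ n) sums f y"
    by blast
  define F where "F = (\<lambda>z. \<Sum>n. complex_of_real (a n) * (z - of_real x) ^ n)"
  have s: "(\<lambda>n. complex_of_real (a n) * (w - of_real x) ^ n) sums F w" if w: "w \<in> ball (of_real x) r" for w
  proof -
    define d where "d = norm (w - of_real x)"
    have d: "d < r" "d \<ge> 0" using w by (auto simp: d_def dist_norm norm_minus_commute)
    \<comment> \<open>Convergence of the real series at a distance beyond that of \<open>w\<close>
      forces absolute convergence at the complex point \<open>w\<close>.\<close>
    obtain y where y: "d < y" "y < r" using d dense by blast
    have "(\<lambda>n. a n * (x + y - x) ^ n) sums f (x + y)" by (rule a) (use y d in simp)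
    hence "summable (\<lambda>n. a n * y ^ n)" by (simp add: sums_iff)
    from summable_of_real[OF this, where 'a = complex]
    have "summable (\<lambda>n. complex_of_real (a n) * of_real y ^ n)" by simp
    hence "summable (\<lambda>n. norm (complex_of_real (a n) * (w - of_real x) ^ n))"
      by (rule powser_insidea) (use y d in \<open>simp add: d_def\<close>)
    thus ?thesis unfolding F_def by (rule summable_sums[OF summable_norm_cancel])
  qed
  have "F holomorphic_on ball (of_real x) r"
    by (rule power_series_holomorphic[where a = "\<lambda>n. of_real (a n)"]) (rule s)
  moreover have "F (of_real y) = of_real (f y)" if "\<bar>y - x\<bar> < r" for y
  proof -
    have "(\<lambda>n. complex_of_real (a n * (y - x) ^ n)) sums of_real (f y)"
      using a[OF that] by (rule sums_of_real)
    moreover have "(\<lambda>n. complex_of_real (a n) * (of_real y - of_real x) ^ n) sums F (of_real y)"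
      by (rule s) (use that in \<open>simp only: of_real_mem_ball\<close>)
    ultimately show ?thesis by (simp add: sums_iff)
  qed
  ultimately show ?thesis using r unfolding extends_near_def by blast
qed

lemma real_analyticI:
  assumes "\<And>x. \<exists>r F. extends_near f x r F" shows "real_analytic f"
  unfolding real_analytic_def
proof
  fix x
  from assms[of x] obtain r F where F: "r > 0" "F holomorphic_on ball (of_real x) r"
    "\<And>y. \<bar>y - x\<bar> < r \<Longrightarrow> F (of_real y) = of_real (f y)"
    unfolding extends_near_def by blast
  define a where "a = (\<lambda>n. Re ((deriv ^^ n) F (of_real x) / fact n))"
  have "(\<lambda>n. a n * (y - x) ^ n) sums f y" if y: "\<bar>y - x\<bar> < r" for y
  proof -
    have "(\<lambda>n. (deriv ^^ n) F (of_real x) / fact n * (of_real y - of_real x) ^ n) sums F (of_real y)"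
      by (rule holomorphic_power_series[OF F(2)]) (use y in \<open>simp only: of_real_mem_ball\<close>)
    hence "(\<lambda>n. Re ((deriv ^^ n) F (of_real x) / fact n * (of_real y - of_real x) ^ n)) sums Re (F (of_real y))"
      by (rule sums_Re)
    moreover have "Re (c * (of_real y - of_real x) ^ n) = Re c * (y - x) ^ n" for c n
      by (simp flip: of_real_diff of_real_power)
    ultimately show ?thesis unfolding F(3)[OF y] a_def by (simp only: Re_complex_of_real)
  qed
  thus "\<exists>r>0. \<exists>a. \<forall>y. \<bar>y - x\<bar> < r \<longrightarrow> (\<lambda>n. a n * (y - x) ^ n) sums f y"
    using F(1) by blast
qed

lemma real_analytic_cong: "real_analytic f \<Longrightarrow> (\<And>x. f x = g x) \<Longrightarrow> real_analytic g"
  by (metis ext)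

lemma real_analytic_extends2:
  assumes "real_analytic f" "real_analytic g"
  obtains r F G where "extends_near f x r F" "extends_near g x r G"
proof -
  obtain r1 F where 1: "extends_near f x r1 F" using real_analyticD[OF assms(1)] by blast
  obtain r2 G where 2: "extends_near g x r2 G" using real_analyticD[OF assms(2)] by blast
  have "min r1 r2 > 0" using 1 2 by (simp add: extends_near_def)
  show ?thesis
    by (rule that[OF extends_near_mono[OF 1 \<open>min r1 r2 > 0\<close>] extends_near_mono[OF 2 \<open>min r1 r2 > 0\<close>]]) simp_all
qed

lemma real_analytic_add:
  assumes "real_analytic f" "real_analytic g" shows "real_analytic (\<lambda>x. f x + g x)"
proof (rule real_analyticI)
  fix x
  obtain r F G where "extends_near f x r F" "extends_near g x r G" using real_analytic_extends2[OF assms] .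
  hence "extends_near (\<lambda>x. f x + g x) x r (\<lambda>z. F z + G z)"
    unfolding extends_near_def by (auto intro: holomorphic_intros)
  thus "\<exists>r F. extends_near (\<lambda>x. f x + g x) x r F" by blast
qed

lemma real_analytic_diff:
  assumes "real_analytic f" "real_analytic g" shows "real_analytic (\<lambda>x. f x - g x)"
proof (rule real_analyticI)
  fix x
  obtain r F G where "extends_near f x r F" "extends_near g x r G" using real_analytic_extends2[OF assms] .
  hence "extends_near (\<lambda>x. f x - g x) x r (\<lambda>z. F z - G z)"
    unfolding extends_near_def by (auto intro: holomorphic_intros)
  thus "\<exists>r F. extends_near (\<lambda>x. f x - g x) x r F" by blast
qed

lemma real_analytic_mult:
  assumes "real_analytic f" "real_analytic g" shows "real_analytic (\<lambda>x. f x * g x)"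
proof (rule real_analyticI)
  fix x
  obtain r F G where "extends_near f x r F" "extends_near g x r G" using real_analytic_extends2[OF assms] .
  hence "extends_near (\<lambda>x. f x * g x) x r (\<lambda>z. F z * G z)"
    unfolding extends_near_def by (auto intro: holomorphic_intros)
  thus "\<exists>r F. extends_near (\<lambda>x. f x * g x) x r F" by blast
qed

lemma real_analytic_of_holomorphic:
  assumes "F holomorphic_on A" "open A" "\<And>x. of_real x \<in> A" "\<And>x. F (of_real x) = of_real (f x)"
  shows "real_analytic f"
proof (rule real_analyticI)
  fix x
  obtain r where "r > 0" "ball (of_real x) r \<subseteq> A" using assms(2,3) open_contains_ball by blast
  hence "extends_near f x r F" using assms by (auto simp: extends_near_def intro: holomorphic_on_subset)
  thus "\<exists>r F. extends_near f x r F" by blast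
qed

lemma real_analytic_comp:
  assumes "F holomorphic_on UNIV" "\<And>x. F (of_real x) = of_real (f x)" "real_analytic g"
  shows "real_analytic (\<lambda>x. f (g x))"
proof (rule real_analyticI)
  fix x
  obtain r G where "extends_near g x r G" using real_analyticD[OF assms(3)] by blast
  hence "extends_near (\<lambda>x. f (g x)) x r (\<lambda>z. F (G z))"
    unfolding extends_near_def using assms(2)
    by (auto intro!: holomorphic_on_compose_gen[OF _ assms(1), unfolded o_def])
  thus "\<exists>r F. extends_near (\<lambda>x. f (g x)) x r F" by blast
qed

lemma real_analytic_sin: "real_analytic g \<Longrightarrow> real_analytic (\<lambda>x. sin (g x))"
  by (rule real_analytic_comp[of sin]) (auto simp: sin_of_real intro: holomorphic_intros)

lemma real_analytic_cos: "real_analytic g \<Longrightarrow> real_analytic (\<lambda>x. cos (g x))"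
  by (rule real_analytic_comp[of cos]) (auto simp: cos_of_real intro: holomorphic_intros)

lemma real_analytic_const: "real_analytic (\<lambda>_. c)"
  by (rule real_analytic_of_holomorphic[of "\<lambda>_. of_real c" UNIV]) auto

lemma extends_near_derivative:
  assumes "extends_near f x r F" "\<bar>y - x\<bar> < r"
  shows "(f has_real_derivative deriv f y) (at y)" "deriv F (of_real y) = of_real (deriv f y)"
proof -
  have F: "F holomorphic_on ball (of_real x) r" "\<And>y. \<bar>y - x\<bar> < r \<Longrightarrow> F (of_real y) = of_real (f y)"
    using assms(1) by (auto simp: extends_near_def)
  have dF: "(F has_field_derivative deriv F (of_real y)) (at (of_real y))"
    by (rule holomorphic_derivI[OF F(1) open_ball]) (use assms(2) in \<open>simp only: of_real_mem_ball\<close>)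
  have v: "((\<lambda>t. F (of_real t)) has_vector_derivative deriv F (of_real y)) (at y)"
    using dF by (rule has_vector_derivative_real_field)
  define A where "A = {t. \<bar>t - x\<bar> < r}"
  have A: "open A" "y \<in> A" unfolding A_def using assms(2) by (auto intro!: open_Collect_less continuous_intros)
  have v2: "((\<lambda>t. complex_of_real (f t)) has_vector_derivative deriv F (of_real y)) (at y)"
    by (rule has_vector_derivative_transform_within_open[OF v A]) (simp add: F(2) A_def)
  have "((\<lambda>t. Re (complex_of_real (f t))) has_vector_derivative Re (deriv F (of_real y))) (at y)"
    by (rule bounded_linear.has_vector_derivative[OF bounded_linear_Re v2])
  hence 1: "(f has_real_derivative Re (deriv F (of_real y))) (at y)"
    by (simp add: has_real_derivative_iff_has_vector_derivative)
  thus "(f has_real_derivative deriv f y) (at y)" by (metis DERIV_imp_deriv)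
  have "((\<lambda>t. Im (complex_of_real (f t))) has_vector_derivative Im (deriv F (of_real y))) (at y)"
    by (rule bounded_linear.has_vector_derivative[OF bounded_linear_Im v2])
  hence "((\<lambda>t. 0) has_real_derivative Im (deriv F (of_real y))) (at y)"
    by (simp add: has_real_derivative_iff_has_vector_derivative)
  hence "Im (deriv F (of_real y)) = 0" using DERIV_const DERIV_unique by blast
  thus "deriv F (of_real y) = of_real (deriv f y)"
    using DERIV_imp_deriv[OF 1] by (simp add: complex_eq_iff)
qed

lemma real_analytic_has_derivative:
  assumes "real_analytic f" shows "(f has_real_derivative deriv f y) (at y)"
proof -
  obtain r F where *: "extends_near f y r F" using real_analyticD[OF assms] by blast
  thus ?thesis by (rule extends_near_derivative(1)) (use * in \<open>simp add: extends_near_def\<close>)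
qed

lemma extends_near_deriv:
  assumes "extends_near f x r F" shows "extends_near (deriv f) x r (deriv F)"
  using assms extends_near_derivative(2)[OF assms] by (auto simp: extends_near_def intro: holomorphic_deriv)

lemma real_analytic_deriv:
  assumes "real_analytic f" shows "real_analytic (deriv f)"
  using real_analyticD[OF assms] extends_near_deriv by (intro real_analyticI) blast

lemma real_analytic_isCont: "real_analytic f \<Longrightarrow> isCont f x"
  using real_analytic_has_derivative DERIV_isCont by blast

lemma real_analytic_continuous_on: "real_analytic f \<Longrightarrow> continuous_on A f"
  using real_analytic_isCont continuous_at_imp_continuous_on by blast

lemma primitive_of_real_extension:
  assumes G: "\<And>z. z \<in> ball (of_real x) r \<Longrightarrow> (G has_field_derivative F z) (at z)"
    and F: "\<And>y. \<bar>y - x\<bar> < r \<Longrightarrow> F (of_real y) = of_real (f y)"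
    and g: "\<And>x. (g has_real_derivative f x) (at x)"
    and y: "\<bar>y - x\<bar> < r"
  shows "G (of_real y) - of_real (g y) = G (of_real x) - complex_of_real (g x)"
proof -
  define A where "A = {x - r<..<x + r}"
  have A: "\<bar>t - x\<bar> < r" if "t \<in> A" for t using that by (auto simp: A_def)
  have der: "((\<lambda>t. G (of_real t) - of_real (g t)) has_vector_derivative 0) (at t within A)" if t: "t \<in> A" for t
  proof -
    have b: "of_real t \<in> ball (complex_of_real x) r" using A[OF t] by (simp only: of_real_mem_ball)
    have 1: "((\<lambda>t. G (of_real t)) has_vector_derivative F (of_real t)) (at t within A)"
      by (rule has_vector_derivative_real_field[OF G[OF b]])
    have 2: "((\<lambda>t. complex_of_real (g t)) has_vector_derivative of_real (f t)) (at t within A)"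
      by (rule has_vector_derivative_of_real) (rule has_field_derivative_at_within[OF g])
    show ?thesis using has_vector_derivative_diff[OF 1 2] by (simp only: F[OF A[OF t]] diff_self)
  qed
  have cA: "convex A" by (simp add: A_def)
  have xy: "x \<in> A" "y \<in> A" using y by (auto simp: A_def abs_less_iff)
  show ?thesis
  proof (rule has_vector_derivative_zero_constant[OF cA der])
    fix c assume c: "\<And>t. t \<in> A \<Longrightarrow> G (of_real t) - of_real (g t) = c"
    show ?thesis by (rule trans[OF c[OF xy(2)] sym[OF c[OF xy(1)]]])
  qed
qed

text \<open>On each disc the holomorphic extension has a complex primitive, which differs from the
  given real antiderivative by a constant on the axis. The phase obtained by integrating an angular
  velocity is analytic for this reason.\<close>

lemma real_analytic_antiderivative:
  assumes f: "real_analytic f" and g: "\<And>x. (g has_real_derivative f x) (at x)"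
  shows "real_analytic g"
proof (rule real_analyticI)
  fix x
  obtain r F where F: "extends_near f x r F" using real_analyticD[OF f] by blast
  hence r: "r > 0" "F holomorphic_on ball (of_real x) r" "\<And>y. \<bar>y - x\<bar> < r \<Longrightarrow> F (of_real y) = of_real (f y)"
    by (auto simp: extends_near_def)
  obtain G where G: "\<And>z. z \<in> ball (of_real x) r \<Longrightarrow> (G has_field_derivative F z) (at z within ball (of_real x) r)"
    using holomorphic_convex_primitive'[OF convex_ball open_ball r(2)] by blast
  have G': "(G has_field_derivative F z) (at z)" if "z \<in> ball (of_real x) r" for z
    using G[OF that] that by (simp only: at_within_open[OF _ open_ball])
  define H where "H = (\<lambda>z. G z - (G (of_real x) - of_real (g x)))"
  have "G holomorphic_on ball (of_real x) r" unfolding holomorphic_on_open[OF open_ball] using G' by blast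
  hence "H holomorphic_on ball (of_real x) r" unfolding H_def by (intro holomorphic_intros)
  moreover have "H (of_real y) = of_real (g y)" if y: "\<bar>y - x\<bar> < r" for y
  proof -
    have "G (of_real y) - of_real (g y) = G (of_real x) - of_real (g x)"
      by (rule primitive_of_real_extension[OF G' r(3) g y])
    moreover have "a - K = b" if "a - b = K" for a b K :: complex using that by auto
    ultimately show ?thesis unfolding H_def by blast
  qed
  ultimately have "extends_near g x r H" using r(1) unfolding extends_near_def by blast
  thus "\<exists>r F. extends_near g x r F" by blast
qed

lemma real_analytic_locally_zero:
  assumes f: "real_analytic f" and fr: "\<exists>\<^sub>F y in at x. f y = 0"
  shows "\<exists>e>0. \<forall>y. \<bar>y - x\<bar> < e \<longrightarrow> f y = 0"
proof -
  obtain r F where F: "extends_near f x r F" using real_analyticD[OF f] by blast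
  hence r: "r > 0" "F holomorphic_on ball (of_real x) r" "\<And>y. \<bar>y - x\<bar> < r \<Longrightarrow> F (of_real y) = of_real (f y)"
    by (auto simp: extends_near_def)
  define U where "U = {z \<in> ball (of_real x) r. F z = 0}"
  have isl: "of_real x islimpt U"
    unfolding islimpt_approachable
  proof (intro allI impI)
    fix e :: real assume "e > 0"
    have ex: "\<exists>y. y \<noteq> x \<and> dist y x < d \<and> f y = 0" if "d > 0" for d
      using fr that unfolding frequently_def eventually_at by blast
    have "min e r > 0" using \<open>e > 0\<close> r(1) by simp
    from ex[OF this] obtain y where "y \<noteq> x" "dist y x < min e r" "f y = 0" by blast
    hence y: "y \<noteq> x" "\<bar>y - x\<bar> < e" "\<bar>y - x\<bar> < r" "f y = 0" by (simp_all add: dist_real_def)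
    show "\<exists>x'\<in>U. x' \<noteq> of_real x \<and> dist x' (of_real x) < e"
    proof (intro bexI conjI)
      show "complex_of_real y \<noteq> of_real x" using y by simp
      show "dist (complex_of_real y) (of_real x) < e" using y by (simp add: dist_real_def)
      show "complex_of_real y \<in> U" unfolding U_def mem_Collect_eq of_real_mem_ball using y r(3)[OF y(3)] by simp
    qed
  qed
  have Uz: "U \<subseteq> ball (of_real x) r" "\<And>z. z \<in> U \<Longrightarrow> F z = 0" by (auto simp: U_def)
  have xb: "complex_of_real x \<in> ball (of_real x) r" using r(1) by simp
  have Fz: "F w = 0" if "w \<in> ball (of_real x) r" for w
    by (rule analytic_continuation[OF r(2) open_ball connected_ball Uz(1) xb isl Uz(2) that])
  have "f y = 0" if y: "\<bar>y - x\<bar> < r" for y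
  proof -
    have "F (of_real y) = 0" by (rule Fz) (use y in \<open>simp only: of_real_mem_ball\<close>)
    thus ?thesis using r(3)[OF y] by simp
  qed
  thus ?thesis using r(1) by blast
qed

text \<open>The points near which \<open>f\<close> vanishes identically form an open set; it is
  closed because a limit of such points is an accumulation point of zeros. The line is
  connected.\<close>

lemma real_analytic_identity:
  assumes f: "real_analytic f" and z: "\<exists>\<^sub>F y in at x0. f y = 0"
  shows "f x = 0"
proof -
  define A where "A = {x. \<exists>e>0. \<forall>y. \<bar>y - x\<bar> < e \<longrightarrow> f y = 0}"
  have "open A"
    unfolding open_dist
  proof
    fix x assume "x \<in> A"
    then obtain e where e: "e > 0" "\<And>y. \<bar>y - x\<bar> < e \<Longrightarrow> f y = 0" by (auto simp: A_def)
    show "\<exists>e>0. \<forall>y. dist y x < e \<longrightarrow> y \<in> A"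
    proof (intro exI conjI allI impI)
      show "e / 2 > 0" using e by simp
      fix y assume y: "dist y x < e / 2"
      have "f u = 0" if "\<bar>u - y\<bar> < e / 2" for u
        by (rule e(2)) (use that y in \<open>unfold dist_real_def, linarith\<close>)
      thus "y \<in> A" using e(1) by (auto simp: A_def intro!: exI[of _ "e / 2"])
    qed
  qed
  moreover have "closed A"
    unfolding closed_limpt
  proof (intro allI impI)
    fix x assume lim: "x islimpt A"
    have "\<exists>\<^sub>F y in at x. f y = 0"
      unfolding frequently_def eventually_at
    proof (rule notI, elim exE conjE)
      fix d :: real assume "d > 0" and nz: "\<forall>y\<in>UNIV. y \<noteq> x \<and> dist y x < d \<longrightarrow> \<not> f y = 0"
      with lim obtain y where "y \<in> A" "y \<noteq> x" "dist y x < d" unfolding islimpt_approachable by blast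
      moreover from \<open>y \<in> A\<close> have "f y = 0" by (auto simp: A_def)
      ultimately show False using nz by blast
    qed
    thus "x \<in> A" using real_analytic_locally_zero[OF f] by (auto simp: A_def)
  qed
  moreover have "x0 \<in> A" using real_analytic_locally_zero[OF f z] by (auto simp: A_def)
  ultimately have "A = UNIV" using clopen[of A] by auto
  hence "x \<in> A" by simp
  thus ?thesis by (auto simp: A_def)
qed

lemma real_analytic_eventually_nonzero:
  assumes "real_analytic f" "f x0 \<noteq> 0"
  shows "\<forall>\<^sub>F y in at x. f y \<noteq> 0"
  using real_analytic_identity[OF assms(1), of x x0] assms(2) unfolding frequently_def by auto

text \<open>The holomorphic extension factors with a nonvanishing cofactor. That cofactor is real on
  the axis: away from \<open>x\<close> as a quotient of reals, at \<open>x\<close> by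
  continuity.\<close>

lemma real_analytic_factor:
  assumes f: "real_analytic f" and nz: "f x0 \<noteq> 0"
  shows "\<exists>m g r G. extends_near g x r G \<and> g x \<noteq> 0 \<and> (\<forall>y. \<bar>y - x\<bar> < r \<longrightarrow> f y = (y - x) ^ m * g y) \<and> (f x = 0 \<longrightarrow> m > 0)"
proof (cases "f x = 0")
  case False
  obtain r F where "extends_near f x r F" using real_analyticD[OF f] by blast
  thus ?thesis using False by (intro exI[of _ 0] exI[of _ f] exI[of _ r] exI[of _ F]) auto
next
  case True
  obtain r F where F: "extends_near f x r F" using real_analyticD[OF f] by blast
  hence r: "r > 0" "F holomorphic_on ball (of_real x) r" "\<And>y. \<bar>y - x\<bar> < r \<Longrightarrow> F (of_real y) = of_real (f y)"
    by (auto simp: extends_near_def)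
  have F0: "F (of_real x) = 0" using r(3)[of x] r(1) True by simp
  have nc: "\<not> F constant_on ball (of_real x) r"
  proof
    assume "F constant_on ball (of_real x) r"
    hence Fz: "F w = 0" if "w \<in> ball (of_real x) r" for w
      using that F0 r(1) unfolding constant_on_def by (metis centre_in_ball)
    have "f y = 0" if "\<bar>y - x\<bar> < r" for y
      using Fz[of "of_real y"] r(3)[OF that] of_real_mem_ball[of y x r] that by simp
    moreover obtain d where "d > 0" "\<And>y. y \<noteq> x \<Longrightarrow> \<bar>y - x\<bar> < d \<Longrightarrow> f y \<noteq> 0"
      using real_analytic_eventually_nonzero[OF f nz, of x] unfolding eventually_at by (auto simp: dist_real_def)
    moreover have "x + min r d / 2 \<noteq> x" "\<bar>x + min r d / 2 - x\<bar> < r" "\<bar>x + min r d / 2 - x\<bar> < d"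
      using r(1) \<open>d > 0\<close> by auto
    ultimately show False by blast
  qed
  obtain g e n where n: "0 < n" and e: "0 < e" "ball (of_real x) e \<subseteq> ball (complex_of_real x) r"
    and g: "g holomorphic_on ball (of_real x) e" "\<And>w. w \<in> ball (of_real x) e \<Longrightarrow> F w = (w - of_real x) ^ n * g w"
      "\<And>w. w \<in> ball (of_real x) e \<Longrightarrow> g w \<noteq> 0"
    by (rule holomorphic_factor_zero_nonconstant[OF r(2) open_ball connected_ball _ F0 nc]) (use r(1) in auto)
  define h where "h = (\<lambda>y. Re (g (of_real y)))"
  have er: "\<bar>y - x\<bar> < r" if "\<bar>y - x\<bar> < e" for y
    using e(2) that of_real_mem_ball[of y x e] of_real_mem_ball[of y x r] by blast
  have real: "g (of_real y) \<in> \<real>" if y: "\<bar>y - x\<bar> < e" "y \<noteq> x" for y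
  proof -
    have "of_real (f y) = (of_real y - of_real x) ^ n * g (of_real y)"
      using g(2)[of "of_real y"] r(3)[OF er[OF y(1)]] of_real_mem_ball[of y x e] y(1) by simp
    hence "g (of_real y) = of_real (f y / (y - x) ^ n)" using y(2) by (simp add: field_simps flip: of_real_diff of_real_power)
    thus ?thesis by simp
  qed
  have realx: "g (of_real x) \<in> \<real>"
  proof -
    have "isCont g (of_real x)"
      using g(1) e(1) by (metis centre_in_ball continuous_on_eq_continuous_at holomorphic_on_imp_continuous_on open_ball)
    moreover have "((\<lambda>y. complex_of_real y) \<longlongrightarrow> of_real x) (at x)" by (intro tendsto_intros)
    ultimately have "((\<lambda>y. g (of_real y)) \<longlongrightarrow> g (of_real x)) (at x)" by (rule isCont_tendsto_compose)
    moreover have "\<forall>\<^sub>F y in at x. g (of_real y) \<in> \<real>"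
      unfolding eventually_at using real e(1) by (auto simp: dist_real_def intro!: exI[of _ e])
    ultimately show ?thesis using closed_complex_Reals Lim_in_closed_set[of "\<real>"] by (metis trivial_limit_at)
  qed
  have gh: "g (of_real y) = of_real (h y)" if "\<bar>y - x\<bar> < e" for y
    using real[OF that] realx unfolding h_def by (cases "y = x") (auto simp: of_real_Re)
  have "extends_near h x e g" using e(1) g(1) gh by (simp add: extends_near_def)
  moreover have "h x \<noteq> 0" using g(3)[of "of_real x"] gh[of x] e(1) by auto
  moreover have "f y = (y - x) ^ n * h y" if y: "\<bar>y - x\<bar> < e" for y
  proof -
    have "complex_of_real (f y) = of_real ((y - x) ^ n * h y)"
      using g(2)[of "of_real y"] r(3)[OF er[OF y]] of_real_mem_ball[of y x e] y gh[OF y] by simp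
    thus ?thesis by (simp only: of_real_eq_iff)
  qed
  ultimately show ?thesis using n by blast
qed

subsection \<open>The phase of a real analytic curve\<close>

lemma continuous_antiderivative:
  fixes w :: "real \<Rightarrow> real"
  assumes "\<And>x. isCont w x"
  obtains h where "\<And>x. (h has_real_derivative w x) (at x)" "h 0 = 0"
proof -
  have "\<exists>F. \<forall>x::real. -\<infinity> < ereal x \<longrightarrow> ereal x < \<infinity> \<longrightarrow> (F has_vector_derivative w x) (at x)"
    by (rule einterval_antiderivative) (use assms in auto)
  then obtain F where F: "\<And>x. (F has_real_derivative w x) (at x)"
    by (auto simp: has_real_derivative_iff_has_vector_derivative)
  show ?thesis
  proof (rule that[of "\<lambda>x. F x - F 0"])
    show "((\<lambda>x. F x - F 0) has_real_derivative w x) (at x)" for x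
      using F[of x] by (auto intro!: derivative_eq_intros)
  qed simp
qed

text \<open>Dividing by the lower of the two orders of vanishing leaves a pair that is not zero at
  \<open>x\<close>. If \<open>Q\<close> is identically zero, the order of \<open>P\<close> is
  taken.\<close>

lemma real_analytic_common_factor:
  assumes P: "real_analytic P" and Q: "real_analytic Q" and P0: "P x0 \<noteq> 0"
  shows "\<exists>k r A B FA FB. extends_near A x r FA \<and> extends_near B x r FB \<and> (A x \<noteq> 0 \<or> B x \<noteq> 0) \<and>
     (\<forall>y. \<bar>y - x\<bar> < r \<longrightarrow> P y = (y - x) ^ k * A y \<and> Q y = (y - x) ^ k * B y)"
proof -
  from real_analytic_factor[OF P P0, of x] obtain p A r1 FA where A: "extends_near A x r1 FA" "A x \<noteq> 0" "\<And>y. \<bar>y - x\<bar> < r1 \<Longrightarrow> P y = (y - x) ^ p * A y"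
    by blast
  show ?thesis
  proof (cases "\<forall>t. Q t = 0")
    case True
    have "extends_near (\<lambda>_. 0) x r1 (\<lambda>_. 0)" using A(1) by (simp add: extends_near_def)
    thus ?thesis using A True by (intro exI[of _ p] exI[of _ r1] exI[of _ A] exI[of _ "\<lambda>_. 0"] exI[of _ FA]) auto
  next
    case False
    then obtain x1 where Q0: "Q x1 \<noteq> 0" by blast
    from real_analytic_factor[OF Q Q0, of x] obtain q B r2 FB where B: "extends_near B x r2 FB" "B x \<noteq> 0" "\<And>y. \<bar>y - x\<bar> < r2 \<Longrightarrow> Q y = (y - x) ^ q * B y"
      by blast
    define r where "r = min r1 r2"
    have r: "0 < r" "r \<le> r1" "r \<le> r2" using A(1) B(1) by (auto simp: r_def extends_near_def)
    have A': "extends_near A x r FA" and B': "extends_near B x r FB"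
      using extends_near_mono[OF A(1) r(1,2)] extends_near_mono[OF B(1) r(1,3)] .
    have mul: "extends_near (\<lambda>y. (y - x) ^ j * C y) x r (\<lambda>z. (z - of_real x) ^ j * FC z)"
      if "extends_near C x r FC" for C FC j
      using that unfolding extends_near_def by (auto intro!: holomorphic_intros)
    have lt: "\<bar>y - x\<bar> < r1" "\<bar>y - x\<bar> < r2" if "\<bar>y - x\<bar> < r" for y using that r by linarith+
    show ?thesis
    proof (cases "p \<le> q")
      case True
      have "(y - x) ^ q * B y = (y - x) ^ p * ((y - x) ^ (q - p) * B y)" for y
        using True by (simp add: power_add[symmetric] mult.assoc[symmetric])
      thus ?thesis
        using A(2,3) B(3) A' mul[OF B', of "q - p"] lt
        by (intro exI[of _ p] exI[of _ r] exI[of _ A] exI[of _ "\<lambda>y. (y - x) ^ (q - p) * B y"] exI[of _ FA] exI[of _ "\<lambda>z. (z - of_real x) ^ (q - p) * FB z"]) auto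
    next
      case False
      have "(y - x) ^ p * A y = (y - x) ^ q * ((y - x) ^ (p - q) * A y)" for y
        using False by (simp add: power_add[symmetric] mult.assoc[symmetric])
      thus ?thesis
        using B(2,3) A(3) B' mul[OF A', of "p - q"] lt
        by (intro exI[of _ q] exI[of _ r] exI[of _ "\<lambda>y. (y - x) ^ (p - q) * A y"] exI[of _ B] exI[of _ "\<lambda>z. (z - of_real x) ^ (p - q) * FA z"] exI[of _ FB]) auto
    qed
  qed
qed

text \<open>
  The angular velocity \<open>(P Q' - Q P') / (P\<^sup>2 + Q\<^sup>2)\<close> of the curve \<open>(P, Q)\<close> has removable singularities
  at the common zeros of \<open>P\<close> and \<open>Q\<close>.
\<close>
lemma angular_velocity_extends:
  assumes P: "real_analytic P" and Q: "real_analytic Q" and P0: "P x0 \<noteq> 0"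
  defines "v \<equiv> \<lambda>y. (P y * deriv Q y - Q y * deriv P y) / ((P y)\<^sup>2 + (Q y)\<^sup>2)"
  shows "\<exists>r w W. extends_near w x r W \<and> (\<forall>y. \<bar>y - x\<bar> < r \<longrightarrow> y \<noteq> x \<longrightarrow> v y = w y)"
proof -
  obtain k r A B FA FB where A: "extends_near A x r FA" and B: "extends_near B x r FB" and nz: "A x \<noteq> 0 \<or> B x \<noteq> 0"
    and PQ: "\<And>y. \<bar>y - x\<bar> < r \<Longrightarrow> P y = (y - x) ^ k * A y" "\<And>y. \<bar>y - x\<bar> < r \<Longrightarrow> Q y = (y - x) ^ k * B y"
    using real_analytic_common_factor[OF P Q P0, of x] by blast
  have r: "r > 0" "FA holomorphic_on ball (of_real x) r" "FB holomorphic_on ball (of_real x) r" 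
    using A B by (auto simp: extends_near_def)
  define D where "D = (\<lambda>z. (FA z)\<^sup>2 + (FB z)\<^sup>2)"
  have D: "D holomorphic_on ball (of_real x) r" unfolding D_def by (intro holomorphic_intros r)
  have real: "FA (of_real y) = of_real (A y)" "FB (of_real y) = of_real (B y)" 
     "deriv FA (of_real y) = of_real (deriv A y)" "deriv FB (of_real y) = of_real (deriv B y)" if "\<bar>y - x\<bar> < r" for y
    using A B that extends_near_derivative(2)[OF A that] extends_near_derivative(2)[OF B that] by (auto simp: extends_near_def)
  have "D (of_real x) = of_real ((A x)\<^sup>2 + (B x)\<^sup>2)" using real[of x] r(1) by (simp add: D_def)
  hence Dx: "D (of_real x) \<noteq> 0" using nz by (simp only: of_real_eq_0_iff sum_power2_eq_zero_iff) blast
  have "isCont D (of_real x)"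
    using D r(1) by (metis centre_in_ball continuous_on_eq_continuous_at holomorphic_on_imp_continuous_on open_ball)
  from continuous_at_avoid[OF this Dx] obtain e where e: "e > 0" "\<And>z. dist (of_real x) z < e \<Longrightarrow> D z \<noteq> 0" by blast
  define s where "s = min e r"
  have s: "s > 0" "s \<le> r" "s \<le> e" using e r by (auto simp: s_def)
  have sub: "ball (complex_of_real x) s \<subseteq> ball (of_real x) r" using s by (intro subset_ball)
  define W where "W = (\<lambda>z. (FA z * deriv FB z - FB z * deriv FA z) / D z)"
  define w where "w = (\<lambda>y. (A y * deriv B y - B y * deriv A y) / ((A y)\<^sup>2 + (B y)\<^sup>2))"
  have "W holomorphic_on ball (of_real x) s"
    unfolding W_def using e(2) s
    by (intro holomorphic_intros holomorphic_deriv holomorphic_on_subset[OF r(2) sub] holomorphic_on_subset[OF r(3) sub] holomorphic_on_subset[OF D sub] open_ball) auto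
  moreover have "W (of_real y) = of_real (w y)" if "\<bar>y - x\<bar> < s" for y
    using real[of y] that s(2) by (simp add: W_def w_def D_def)
  ultimately have "extends_near w x s W" using s(1) by (simp add: extends_near_def)
  moreover have "v y = w y" if y: "\<bar>y - x\<bar> < s" "y \<noteq> x" for y
  proof -
    have yr: "\<bar>y - x\<bar> < r" using y s by linarith
    define c where "c = (y - x) ^ k"
    have c: "c \<noteq> 0" using y by (simp add: c_def)
    define c' where "c' = real k * (y - x) ^ (k - 1)"
    have op: "open {t. \<bar>t - x\<bar> < r}" by (intro open_Collect_less continuous_intros)
    have dc: "((\<lambda>t. (t - x) ^ k) has_real_derivative c') (at y)"
      unfolding c'_def by (auto intro!: derivative_eq_intros)
    have "(P has_real_derivative c' * A y + deriv A y * c) (at y)"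
    proof (rule has_field_derivative_transform_within_open[OF _ op])
      show "((\<lambda>t. (t - x) ^ k * A t) has_real_derivative c' * A y + deriv A y * c) (at y)"
        using DERIV_mult[OF dc extends_near_derivative(1)[OF A yr]] by (simp add: c_def)
    qed (use PQ yr in auto)
    hence dP: "deriv P y = c' * A y + deriv A y * c" by (rule DERIV_imp_deriv)
    have "(Q has_real_derivative c' * B y + deriv B y * c) (at y)"
    proof (rule has_field_derivative_transform_within_open[OF _ op])
      show "((\<lambda>t. (t - x) ^ k * B t) has_real_derivative c' * B y + deriv B y * c) (at y)"
        using DERIV_mult[OF dc extends_near_derivative(1)[OF B yr]] by (simp add: c_def)
    qed (use PQ yr in auto)
    hence dQ: "deriv Q y = c' * B y + deriv B y * c" by (rule DERIV_imp_deriv)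
    have Py: "P y = c * A y" "Q y = c * B y" using PQ[OF yr] by (auto simp: c_def)
    \<comment> \<open>The angular velocity does not change under a common real factor: the terms
      with \<open>c'\<close> cancel.\<close>
    have "P y * deriv Q y - Q y * deriv P y = c\<^sup>2 * (A y * deriv B y - B y * deriv A y)"
      unfolding Py dP dQ by (simp add: power2_eq_square algebra_simps)
    moreover have "(P y)\<^sup>2 + (Q y)\<^sup>2 = c\<^sup>2 * ((A y)\<^sup>2 + (B y)\<^sup>2)"
      unfolding Py by (simp add: power_mult_distrib algebra_simps)
    ultimately show ?thesis using c by (simp add: v_def w_def)
  qed
  ultimately show ?thesis by blast
qed

text \<open>\<open>h\<close> is the integral of the extended angular velocity and
  \<open>\<rho>\<close> the component of the curve along (cos h, sin h); the component
  \<open>D\<close> across it must vanish. This is a calculation near 0, where \<open>P\<close> is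
  nonzero, and the identity theorem extends it past all common zeros.\<close>

theorem real_analytic_phase_exists:
  assumes P: "real_analytic P" and Q: "real_analytic Q" and P0: "P 0 \<noteq> 0" and Q0: "Q 0 = 0"
  obtains h \<rho> where "real_analytic h" "real_analytic \<rho>" "h 0 = 0"
    "\<And>t. P t = \<rho> t * cos (h t)" "\<And>t. Q t = \<rho> t * sin (h t)"
proof -
  define v where "v = (\<lambda>y. (P y * deriv Q y - Q y * deriv P y) / ((P y)\<^sup>2 + (Q y)\<^sup>2))"
  \<comment> \<open>The limit at every point gives one global function, which takes the removable
    value at the common zeros.\<close>
  define w where "w = (\<lambda>x. Lim (at x) v)"
  have loc: "\<exists>r W. extends_near w x r W" for x
  proof -
    obtain r u W where u: "extends_near u x r W" and vu: "\<And>y. \<bar>y - x\<bar> < r \<Longrightarrow> y \<noteq> x \<Longrightarrow> v y = u y"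
      using angular_velocity_extends[OF P Q P0, of x] unfolding v_def by blast
    have "w y = u y" if y: "\<bar>y - x\<bar> < r" for y
    proof -
      have "isCont u y" using extends_near_derivative(1)[OF u y] by (rule DERIV_isCont)
      hence t: "(u \<longlongrightarrow> u y) (at y)" by (simp add: isCont_def)
      have op: "open ({t. \<bar>t - x\<bar> < r})" by (intro open_Collect_less continuous_intros)
      have "\<forall>\<^sub>F t in at y. t \<in> {t. \<bar>t - x\<bar> < r}" using op y by (intro eventually_at_in_open') auto
      moreover have "\<forall>\<^sub>F t in at y. t \<noteq> x"
      proof (cases "y = x")
        case False
        thus ?thesis using eventually_at_in_open'[of "- {x}" y] by auto
      qed (simp add: eventually_at_filter)
      ultimately have "\<forall>\<^sub>F t in at y. u t = v t" by eventually_elim (use vu in auto)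
      with t have "(v \<longlongrightarrow> u y) (at y)" by (rule Lim_transform_eventually)
      thus ?thesis unfolding w_def by (intro tendsto_Lim) auto
    qed
    hence "extends_near w x r W" using u unfolding extends_near_def by simp
    thus ?thesis by blast
  qed
  hence w: "real_analytic w" by (rule real_analyticI)
  obtain h where h: "\<And>x. (h has_real_derivative w x) (at x)" "h 0 = 0"
    using continuous_antiderivative[OF real_analytic_isCont[OF w]] by blast
  have ha: "real_analytic h" by (rule real_analytic_antiderivative[OF w h(1)])
  define D where "D = (\<lambda>t. Q t * cos (h t) - P t * sin (h t))"
  define \<rho> where "\<rho> = (\<lambda>t. P t * cos (h t) + Q t * sin (h t))"
  have Da: "real_analytic D" and ra: "real_analytic \<rho>" unfolding D_def \<rho>_def
    by (intro real_analytic_add real_analytic_diff real_analytic_mult P Q real_analytic_sin real_analytic_cos ha)+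
  have "isCont P 0" using P by (rule real_analytic_isCont)
  from continuous_at_avoid[OF this P0] obtain e where e: "e > 0" "\<And>y. dist 0 y < e \<Longrightarrow> P y \<noteq> 0" by blast
  have Pn: "P y \<noteq> 0" if "\<bar>y\<bar> < e" for y using e(2)[of y] that by (simp add: dist_real_def)
  define N where "N = (\<lambda>t. (P t)\<^sup>2 + (Q t)\<^sup>2)"
  have Nn: "N y \<noteq> 0" if "\<bar>y\<bar> < e" for y using Pn[OF that] by (simp add: N_def sum_power2_eq_zero_iff)
  have dP: "(P has_real_derivative deriv P y) (at y)" and dQ: "(Q has_real_derivative deriv Q y) (at y)" for y
    using real_analytic_has_derivative P Q by blast+
  have w_eq: "w y * N y = P y * deriv Q y - Q y * deriv P y" if y: "\<bar>y\<bar> < e" for y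
  proof -
    have "isCont v y" unfolding v_def
      using Nn[OF y] real_analytic_isCont[OF P] real_analytic_isCont[OF Q] real_analytic_isCont[OF real_analytic_deriv[OF P]] real_analytic_isCont[OF real_analytic_deriv[OF Q]]
      by (intro continuous_intros) (auto simp: N_def)
    hence "w y = v y" unfolding w_def isCont_def by (intro tendsto_Lim) auto
    thus ?thesis using Nn[OF y] by (simp add: v_def N_def)
  qed
  have zero: "D y = 0" if y: "\<bar>y\<bar> < e" for y
  proof -
    \<comment> \<open>\<open>(D t)\<^sup>2 / N t\<close> is the squared sine of the angle between
      (P, Q) and (cos h, sin h), and both vectors turn at the same rate.\<close>
    have der: "((\<lambda>t. (D t)\<^sup>2 / N t) has_real_derivative 0) (at u)" if u: "\<bar>u\<bar> < e" for u
    proof -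
      define c s where "c = cos (h u)" and "s = sin (h u)"
      define D' where "D' = deriv Q u * c - Q u * s * w u - (deriv P u * s + P u * c * w u)"
      define N' where "N' = 2 * P u * deriv P u + 2 * Q u * deriv Q u"
      have dD: "(D has_real_derivative D') (at u)"
        unfolding D_def D'_def c_def s_def by (auto intro!: derivative_eq_intros dP dQ h(1))
      have dN: "(N has_real_derivative N') (at u)"
        unfolding N_def N'_def by (auto intro!: derivative_eq_intros dP dQ)
      have "2 * (N u * D') = N' * D u"
      proof -
        have "N u * D' = N u * (deriv Q u * c - deriv P u * s) - (Q u * s + P u * c) * (w u * N u)"
          unfolding D'_def by (simp add: algebra_simps)
        also have "\<dots> = N u * (deriv Q u * c - deriv P u * s) - (Q u * s + P u * c) * (P u * deriv Q u - Q u * deriv P u)"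
          by (simp only: w_eq[OF u])
        finally show ?thesis unfolding N'_def D_def N_def c_def[symmetric] s_def[symmetric]
          by (simp add: power2_eq_square algebra_simps)
      qed
      moreover have "((\<lambda>t. (D t)\<^sup>2 / N t) has_real_derivative (2 * D u * D' * N u - (D u)\<^sup>2 * N') / (N u * N u)) (at u)"
        using Nn[OF u] by (auto intro!: derivative_eq_intros dD dN)
      moreover have "2 * D u * D' * N u - (D u)\<^sup>2 * N' = D u * (2 * (N u * D') - N' * D u)"
        by (simp add: power2_eq_square algebra_simps)
      ultimately show ?thesis by simp
    qed
    have "(D y)\<^sup>2 / N y = (D 0)\<^sup>2 / N 0"
    proof (rule DERIV_isconst3[of "-e" e y 0 "\<lambda>t. (D t)\<^sup>2 / N t"])
      show "((\<lambda>t. (D t)\<^sup>2 / N t) has_real_derivative 0) (at u)" if "u \<in> {-e<..<e}" for u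
        by (rule der) (use that in \<open>simp add: abs_less_iff\<close>)
    qed (use e(1) y in \<open>simp_all add: abs_less_iff\<close>)
    moreover have "D 0 = 0" by (simp add: D_def Q0 h(2))
    ultimately show ?thesis using Nn[OF y] by simp
  qed
  have "\<exists>\<^sub>F y in at 0. D y = 0"
  proof -
    have "\<forall>\<^sub>F y in at 0. D y = 0" unfolding eventually_at using e(1) zero by (auto simp: dist_real_def)
    thus ?thesis by (rule eventually_frequently[rotated]) simp
  qed
  hence D0: "D t = 0" for t by (rule real_analytic_identity[OF Da])
  have "P t = \<rho> t * cos (h t)" for t
  proof -
    have "\<rho> t * cos (h t) = P t * ((cos (h t))\<^sup>2 + (sin (h t))\<^sup>2) + D t * sin (h t)"
      unfolding \<rho>_def D_def by algebra
    thus ?thesis by (simp add: D0)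
  qed
  moreover have "Q t = \<rho> t * sin (h t)" for t
  proof -
    have "\<rho> t * sin (h t) = Q t * ((cos (h t))\<^sup>2 + (sin (h t))\<^sup>2) - D t * cos (h t)"
      unfolding \<rho>_def D_def by algebra
    thus ?thesis by (simp add: D0)
  qed
  ultimately show ?thesis using that[OF ha ra h(2)] by blast
qed

text \<open>The average of F(z) and the conjugate of F at the conjugate of z is holomorphic and
  equals Re F on the axis.\<close>

lemma real_analytic_Re:
  assumes "F holomorphic_on A" "open A" "\<And>x. of_real x \<in> A"
  shows "real_analytic (\<lambda>x. Re (F (of_real x)))"
proof (rule real_analyticI)
  fix x
  obtain r where r: "r > 0" "ball (of_real x) r \<subseteq> A" using assms(2,3) open_contains_ball by blast
  have F: "F holomorphic_on ball (of_real x) r" using assms(1) r(2) by (rule holomorphic_on_subset)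
  have "cnj ` ball (of_real x) r = ball (complex_of_real x) r"
  proof -
    have d: "dist (of_real x) (cnj z) = dist (complex_of_real x) z" for z
      using complex_mod_cnj[of "of_real x - z"] by (simp add: dist_norm)
    show ?thesis
    proof (intro equalityI subsetI)
      fix z assume "z \<in> ball (complex_of_real x) r"
      hence "cnj z \<in> ball (complex_of_real x) r" using d by simp
      thus "z \<in> cnj ` ball (of_real x) r" by (metis complex_cnj_cnj imageI)
    qed (use d in auto)
  qed
  hence "cnj \<circ> F \<circ> cnj holomorphic_on ball (of_real x) r"
    using F by (intro holomorphic_on_compose_cnj_cnj) auto
  hence c: "(\<lambda>z. cnj (F (cnj z))) holomorphic_on ball (of_real x) r" by (simp only: o_def)
  have "(\<lambda>z. (F z + cnj (F (cnj z))) / 2) holomorphic_on ball (of_real x) r"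
    by (intro holomorphic_intros F c) auto
  hence "extends_near (\<lambda>x. Re (F (of_real x))) x r (\<lambda>z. (F z + cnj (F (cnj z))) / 2)"
    using r(1) by (simp add: extends_near_def complex_add_cnj)
  thus "\<exists>r G. extends_near (\<lambda>x. Re (F (of_real x))) x r G" by blast
qed

subsection \<open>Bounds for the digamma function\<close>

text \<open>This is q <= artanh q at q = A / D. It bounds a term of the digamma series by a
  difference of logarithms.\<close>

lemma ln_ratio_ge:
  fixes A D :: real
  assumes "0 \<le> A" "A < D"
  shows "2 * A / D \<le> ln (D + A) - ln (D - A)"
proof -
  define f where "f = (\<lambda>q::real. ln (1 + q) - ln (1 - q) - 2 * q)"
  define q where "q = A / D"
  have q: "0 \<le> q" "q < 1" using assms by (auto simp: q_def)
  have "f 0 \<le> f q"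
  proof (rule DERIV_nonneg_imp_nondecreasing[OF q(1)])
    fix u assume u: "0 \<le> u" "u \<le> q"
    hence u1: "u < 1" using q by simp
    have "(f has_real_derivative 1 / (1 + u) + 1 / (1 - u) - 2) (at u)"
      unfolding f_def using u u1 by (auto intro!: derivative_eq_intros)
    moreover have "1 / (1 + u) + 1 / (1 - u) - 2 = 2 * u\<^sup>2 / ((1 + u) * (1 - u))"
    proof -
      have "1 + u \<noteq> 0" "1 - u \<noteq> 0" using u u1 by auto
      thus ?thesis by (simp add: divide_simps) (simp add: power2_eq_square algebra_simps)
    qed
    moreover have "\<dots> \<ge> 0" using u u1 by simp
    ultimately show "\<exists>y. (f has_real_derivative y) (at u) \<and> 0 \<le> y" by auto
  qed
  moreover have "ln (1 + q) - ln (1 - q) = ln (D + A) - ln (D - A)"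
  proof -
    have "1 + q = (D + A) / D" "1 - q = (D - A) / D" using assms by (auto simp: q_def field_simps)
    thus ?thesis using assms by (simp add: ln_div)
  qed
  ultimately show ?thesis by (simp add: f_def q_def)
qed

text \<open>The opposite estimate artanh q <= q / (1 - q^2) at q = A / D.\<close>

lemma ln_ratio_le:
  fixes A D :: real
  assumes "0 \<le> A" "A < D"
  shows "ln (D + A) - ln (D - A) \<le> 2 * A * D / (D\<^sup>2 - A\<^sup>2)"
proof -
  define f where "f = (\<lambda>q::real. 2 * q / (1 - q\<^sup>2) - (ln (1 + q) - ln (1 - q)))"
  define q where "q = A / D"
  have q: "0 \<le> q" "q < 1" using assms by (auto simp: q_def)
  have "f 0 \<le> f q"
  proof (rule DERIV_nonneg_imp_nondecreasing[OF q(1)])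
    fix u assume u: "0 \<le> u" "u \<le> q"
    hence u1: "u < 1" using q by simp
    have u2: "1 - u\<^sup>2 > 0" using power_strict_mono[of u 1 2] u u1 by simp
    have "(f has_real_derivative (2 * (1 - u\<^sup>2) - 2 * u * (- 2 * u)) / (1 - u\<^sup>2)\<^sup>2 - (1 / (1 + u) + 1 / (1 - u))) (at u)"
      unfolding f_def using u u1 u2 by (auto intro!: derivative_eq_intros simp: power2_eq_square)
    moreover have "(2 * (1 - u\<^sup>2) - 2 * u * (- 2 * u)) / (1 - u\<^sup>2)\<^sup>2 - (1 / (1 + u) + 1 / (1 - u)) = 4 * u\<^sup>2 / (1 - u\<^sup>2)\<^sup>2"
    proof -
      have "1 / (1 + u) + 1 / (1 - u) = 2 / (1 - u\<^sup>2)" using u u1 u2 by (simp add: field_simps power2_eq_square)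
      also have "\<dots> = 2 * (1 - u\<^sup>2) / (1 - u\<^sup>2)\<^sup>2"
      proof -
        have "2 / w = 2 * w / w\<^sup>2" if "w > 0" for w :: real using that by (simp add: power2_eq_square)
        thus ?thesis using u2 by blast
      qed
      finally show ?thesis by (simp add: diff_divide_distrib[symmetric] power2_eq_square algebra_simps)
    qed
    moreover have "\<dots> \<ge> 0" by simp
    ultimately show "\<exists>y. (f has_real_derivative y) (at u) \<and> 0 \<le> y" by auto
  qed
  moreover have "ln (1 + q) - ln (1 - q) = ln (D + A) - ln (D - A)"
  proof -
    have "1 + q = (D + A) / D" "1 - q = (D - A) / D" using assms by (auto simp: q_def field_simps)
    thus ?thesis using assms by (simp add: ln_div)
  qed
  moreover have "2 * q / (1 - q\<^sup>2) = 2 * A * D / (D\<^sup>2 - A\<^sup>2)"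
  proof -
    have "1 - q\<^sup>2 = (D\<^sup>2 - A\<^sup>2) / D\<^sup>2" using assms by (simp add: q_def power_divide field_simps)
    thus ?thesis using assms by (simp add: q_def power2_eq_square)
  qed
  ultimately show ?thesis by (simp add: f_def)
qed

text \<open>By the addition theorem the left side is the arctangent of the right side, and arctan w
  <= w for w >= 0; the proof is by monotonicity in \<open>p\<close>.\<close>

lemma arctan_diff_le:
  fixes p r :: real
  assumes "r \<le> p" "1 + p * r > 0"
  shows "arctan p - arctan r \<le> (p - r) / (1 + p * r)"
proof -
  define f where "f = (\<lambda>u. (u - r) / (1 + u * r) - arctan u)"
  have pos: "1 + u * r > 0" if "r \<le> u" "u \<le> p" for u
  proof (cases "r \<ge> 0")
    case True thus ?thesis using that by (smt (verit) mult_nonneg_nonneg)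
  next
    case False hence "u * r \<ge> p * r" using that by (intro mult_right_mono_neg) auto
    thus ?thesis using assms by linarith
  qed
  have "f r \<le> f p"
  proof (rule DERIV_nonneg_imp_nondecreasing[OF assms(1)])
    fix u assume u: "r \<le> u" "u \<le> p"
    note P = pos[OF u]
    have "(f has_real_derivative ((1 + u * r) - (u - r) * r) / (1 + u * r)\<^sup>2 - 1 / (1 + u\<^sup>2)) (at u)"
      unfolding f_def using P by (auto intro!: derivative_eq_intros simp: power2_eq_square field_simps)
    moreover have "((1 + u * r) - (u - r) * r) / (1 + u * r)\<^sup>2 - 1 / (1 + u\<^sup>2) \<ge> 0"
    proof -
      have "(1 + u * r)\<^sup>2 \<le> (1 + r\<^sup>2) * (1 + u\<^sup>2)"
        using zero_le_power2[of "u - r"] by (simp add: power2_eq_square algebra_simps)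
      moreover have "1 / b \<le> c / d" if "0 < b" "0 < d" "d \<le> c * b" for b c d :: real
        using that by (simp add: field_simps)
      ultimately have le: "1 / (1 + u\<^sup>2) \<le> (1 + r\<^sup>2) / (1 + u * r)\<^sup>2"
        using P by (meson add_pos_nonneg zero_le_power2 zero_less_one zero_less_power)
      have e: "(1 + u * r) - (u - r) * r = 1 + r\<^sup>2" by (simp add: power2_eq_square algebra_simps)
      show ?thesis unfolding e using le by linarith
    qed
    ultimately show "\<exists>y. (f has_real_derivative y) (at u) \<and> 0 \<le> y" by blast
  qed
  thus ?thesis by (simp add: f_def)
qed

text \<open>On the line Re z = 1/4 the real part of the digamma function governs the derivative of
  \<open>theta\<close>, and the imaginary part that of log |Gamma|.\<close>

definition psi_re :: "real \<Rightarrow> real" where "psi_re y = Re (Digamma (Complex (1/4) y))"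
definition psi_im :: "real \<Rightarrow> real" where "psi_im y = Im (Digamma (Complex (1/4) y))"

lemma inverse_Complex: "inverse (Complex a y) = Complex (a / (a\<^sup>2 + y\<^sup>2)) (- y / (a\<^sup>2 + y\<^sup>2))"
  by (simp add: complex_eq_iff)

lemma psi_re_LIMSEQ:
  "(\<lambda>m. ln (real m) - (\<Sum>n<m. (real n + 1/4) / ((real n + 1/4)\<^sup>2 + y\<^sup>2))) \<longlonglongrightarrow> psi_re y"
proof -
  have "Complex (1/4) y \<noteq> 0" by (simp add: complex_eq_iff)
  from tendsto_Re[OF Digamma_LIMSEQ[OF this]]
  have "(\<lambda>m. ln (real m) - (\<Sum>n<m. Re (inverse (Complex (1/4) y + of_nat n)))) \<longlonglongrightarrow> psi_re y"
    by (simp add: psi_re_def)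
  moreover have "Complex (1/4) y + of_nat n = Complex (real n + 1/4) y" for n by (simp add: complex_eq_iff)
  ultimately show ?thesis by (simp only: inverse_Complex complex.sel)
qed

lemma psi_im_LIMSEQ:
  "(\<lambda>m. \<Sum>n<m. y / ((real n + 1/4)\<^sup>2 + y\<^sup>2)) \<longlonglongrightarrow> psi_im y"
proof -
  have "Complex (1/4) y \<noteq> 0" by (simp add: complex_eq_iff)
  from tendsto_Im[OF Digamma_LIMSEQ[OF this]]
  have "(\<lambda>m. - (\<Sum>n<m. Im (inverse (Complex (1/4) y + of_nat n)))) \<longlonglongrightarrow> psi_im y"
    by (simp add: psi_im_def)
  moreover have "Complex (1/4) y + of_nat n = Complex (real n + 1/4) y" for n by (simp add: complex_eq_iff)
  ultimately show ?thesis by (simp only: inverse_Complex complex.sel sum_negf[symmetric] minus_divide_left minus_minus)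
qed

lemma psi_re_ge:
  assumes y: "y\<^sup>2 > 1/4" shows "psi_re y \<ge> ln (y\<^sup>2 - 3/16) / 2"
proof -
  \<comment> \<open>With A = n + 1/4 and D = A^2 + y^2, the numbers D - A and D + A are consecutive
    values of \<open>g\<close>, so the logarithmic bounds telescope. The assumption on y keeps
    \<open>g 0\<close> positive.\<close>
  define g where "g = (\<lambda>n. (real n - 1/4)\<^sup>2 + (y\<^sup>2 - 1/4))"
  have gpos: "g n > 0" for n unfolding g_def using y by (intro add_nonneg_pos) auto
  have tb: "(real n + 1/4) / ((real n + 1/4)\<^sup>2 + y\<^sup>2) \<le> (ln (g (Suc n)) - ln (g n)) / 2" for n
  proof -
    define A D where "A = real n + 1/4" and "D = (real n + 1/4)\<^sup>2 + y\<^sup>2"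
    have e: "D + A = g (Suc n)" "D - A = g n"
      by (simp_all add: A_def D_def g_def power2_eq_square field_simps)
    have "A < D" using gpos[of n] e by simp
    hence "2 * A / D \<le> ln (D + A) - ln (D - A)" by (intro ln_ratio_ge) (simp_all add: A_def)
    hence "A / D \<le> (ln (D + A) - ln (D - A)) / 2" by (simp add: mult.commute)
    thus ?thesis unfolding e unfolding A_def D_def .
  qed
  have "(\<Sum>n<m. (real n + 1/4) / ((real n + 1/4)\<^sup>2 + y\<^sup>2)) \<le> (ln (g m) - ln (g 0)) / 2" for m
  proof -
    have "(\<Sum>n<m. (real n + 1/4) / ((real n + 1/4)\<^sup>2 + y\<^sup>2)) \<le> (\<Sum>n<m. ln (g (Suc n)) / 2 - ln (g n) / 2)"
      by (intro sum_mono) (use tb in \<open>simp add: diff_divide_distrib\<close>)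
    also have "\<dots> = ln (g m) / 2 - ln (g 0) / 2" by (rule sum_lessThan_telescope)
    finally show ?thesis by (simp add: diff_divide_distrib)
  qed
  hence "ln (real m) - (ln (g m) - ln (g 0)) / 2 \<le> ln (real m) - (\<Sum>n<m. (real n + 1/4) / ((real n + 1/4)\<^sup>2 + y\<^sup>2))" for m
    by (rule diff_left_mono)
  moreover have "(\<lambda>m. ln (real m) - (ln (g m) - ln (g 0)) / 2) \<longlonglongrightarrow> ln (g 0) / 2"
    unfolding g_def by real_asymp
  ultimately have "ln (g 0) / 2 \<le> psi_re y"
    by (intro LIMSEQ_le[OF _ psi_re_LIMSEQ]) blast+
  moreover have "g 0 = y\<^sup>2 - 3/16" by (simp add: g_def power2_eq_square)
  ultimately show ?thesis by simp
qed

lemma psi_re_le: "psi_re y \<le> ln (y\<^sup>2 + 13/16) / 2"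
proof -
  define g where "g = (\<lambda>n. (real n - 1/4)\<^sup>2 + (y\<^sup>2 + 3/4))"
  have gpos: "g n > 0" for n unfolding g_def by (intro add_nonneg_pos) auto
  have tb: "(real n + 1/4) / ((real n + 1/4)\<^sup>2 + y\<^sup>2) \<ge> (ln (g (Suc n)) - ln (g n)) / 2" for n
  proof -
    define A B where "A = real n + 1/4" and "B = (real n + 1/4)\<^sup>2 + y\<^sup>2"
    \<comment> \<open>The shift by 1 keeps D - A and D + A consecutive values of \<open>g\<close>
      and compensates for the weaker upper bound: D B <= D^2 - A^2 follows from A^2 <= B <
      D.\<close>
    define D where "D = B + 1"
    have A: "A > 0" by (simp add: A_def)
    have B: "B > 0" unfolding B_def by (intro add_pos_nonneg) auto
    have BA: "B \<ge> A\<^sup>2" by (simp add: A_def B_def)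
    have e: "D + A = g (Suc n)" "D - A = g n"
      by (simp_all add: A_def B_def D_def g_def power2_eq_square field_simps)
    have AD: "A < D" using gpos[of n] e by simp
    hence "ln (D + A) - ln (D - A) \<le> 2 * A * D / (D\<^sup>2 - A\<^sup>2)" using A by (intro ln_ratio_le) simp_all
    also have "\<dots> \<le> 2 * A / B"
    proof -
      have "D\<^sup>2 - A\<^sup>2 > 0" using AD A by (simp add: power_strict_mono)
      moreover have "D * B \<le> D\<^sup>2 - A\<^sup>2" using BA by (simp add: D_def power2_eq_square algebra_simps)
      hence "2 * A * (D * B) \<le> 2 * A * (D\<^sup>2 - A\<^sup>2)" using A by (intro mult_left_mono) auto
      ultimately show ?thesis using B by (simp add: field_simps)
    qed
    finally have "(ln (D + A) - ln (D - A)) / 2 \<le> A / B" by (simp add: mult.commute)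
    thus ?thesis unfolding e unfolding A_def B_def .
  qed
  have "(\<Sum>n<m. (real n + 1/4) / ((real n + 1/4)\<^sup>2 + y\<^sup>2)) \<ge> (ln (g m) - ln (g 0)) / 2" for m
  proof -
    have "(\<Sum>n<m. (real n + 1/4) / ((real n + 1/4)\<^sup>2 + y\<^sup>2)) \<ge> (\<Sum>n<m. ln (g (Suc n)) / 2 - ln (g n) / 2)"
      by (intro sum_mono) (use tb in \<open>simp add: diff_divide_distrib\<close>)
    moreover have "(\<Sum>n<m. ln (g (Suc n)) / 2 - ln (g n) / 2) = ln (g m) / 2 - ln (g 0) / 2" by (rule sum_lessThan_telescope)
    ultimately show ?thesis by (simp add: diff_divide_distrib)
  qed
  hence "ln (real m) - (\<Sum>n<m. (real n + 1/4) / ((real n + 1/4)\<^sup>2 + y\<^sup>2)) \<le> ln (real m) - (ln (g m) - ln (g 0)) / 2" for m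
    by (rule diff_left_mono)
  moreover have "(\<lambda>m. ln (real m) - (ln (g m) - ln (g 0)) / 2) \<longlonglongrightarrow> ln (g 0) / 2"
    unfolding g_def by real_asymp
  ultimately have "psi_re y \<le> ln (g 0) / 2"
    by (intro LIMSEQ_le[OF psi_re_LIMSEQ]) blast+
  moreover have "g 0 = y\<^sup>2 + 13/16" by (simp add: g_def power2_eq_square)
  ultimately show ?thesis by simp
qed

text \<open>Every term of the series decreases in y, and the gap in the term n = 0 is fixed, so
  strictness survives the limit.\<close>

lemma psi_re_strict_mono:
  assumes "0 \<le> y1" "y1 < y2" shows "psi_re y1 < psi_re y2"
proof -
  define f where "f = (\<lambda>y n. (real n + 1/4) / ((real n + 1/4)\<^sup>2 + y\<^sup>2))"
  have sq: "y1\<^sup>2 < y2\<^sup>2" using assms by (intro power_strict_mono) auto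
  have le: "f y2 n \<le> f y1 n" for n
    unfolding f_def using sq by (intro divide_left_mono) (auto intro!: mult_pos_pos add_pos_nonneg)
  have lt: "f y2 0 < f y1 0"
    unfolding f_def using sq by (intro divide_strict_left_mono) (auto intro!: mult_pos_pos add_pos_nonneg)
  have "ln (real m) - (\<Sum>n<m. f y1 n) + (f y1 0 - f y2 0) \<le> ln (real m) - (\<Sum>n<m. f y2 n)" if m: "m \<ge> 1" for m
  proof -
    have "(\<Sum>n<m. f y2 n) + (f y1 0 - f y2 0) \<le> (\<Sum>n<m. f y1 n)"
    proof -
      have "(\<Sum>n\<in>{0}. f y1 n - f y2 n) \<le> (\<Sum>n<m. f y1 n - f y2 n)"
        using m le by (intro sum_mono2) auto
      thus ?thesis by (simp add: sum_subtractf)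
    qed
    thus ?thesis by linarith
  qed
  hence "\<exists>N. \<forall>m\<ge>N. ln (real m) - (\<Sum>n<m. f y1 n) + (f y1 0 - f y2 0) \<le> ln (real m) - (\<Sum>n<m. f y2 n)" by blast
  hence "psi_re y1 + (f y1 0 - f y2 0) \<le> psi_re y2"
    by (intro LIMSEQ_le[OF tendsto_add[OF psi_re_LIMSEQ tendsto_const] psi_re_LIMSEQ]) (simp add: f_def)
  thus ?thesis using lt by linarith
qed

text \<open>With A = n + 1/4, p = (A + 1/2) / Y and r = (A - 1/2) / Y, the choice of Y gives 1 + p r
  = (A^2 + y^2) / Y^2. A term of the series is thus at least y / Y times a difference of
  arctangents, and these differences telescope.\<close>

lemma psi_im_ge:
  assumes y: "y > 0"
  defines "Y \<equiv> sqrt (y\<^sup>2 + 1/4)"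
  shows "psi_im y \<ge> y / Y * (pi / 2 + arctan (1 / (4 * Y)))"
proof -
  have Y: "Y > 0" "Y\<^sup>2 = y\<^sup>2 + 1/4" unfolding Y_def by (auto simp: add_nonneg_pos)
  define g where "g = (\<lambda>n. arctan ((real n - 1/4) / Y))"
  have tb: "y / Y * (g (Suc n) - g n) \<le> y / ((real n + 1/4)\<^sup>2 + y\<^sup>2)" for n
  proof -
    define A where "A = real n + 1/4"
    define p r where "p = (A + 1/2) / Y" and "r = (A - 1/2) / Y"
    have pr: "1 + p * r = (A\<^sup>2 + y\<^sup>2) / Y\<^sup>2"
    proof -
      have "p * r = (A\<^sup>2 - 1/4) / Y\<^sup>2" unfolding p_def r_def by (simp add: power2_eq_square algebra_simps)
      hence "1 + p * r = (Y\<^sup>2 + (A\<^sup>2 - 1/4)) / Y\<^sup>2" using Y(1) by (simp add: add_divide_distrib)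
      thus ?thesis unfolding Y(2) by (simp add: algebra_simps)
    qed
    have AP: "A\<^sup>2 + y\<^sup>2 > 0" using y by (intro add_nonneg_pos) auto
    have "arctan p - arctan r \<le> (p - r) / (1 + p * r)"
    proof (rule arctan_diff_le)
      show "r \<le> p" unfolding p_def r_def using Y by (intro divide_right_mono) auto
      show "1 + p * r > 0" unfolding pr using AP Y(1) by (intro divide_pos_pos) auto
    qed
    also have "p - r = 1 / Y" unfolding p_def r_def by (simp add: diff_divide_distrib[symmetric])
    also have "1 / Y / (1 + p * r) = Y / (A\<^sup>2 + y\<^sup>2)" unfolding pr using Y(1) by (simp add: power2_eq_square)
    finally have "y / Y * (arctan p - arctan r) \<le> y / Y * (Y / (A\<^sup>2 + y\<^sup>2))"
      using y Y by (intro mult_left_mono) auto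
    also have "\<dots> = y / (A\<^sup>2 + y\<^sup>2)" using Y by simp
    finally show ?thesis by (simp add: g_def p_def r_def A_def)
  qed
  have "y / Y * (g m - g 0) \<le> (\<Sum>n<m. y / ((real n + 1/4)\<^sup>2 + y\<^sup>2))" for m
  proof -
    have "y / Y * (g m - g 0) = (\<Sum>n<m. y / Y * (g (Suc n) - g n))"
      unfolding sum_distrib_left[symmetric] sum_lessThan_telescope ..
    also have "\<dots> \<le> (\<Sum>n<m. y / ((real n + 1/4)\<^sup>2 + y\<^sup>2))" by (intro sum_mono tb)
    finally show ?thesis .
  qed
  moreover have "(\<lambda>m. y / Y * (g m - g 0)) \<longlonglongrightarrow> y / Y * (pi / 2 - g 0)"
  proof -
    have "filterlim (\<lambda>m. (real m - 1/4) / Y) at_top sequentially" using Y(1) by real_asymp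
    hence "g \<longlonglongrightarrow> pi / 2" unfolding g_def by (rule filterlim_compose[OF tendsto_arctan_at_top])
    thus ?thesis by (intro tendsto_intros)
  qed
  ultimately have "y / Y * (pi / 2 - g 0) \<le> psi_im y"
    by (intro LIMSEQ_le[OF _ psi_im_LIMSEQ]) blast+
  moreover have "g 0 = - arctan (1 / (4 * Y))" by (simp add: g_def flip: arctan_minus)
  ultimately show ?thesis by simp
qed

text \<open>The range contains \<open>a_theta / 2\<close>, and half of the bound is the constant
  812/1000 in the sign estimate for the derivative of Z.\<close>

lemma psi_im_lower_bound:
  assumes "3 \<le> y" "y \<le> 32/10" shows "psi_im y \<ge> 1624/1000"
proof -
  define Y where "Y = sqrt (y\<^sup>2 + 1/4)"
  have y2: "9 \<le> y\<^sup>2" "y\<^sup>2 \<le> 1024/100"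
    using power_mono[of 3 y 2] power_mono[of y "32/10" 2] assms by (auto simp: power2_eq_square)
  have Y2: "Y\<^sup>2 = y\<^sup>2 + 1/4" and Y: "Y > 0" unfolding Y_def by (auto simp: add_nonneg_pos)
  have Yu: "Y \<le> 324/100" by (rule power2_le_imp_le) (use Y2 y2 in \<open>auto simp: power2_eq_square\<close>)
  \<comment> \<open>The quotient is smallest at y = 3, where its square is 9 / 9.25.\<close>
  have r: "y / Y \<ge> 9863/10000"
  proof (rule power2_le_imp_le)
    have "(y / Y)\<^sup>2 = y\<^sup>2 / (y\<^sup>2 + 1/4)" by (simp add: power_divide Y2)
    also have "\<dots> \<ge> (9863/10000)\<^sup>2" using y2 by (simp add: field_simps power2_eq_square)
    finally show "(9863/10000)\<^sup>2 \<le> (y / Y)\<^sup>2" by simp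
  qed (use assms Y in auto)
  have "1 / (4 * Y) \<ge> 771/10000" using Yu Y by (simp add: field_simps)
  hence "arctan (1 / (4 * Y)) \<ge> arctan (771/10000)" by (simp add: arctan_le_iff)
  moreover have "arctan (771/10000) \<ge> 769/10000"
    using arctan_lower_bound[of "771/10000" 1] by (simp add: eval_nat_numeral)
  ultimately have a: "arctan (1 / (4 * Y)) \<ge> 769/10000" by linarith
  have "pi / 2 \<ge> 15707/10000" using pi_approx by simp
  hence "9863/10000 * (15707/10000 + 769/10000) \<le> y / Y * (pi / 2 + arctan (1 / (4 * Y)))"
    using r a assms Y by (intro mult_mono add_mono) auto
  moreover have "y / Y * (pi / 2 + arctan (1 / (4 * Y))) \<le> psi_im y"
    unfolding Y_def by (rule psi_im_ge) (use assms in simp)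
  moreover have "1624/1000 \<le> 9863/10000 * (15707/10000 + 769/10000 :: real)" by simp
  ultimately show ?thesis by (meson order.trans)
qed

subsection \<open>The Riemann-Siegel theta function\<close>

text \<open>The values of \<open>d\<close> lie in the discrete set of integer multiples of pi, so
  \<open>d\<close> is locally constant. Uniqueness of phases rests on this; the sine, not
  \<open>cis\<close>, also covers real factors of opposite sign.\<close>

lemma sin_eq_zero_imp_const:
  fixes d :: "real \<Rightarrow> real"
  assumes "connected A" "continuous_on A d" "\<And>x. x \<in> A \<Longrightarrow> sin (d x) = 0" "a \<in> A" "b \<in> A"
  shows "d a = d b"
proof -
  have eq: "d x = d y" if "x \<in> A" "y \<in> A" "\<bar>d x - d y\<bar> < pi" for x y
  proof -
    have "sin (d x - d y) = 0" using assms(3) that(1,2) by (simp add: sin_diff)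
    thus ?thesis using that(3) sin_eq_0_pi[of "d x - d y"] by (simp add: abs_less_iff)
  qed
  show ?thesis
  proof (rule connected_local_const[where f = d and A = A])
    show "\<forall>x\<in>A. \<forall>\<^sub>F y in at x within A. d x = d y"
    proof
      fix x assume x: "x \<in> A"
      have "(d \<longlongrightarrow> d x) (at x within A)" using assms(2) x by (simp add: continuous_on_def)
      hence "\<forall>\<^sub>F y in at x within A. dist (d y) (d x) < pi" by (rule tendstoD) simp
      moreover have "\<forall>\<^sub>F y in at x within A. y \<in> A" by (simp add: eventually_at_filter)
      ultimately show "\<forall>\<^sub>F y in at x within A. d x = d y"
        by eventually_elim (intro eq x, simp_all add: dist_real_def abs_minus_commute)
    qed
  qed (use assms in auto)
qed

definition ln_Gamma_strip :: "complex \<Rightarrow> complex" where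
  "ln_Gamma_strip z = ln_Gamma (1/4 + \<i> * z / 2)"

text \<open>The argument of \<open>ln_Gamma\<close> has real part 1/4 - Im z / 2, which is positive
  exactly in this half-plane.\<close>

lemma ln_Gamma_strip_holomorphic: "ln_Gamma_strip holomorphic_on {z. Im z < 1/2}"
proof -
  have "(\<lambda>z. 1/4 + \<i> * z / 2) ` {z. Im z < 1/2} \<inter> \<real>\<^sub>\<le>\<^sub>0 = {}"
    by (auto simp: complex_nonpos_Reals_iff)
  hence "ln_Gamma holomorphic_on (\<lambda>z. 1/4 + \<i> * z / 2) ` {z. Im z < 1/2}" by (rule holomorphic_ln_Gamma)
  moreover have "(\<lambda>z. 1/4 + \<i> * z / 2) holomorphic_on {z. Im z < 1/2}" by (intro holomorphic_intros) simp_all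
  ultimately show ?thesis
    unfolding ln_Gamma_strip_def[abs_def] using holomorphic_on_compose[unfolded o_def] by blast
qed

lemma Complex_quarter: "1/4 + \<i> * complex_of_real t / 2 = Complex (1/4) (t/2)"
  by (simp add: complex_eq_iff)

definition log_abs_Gamma :: "real \<Rightarrow> real" where
  "log_abs_Gamma t = Re (ln_Gamma (Complex (1/4) (t/2)))"

definition theta :: "real \<Rightarrow> real" where
  "theta t = Im (ln_Gamma (Complex (1/4) (t/2))) - t / 2 * ln pi"

lemma real_analytic_log_abs_Gamma: "real_analytic log_abs_Gamma"
proof -
  have "real_analytic (\<lambda>t. Re (ln_Gamma_strip (of_real t)))"
    by (rule real_analytic_Re[OF ln_Gamma_strip_holomorphic open_halfspace_Im_lt]) simp
  thus ?thesis by (rule real_analytic_cong) (simp add: ln_Gamma_strip_def log_abs_Gamma_def Complex_quarter)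
qed

lemma real_analytic_theta: "real_analytic theta"
proof -
  have "(\<lambda>z. - \<i> * ln_Gamma_strip z - z / 2 * of_real (ln pi)) holomorphic_on {z. Im z < 1/2}"
    by (intro holomorphic_intros ln_Gamma_strip_holomorphic) auto
  hence "real_analytic (\<lambda>t. Re (- \<i> * ln_Gamma_strip (of_real t) - of_real t / 2 * of_real (ln pi)))"
    by (rule real_analytic_Re[OF _ open_halfspace_Im_lt]) simp
  thus ?thesis by (rule real_analytic_cong) (simp add: ln_Gamma_strip_def theta_def Complex_quarter)
qed

lemma ln_Gamma_line_derivative:
  "((\<lambda>t. ln_Gamma (Complex (1/4) (t/2))) has_vector_derivative \<i> / 2 * Digamma (Complex (1/4) (t/2))) (at t)"
proof -
  have "Complex (1/4) (t/2) \<notin> \<real>\<^sub>\<le>\<^sub>0" by (simp add: complex_nonpos_Reals_iff)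
  hence 1: "(ln_Gamma has_field_derivative Digamma (Complex (1/4) (t/2))) (at (Complex (1/4) (t/2)))"
    by (rule has_field_derivative_ln_Gamma_complex)
  have 2: "((\<lambda>z. 1/4 + \<i> * z / 2) has_field_derivative \<i> / 2) (at (of_real t))"
    by (auto intro!: derivative_eq_intros)
  have "((ln_Gamma \<circ> (\<lambda>z. 1/4 + \<i> * z / 2)) has_field_derivative Digamma (Complex (1/4) (t/2)) * (\<i> / 2)) (at (of_real t))"
    by (rule DERIV_chain) (use 1 2 in \<open>simp_all only: Complex_quarter\<close>)
  hence "((\<lambda>t. (ln_Gamma \<circ> (\<lambda>z. 1/4 + \<i> * z / 2)) (of_real t)) has_vector_derivative Digamma (Complex (1/4) (t/2)) * (\<i> / 2)) (at t)"
    by (rule has_vector_derivative_real_field)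
  thus ?thesis by (simp only: o_def Complex_quarter mult.commute)
qed

lemma log_abs_Gamma_derivative: "(log_abs_Gamma has_real_derivative - psi_im (t/2) / 2) (at t)"
  using bounded_linear.has_vector_derivative[OF bounded_linear_Re ln_Gamma_line_derivative[of t]]
  unfolding log_abs_Gamma_def[abs_def] has_real_derivative_iff_has_vector_derivative by (simp add: psi_im_def)

lemma theta_derivative: "(theta has_real_derivative (psi_re (t/2) - ln pi) / 2) (at t)"
proof -
  have "((\<lambda>t. Im (ln_Gamma (Complex (1/4) (t/2)))) has_real_derivative psi_re (t/2) / 2) (at t)"
    using bounded_linear.has_vector_derivative[OF bounded_linear_Im ln_Gamma_line_derivative[of t]]
    unfolding has_real_derivative_iff_has_vector_derivative by (simp add: psi_re_def)
  moreover have "((\<lambda>t. t / 2 * ln pi) has_real_derivative 1 / 2 * ln pi) (at t)"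
    by (auto intro!: derivative_eq_intros)
  ultimately have "((\<lambda>t. Im (ln_Gamma (Complex (1/4) (t/2))) - t / 2 * ln pi) has_real_derivative psi_re (t/2) / 2 - 1 / 2 * ln pi) (at t)"
    by (rule DERIV_diff)
  thus ?thesis unfolding theta_def[abs_def] by (simp add: diff_divide_distrib)
qed

lemma deriv_theta: "deriv theta t = (psi_re (t/2) - ln pi) / 2"
  by (rule DERIV_imp_deriv[OF theta_derivative])

lemma Gamma_line: "Gamma (Complex (1/4) (t/2)) = of_real (exp (log_abs_Gamma t)) * cis (theta t + t / 2 * ln pi)"
proof -
  have "Complex (1/4) (t/2) \<notin> \<int>\<^sub>\<le>\<^sub>0" by (auto elim!: nonpos_Ints_cases simp: complex_eq_iff)
  hence "Gamma (Complex (1/4) (t/2)) = exp (ln_Gamma (Complex (1/4) (t/2)))" by (simp add: Gamma_complex_altdef)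
  also have "\<dots> = of_real (exp (log_abs_Gamma t)) * cis (theta t + t / 2 * ln pi)"
    by (subst exp_eq_polar) (simp add: log_abs_Gamma_def theta_def)
  finally show ?thesis .
qed

lemma cmod_Gamma_line: "cmod (Gamma (Complex (1/4) (t/2))) = exp (log_abs_Gamma t)"
  unfolding Gamma_line by (simp add: norm_mult)

lemma theta_0: "theta 0 = 0"
proof -
  have e: "Complex (1/4) 0 = of_real (1/4)" by (simp add: complex_eq_iff)
  have "ln_Gamma (Complex (1/4) 0) = of_real (ln_Gamma (1/4))" unfolding e by (rule ln_Gamma_complex_of_real) simp
  thus ?thesis by (simp add: theta_def)
qed

theorem rs_theta_eq: "rs_theta = theta"
  unfolding rs_theta_def
proof (rule the_equality, intro conjI allI)
  show "real_analytic theta" "theta 0 = 0" by (rule real_analytic_theta theta_0)+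
  show "Gamma (Complex (1/4) (t/2)) = of_real (cmod (Gamma (Complex (1/4) (t/2)))) * cis (theta t + t / 2 * ln pi)" for t
    unfolding cmod_Gamma_line by (rule Gamma_line)
next
  fix \<theta> assume *: "real_analytic \<theta> \<and> \<theta> 0 = 0 \<and> (\<forall>t. Gamma (Complex (1/4) (t/2)) = of_real (cmod (Gamma (Complex (1/4) (t/2)))) * cis (\<theta> t + t / 2 * ln pi))"
  have eq: "cis (\<theta> t + t / 2 * ln pi) = cis (theta t + t / 2 * ln pi)" for t
  proof -
    have "complex_of_real (exp (log_abs_Gamma t)) * cis (\<theta> t + t / 2 * ln pi) = of_real (exp (log_abs_Gamma t)) * cis (theta t + t / 2 * ln pi)"
      using * Gamma_line[of t] unfolding cmod_Gamma_line by metis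
    thus ?thesis by simp
  qed
  have "\<theta> t - theta t = \<theta> 0 - theta 0" for t
  proof (rule sin_eq_zero_imp_const[where d = "\<lambda>t. \<theta> t - theta t" and A = UNIV])
    show "continuous_on UNIV (\<lambda>t. \<theta> t - theta t)"
      using * real_analytic_theta by (intro continuous_intros real_analytic_continuous_on) auto
    show "sin (\<theta> t - theta t) = 0" for t
    proof -
      have "cis ((\<theta> t + t / 2 * ln pi) - (theta t + t / 2 * ln pi)) = cis (theta t + t / 2 * ln pi) / cis (theta t + t / 2 * ln pi)"
        by (simp only: cis_divide[symmetric] eq)
      hence "cis (\<theta> t - theta t) = 1" by simp
      thus ?thesis by (simp add: complex_eq_iff)
    qed
  qed auto
  thus "\<theta> = theta" using * theta_0 by (simp add: fun_eq_iff)
qed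

lemma deriv_theta_strict_mono:
  assumes "0 \<le> t1" "t1 < t2" shows "deriv theta t1 < deriv theta t2"
  unfolding deriv_theta using psi_re_strict_mono[of "t1/2" "t2/2"] assms by simp

text \<open>In this form the sign of the derivative of \<open>theta\<close> reduces to comparing
  pi^2 with a rational number.\<close>

lemma ln_pi_conv: "ln pi = ln (pi\<^sup>2) / 2"
  by (simp add: ln_realpow)

text \<open>The upper bound for the digamma function at y = 3 reduces this to 9 + 13/16 <
  pi^2.\<close>

lemma deriv_theta_6: "deriv theta 6 < 0"
proof -
  have "pi\<^sup>2 > 98125/10000" 
  proof -
    have "(314159/100000)\<^sup>2 \<le> pi\<^sup>2" using pi_approx by (intro power_mono) auto
    thus ?thesis by (simp add: power2_eq_square)
  qed
  hence "ln (98125/10000 :: real) < ln (pi\<^sup>2)" by (subst ln_less_cancel_iff) auto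
  moreover have "psi_re 3 \<le> ln (98125/10000) / 2" using psi_re_le[of 3] by simp
  ultimately have "psi_re 3 < ln (pi\<^sup>2) / 2" by linarith
  thus ?thesis unfolding deriv_theta ln_pi_conv by simp
qed

text \<open>6.344 is chosen so that (6.344 / 2)^2 - 3/16, from the lower bound for the digamma
  function, just exceeds pi^2.\<close>

lemma deriv_theta_6344: "deriv theta (6344/1000) > 0"
proof -
  have "pi\<^sup>2 < (3172/1000)\<^sup>2 - 3/16"
  proof -
    have "pi\<^sup>2 \<le> (314160/100000)\<^sup>2" using pi_approx by (intro power_mono) auto
    thus ?thesis by (simp add: power2_eq_square)
  qed
  hence "ln (pi\<^sup>2) < ln ((3172/1000)\<^sup>2 - 3/16)" by (subst ln_less_cancel_iff) (auto simp: power2_eq_square)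
  moreover have "psi_re (3172/1000) \<ge> ln ((3172/1000)\<^sup>2 - 3/16) / 2" by (rule psi_re_ge) (simp add: power2_eq_square)
  ultimately show ?thesis unfolding deriv_theta ln_pi_conv by simp
qed

lemma a_theta_props: "6 < a_theta" "a_theta < 6344/1000" "deriv theta a_theta = 0"
proof -
  have "continuous_on {6..6344/1000} (deriv theta)"
    by (intro real_analytic_continuous_on real_analytic_deriv real_analytic_theta)
  hence "\<exists>x. 6 \<le> x \<and> x \<le> 6344/1000 \<and> deriv theta x = 0"
    by (intro IVT') (use deriv_theta_6 deriv_theta_6344 in auto)
  then obtain x where x: "6 \<le> x" "x \<le> 6344/1000" "deriv theta x = 0" by blast
  have "a_theta = x"
    unfolding a_theta_def rs_theta_eq
  proof (rule the_equality)
    show "0 < x \<and> deriv theta x = 0" using x by simp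
    fix a assume a: "0 < a \<and> deriv theta a = 0"
    show "a = x"
    proof (rule ccontr)
      assume "a \<noteq> x"
      hence "a < x \<or> x < a" by auto
      thus False using deriv_theta_strict_mono[of a x] deriv_theta_strict_mono[of x a] a x by auto
    qed
  qed
  moreover have "x \<noteq> 6" "x \<noteq> 6344/1000" using x(3) deriv_theta_6 deriv_theta_6344 by (metis less_irrefl)+
  ultimately show "6 < a_theta" "a_theta < 6344/1000" "deriv theta a_theta = 0" using x by auto
qed

subsection \<open>Numerical bounds between 6 and 6.344\<close>

lemma integral_Ici_derivative:
  fixes F g :: "real \<Rightarrow> real"
  assumes der: "\<And>x. x \<ge> 1 \<Longrightarrow> (F has_real_derivative - g x) (at x)"
    and lim: "(\<lambda>n. F (real n)) \<longlonglongrightarrow> 0"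
    and g: "g absolutely_integrable_on {1..}"
  shows "integral {1..} g = F 1"
proof -
  define f where "f = (\<lambda>n x. if x \<in> {1..real n} then g x else 0)"
  have I: "(g has_integral F 1 - F (real n)) {1..real n}" if "n \<ge> 1" for n
  proof -
    have "((\<lambda>x. - g x) has_integral F (real n) - F 1) {1..real n}"
      using that by (intro fundamental_theorem_of_calculus)
        (auto simp: has_real_derivative_iff_has_vector_derivative[symmetric] intro!: has_field_derivative_at_within der)
    from has_integral_neg[OF this] show ?thesis by simp
  qed
  have If: "(f n has_integral F 1 - F (real n)) {1..}" if "n \<ge> 1" for n
    using I[OF that] unfolding f_def by (subst has_integral_restrict) auto
  have "(\<lambda>n. integral {1..} (f (Suc n))) \<longlonglongrightarrow> integral {1..} g"
  proof (rule dominated_convergence(2))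
    show "f (Suc n) integrable_on {1..}" for n using If[of "Suc n"] by (auto intro: has_integral_integrable)
    show "(\<lambda>x. norm (g x)) integrable_on {1..}" using g by (rule absolutely_integrable_on_def[THEN iffD1, THEN conjunct2])
    show "norm (f (Suc n) x) \<le> norm (g x)" for n x by (simp add: f_def)
    show "(\<lambda>n. f (Suc n) x) \<longlonglongrightarrow> g x" if "x \<in> {1..}" for x
    proof (rule tendsto_eventually)
      show "\<forall>\<^sub>F n in sequentially. f (Suc n) x = g x"
        using eventually_ge_at_top[of "nat \<lceil>x\<rceil>"] by eventually_elim (use that in \<open>auto simp: f_def\<close>)
    qed
  qed
  moreover have "integral {1..} (f (Suc n)) = F 1 - F (real (Suc n))" for n using If[of "Suc n"] by (auto intro: integral_unique)
  ultimately have "(\<lambda>n. F 1 - F (real (Suc n))) \<longlonglongrightarrow> integral {1..} g" by simp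
  moreover have "(\<lambda>n. F 1 - F (real (Suc n))) \<longlonglongrightarrow> F 1 - 0"
    by (intro tendsto_diff tendsto_const LIMSEQ_Suc lim)
  ultimately show ?thesis using LIMSEQ_unique by fastforce
qed

text \<open>Up to the factor pi^(-p - 1) this is the upper incomplete Gamma function Gamma(p + 1,
  pi).\<close>

definition exp_moment :: "real \<Rightarrow> real" where
  "exp_moment p = integral {1..} (\<lambda>x. x powr p * exp (- pi * x))"

lemma exp_pi_le: "x \<ge> 1 \<Longrightarrow> exp (- pi * x) \<le> exp (- x)"
proof -
  assume "x \<ge> 1"
  hence "1 * x \<le> pi * x" using pi_ge_two by (intro mult_right_mono) auto
  thus ?thesis by simp
qed

lemma exp_moment_abs_integrable: "(\<lambda>x. x powr p * exp (- pi * x)) absolutely_integrable_on {1..}"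
proof (rule absolutely_integrable_decay[where C = 1 and p = p])
  show "norm (x powr p * exp (- pi * x)) \<le> 1 * (x powr p * exp (- x))" if "x \<ge> 1" for x
    using exp_pi_le[OF that] by (auto intro!: mult_left_mono)
qed measurable

lemma exp_moment_integrable: "(\<lambda>x. x powr p * exp (- pi * x)) integrable_on {1..}"
  by (rule set_lebesgue_integral_eq_integral(1)[OF exp_moment_abs_integrable])

text \<open>Integration by parts. The recursion expresses the moments with exponents 5/4, 1/4, -3/4
  and -11/4 by the one at -7/4, the only one that needs an estimate of its own.\<close>

lemma exp_moment_rec: "pi * exp_moment p = exp (- pi) + p * exp_moment (p - 1)"
proof -
  define g where "g = (\<lambda>x. pi * (x powr p * exp (- pi * x)) - p * (x powr (p - 1) * exp (- pi * x)))"
  have "integral {1..} g = 1 powr p * exp (- pi * 1)"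
  proof (rule integral_Ici_derivative[where F = "\<lambda>x. x powr p * exp (- pi * x)"])
    show "((\<lambda>x. x powr p * exp (- pi * x)) has_real_derivative - g x) (at x)" if "x \<ge> 1" for x
      unfolding g_def using that by (auto intro!: derivative_eq_intros simp: algebra_simps)
    show "(\<lambda>n. real n powr p * exp (- pi * real n)) \<longlonglongrightarrow> 0" by real_asymp
    show "g absolutely_integrable_on {1..}" unfolding g_def
      by (intro set_integral_diff(1) set_integrable_mult_right exp_moment_abs_integrable)
  qed
  moreover have "integral {1..} g = pi * exp_moment p - p * exp_moment (p - 1)"
    unfolding g_def exp_moment_def
    by (intro integral_unique has_integral_diff has_integral_mult_right integrable_integral exp_moment_integrable)
  ultimately show ?thesis by simp
qed

text \<open>
  \<open>N(v) / D(v)\<close> is the fifth even convergent of the continued fraction of the incomplete gamma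
  function \<open>e\<^sup>v v\<^sup>3\<^sup>/\<^sup>4 \<Gamma>(-3/4, v)\<close>.
\<close>
lemma exp_moment_convergent:
  fixes v :: real
  defines "N \<equiv> \<lambda>v::real. 509140 + 682560 * v + 233088 * v^2 + 27648 * v^3 + 1024 * v^4"
    and "D \<equiv> \<lambda>v::real. 504735 + 1442100 * v + 1048800 * v^2 + 279680 * v^3 + 29440 * v^4 + 1024 * v^5"
  shows "exp (- pi) * (N pi / D pi) \<le> exp_moment (-7/4)"
proof -
  define N' where "N' = (\<lambda>v::real. 682560 + 466176 * v + 82944 * v^2 + 4096 * v^3)"
  define D' where "D' = (\<lambda>v::real. 1442100 + 2097600 * v + 839040 * v^2 + 117760 * v^3 + 5120 * v^4)"
  \<comment> \<open>\<open>K\<close> equals 1024 * 5! * \<open>D 0\<close>, as \<open>id\<close> at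
    v = 0 shows.\<close>
  define K where "K = (1024 :: real)^2 * 7571025 / 128"
  have Dpos: "D v > 0" if "v > 0" for v unfolding D_def using that by (intro add_pos_pos mult_pos_pos zero_less_power) auto
  \<comment> \<open>The convergent satisfies the differential equation of the incomplete Gamma
    function up to the constant \<open>K\<close>: the derivative of \<open>F\<close> is minus the
    integrand times 1 - K / D^2. As this factor is at most 1, \<open>F 1\<close> is a lower
    bound.\<close>
  have id: "(v + 3/4) * (N v * D v) - v * (N' v * D v - N v * D' v) = (D v)\<^sup>2 - K" for v
    unfolding N_def D_def N'_def D'_def K_def by algebra
  define F where "F = (\<lambda>x. x powr (-3/4) * exp (- pi * x) * (N (pi * x) / D (pi * x)))"
  define g where "g = (\<lambda>x. x powr (-7/4) * exp (- pi * x) * (1 - K / (D (pi * x))\<^sup>2))"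
  have K: "K \<ge> 0" by (simp add: K_def)
  have KD: "K \<le> (D v)\<^sup>2" if "v > 0" for v
  proof -
    have "0 \<le> (v + 3/4) * (N v * D v) - v * (N' v * D v - N v * D' v)"
    proof -
      have "(v + 3/4) * (N v * D v) - v * (N' v * D v - N v * D' v) = D v * (v * N v + 3/4 * N v - v * N' v) + v * N v * D' v"
        by algebra
      moreover have "v * N v + 3/4 * N v - v * N' v \<ge> 0" 
      proof -
        have "v * N v + 3/4 * N v - v * N' v = 381855 + 338500 * v + 391200 * v^2 + 170880 * v^3 + 24320 * v^4 + 1024 * v^5"
          unfolding N_def N'_def by algebra
        thus ?thesis using that by simp
      qed
      moreover have "N v \<ge> 0" "D' v \<ge> 0" using that by (simp_all add: N_def D'_def)
      ultimately show ?thesis using that Dpos[OF that] by simp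
    qed
    thus ?thesis unfolding id by simp
  qed
  have ga: "g absolutely_integrable_on {1..}"
  proof (rule absolutely_integrable_decay[where C = 1 and p = "-7/4"])
    show "g \<in> borel_measurable borel" unfolding g_def D_def by measurable
    fix x :: real assume x: "x \<ge> 1"
    hence v: "pi * x > 0" by simp
    have "0 \<le> 1 - K / (D (pi * x))\<^sup>2" "1 - K / (D (pi * x))\<^sup>2 \<le> 1"
      using KD[OF v] K Dpos[OF v] by (auto simp: field_simps)
    hence "norm (g x) \<le> x powr (-7/4) * exp (- pi * x) * 1"
      unfolding g_def by (simp add: abs_mult mult_left_le)
    also have "\<dots> \<le> 1 * (x powr (-7/4) * exp (- x))" using exp_pi_le[OF x] by (auto intro!: mult_left_mono)
    finally show "norm (g x) \<le> 1 * (x powr (-7/4) * exp (- x))" .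
  qed
  have "integral {1..} g = F 1"
  proof (rule integral_Ici_derivative)
    show "(F has_real_derivative - g x) (at x)" if x: "x \<ge> 1" for x
    proof -
      define v where "v = pi * x"
      have v: "v > 0" using x by (simp add: v_def)
      have dN: "(N has_real_derivative N' v) (at v)"
        unfolding N_def N'_def by (auto intro!: derivative_eq_intros)
      have dD: "(D has_real_derivative D' v) (at v)"
        unfolding D_def D'_def by (auto intro!: derivative_eq_intros)
      have dv: "((\<lambda>x. pi * x) has_real_derivative pi) (at x)" by (auto intro!: derivative_eq_intros)
      have cN: "((\<lambda>x. N (pi * x)) has_real_derivative N' v * pi) (at x)"
        by (rule DERIV_chain2[OF _ dv]) (use dN in \<open>simp add: v_def\<close>)
      have cD: "((\<lambda>x. D (pi * x)) has_real_derivative D' v * pi) (at x)"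
        by (rule DERIV_chain2[OF _ dv]) (use dD in \<open>simp add: v_def\<close>)
      have q: "((\<lambda>x. N (pi * x) / D (pi * x)) has_real_derivative (N' v * pi * D v - N v * (D' v * pi)) / (D v * D v)) (at x)"
        using DERIV_divide[OF cN cD] Dpos[OF v] by (simp add: v_def)
      have w: "((\<lambda>x. x powr (-3/4) * exp (- pi * x)) has_real_derivative (-3/4 * x powr (-7/4) * exp (- pi * x) + x powr (-3/4) * (exp (- pi * x) * (- pi)))) (at x)"
        using x by (auto intro!: derivative_eq_intros)
      have xp: "x powr (-3/4) = x * x powr (-7/4)" using x powr_add[of x 1 "-7/4"] by simp
      define E0 where "E0 = x powr (-7/4) * exp (- pi * x)"
      have "(F has_real_derivative (-3/4 * x powr (-7/4) * exp (- pi * x) + x powr (-3/4) * (exp (- pi * x) * (- pi))) * (N v / D v)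
          + (N' v * pi * D v - N v * (D' v * pi)) / (D v * D v) * (x powr (-3/4) * exp (- pi * x))) (at x)"
        unfolding F_def using DERIV_mult[OF w q] by (simp add: v_def)
      moreover have "(-3/4 * x powr (-7/4) * exp (- pi * x) + x powr (-3/4) * (exp (- pi * x) * (- pi))) * (N v / D v)
          + (N' v * pi * D v - N v * (D' v * pi)) / (D v * D v) * (x powr (-3/4) * exp (- pi * x)) = - g x"
      proof -
        have "(-3/4 * x powr (-7/4) * exp (- pi * x) + x powr (-3/4) * (exp (- pi * x) * (- pi))) * (N v / D v)
          + (N' v * pi * D v - N v * (D' v * pi)) / (D v * D v) * (x powr (-3/4) * exp (- pi * x))
          = - E0 * (((v + 3/4) * (N v * D v) - v * (N' v * D v - N v * D' v)) / (D v)\<^sup>2)"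
          unfolding xp E0_def using Dpos[OF v] by (simp add: v_def field_simps power2_eq_square)
        also have "\<dots> = - g x"
          unfolding id using Dpos[OF v] by (simp add: g_def E0_def v_def diff_divide_distrib)
        finally show ?thesis .
      qed
      ultimately show ?thesis by simp
    qed
    show "(\<lambda>n. F (real n)) \<longlonglongrightarrow> 0"
      unfolding F_def N_def D_def by real_asymp
    show "g absolutely_integrable_on {1..}" by (rule ga)
  qed
  moreover have "integral {1..} g \<le> exp_moment (-7/4)"
    unfolding exp_moment_def
  proof (rule integral_le)
    show "(\<lambda>x. x powr (-7/4) * exp (- pi * x)) integrable_on {1..}" by (rule exp_moment_integrable)
    show "g integrable_on {1..}" by (rule set_lebesgue_integral_eq_integral(1)[OF ga])
    fix x :: real assume "x \<in> {1..}"
    hence "D (pi * x) > 0" by (intro Dpos) auto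
    hence "1 - K / (D (pi * x))\<^sup>2 \<le> 1" using K by simp
    hence "x powr (-7/4) * exp (- pi * x) * (1 - K / (D (pi * x))\<^sup>2) \<le> x powr (-7/4) * exp (- pi * x) * 1"
      by (intro mult_left_mono) auto
    thus "g x \<le> x powr (-7/4) * exp (- pi * x)" by (simp add: g_def)
  qed
  ultimately show ?thesis by (simp add: F_def)
qed

section \<open>Rational bounds for powers of pi and for exp (-pi)\<close>

lemma pi_power_bounds:
  "(314159265/100000000) \<le> pi" "pi \<le> (314159266/100000000)"
  "(98696043/10000000) \<le> pi^2" "pi^2 \<le> (98696045/10000000)" "(31006276/1000000) \<le> pi^3" "pi^3 \<le> (31006278/1000000)"
  "(97409090/1000000) \<le> pi^4" "pi^4 \<le> (97409093/1000000)" "(30601968/100000) \<le> pi^5" "pi^5 \<le> (30601971/100000)"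
proof -
  have p: "(31415926535/10000000000) \<le> pi" "pi \<le> (31415926536/10000000000)" using pi_approx by auto
  show "(314159265/100000000) \<le> pi" "pi \<le> (314159266/100000000)" using p by auto
  have l: "((31415926535/10000000000) :: real)^n \<le> pi^n" "pi^n \<le> (31415926536/10000000000)^n" for n
    using p by (auto intro!: power_mono)
  show "(98696043/10000000) \<le> pi^2" "pi^2 \<le> (98696045/10000000)" using l[of 2] by (simp_all add: power2_eq_square)
  show "(31006276/1000000) \<le> pi^3" "pi^3 \<le> (31006278/1000000)" using l[of 3] by (simp_all add: eval_nat_numeral)
  show "(97409090/1000000) \<le> pi^4" "pi^4 \<le> (97409093/1000000)" using l[of 4] by (simp_all add: eval_nat_numeral)
  show "(30601968/100000) \<le> pi^5" "pi^5 \<le> (30601971/100000)" using l[of 5] by (simp_all add: eval_nat_numeral)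
qed

text \<open>Cleared of the denominator this is a linear inequality in the powers of pi. The
  convergent exceeds 217/1000 by less than one part in 100000, hence the precision of the bounds for
  the powers.\<close>

lemma exp_moment_neg_7_4_ge: "(217/1000) * exp (- pi) \<le> exp_moment (-7/4)"
proof -
  have D: "504735 + 1442100 * pi + 1048800 * pi^2 + 279680 * pi^3 + 29440 * pi^4 + 1024 * pi^5 > 0"
    by (intro add_pos_pos mult_pos_pos zero_less_power) auto
  have "(217/1000) * (504735 + 1442100 * pi + 1048800 * pi^2 + 279680 * pi^3 + 29440 * pi^4 + 1024 * pi^5) 
     \<le> 509140 + 682560 * pi + 233088 * pi^2 + 27648 * pi^3 + 1024 * pi^4"
  proof -
    have "(217/1000) * (504735 + 1442100 * p1 + 1048800 * p2 + 279680 * p3 + 29440 * p4 + 1024 * p5)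
       \<le> 509140 + 682560 * p1 + 233088 * p2 + 27648 * p3 + 1024 * p4"
      if "314159265/100000000 \<le> p1" "98696043/10000000 \<le> p2" "p3 \<le> 31006278/1000000" "p4 \<le> 97409093/1000000" "p5 \<le> 30601971/100000"
      for p1 p2 p3 p4 p5 :: real
      using that by (simp add: algebra_simps)
    thus ?thesis using pi_power_bounds by blast
  qed
  hence "(217/1000) \<le> (509140 + 682560 * pi + 233088 * pi^2 + 27648 * pi^3 + 1024 * pi^4) / (504735 + 1442100 * pi + 1048800 * pi^2 + 279680 * pi^3 + 29440 * pi^4 + 1024 * pi^5)"
    using D by (simp add: pos_le_divide_eq)
  hence "exp (- pi) * (217/1000) \<le> exp (- pi) * ((509140 + 682560 * pi + 233088 * pi^2 + 27648 * pi^3 + 1024 * pi^4) / (504735 + 1442100 * pi + 1048800 * pi^2 + 279680 * pi^3 + 29440 * pi^4 + 1024 * pi^5))"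
    by (intro mult_left_mono) auto
  hence "exp (- pi) * (217/1000) \<le> exp_moment (-7/4)" using exp_moment_convergent by (rule order.trans)
  thus ?thesis by (simp only: mult.commute)
qed

lemma exp_small_bounds:
  fixes x :: real assumes "0 \<le> x" "x \<le> 1/2"
  shows "(\<Sum>i\<le>8. x^i / fact i) - 1/10000000 \<le> exp x" "exp x \<le> (\<Sum>i\<le>8. x^i / fact i) + 1/10000000"
proof -
  have "exp x \<le> 2"
  proof -
    have "exp x \<le> exp (1/2)" using assms by simp
    also have "\<dots> \<le> 2"
    proof (rule power2_le_imp_le)
      have "exp (1/2 :: real)^2 = exp 1" by (simp flip: exp_double)
      also have "\<dots> \<le> 3" using exp_le by simp
      finally show "exp (1/2 :: real)^2 \<le> 2^2" by simp
    qed auto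
    finally show ?thesis .
  qed
  moreover have "x^9 \<le> (1/2)^9" using assms by (intro power_mono) auto
  ultimately have "exp x * x^9 / fact 8 \<le> 2 * (1/2)^9 / fact 8"
    using assms by (intro divide_right_mono mult_mono) auto
  also have "\<dots> \<le> 1/10000000" by (simp add: fact_numeral eval_nat_numeral)
  finally have le: "exp x * x^9 / fact 8 \<le> 1/10000000" .
  have "\<bar>exp x - (\<Sum>i\<le>8. x^i / fact i)\<bar> \<le> exp x * x^9 / fact 8"
    using Taylor_exp_field[of x 8] assms by simp
  hence "\<bar>exp x - (\<Sum>i\<le>8. x^i / fact i)\<bar> \<le> 1/10000000" using le by (rule order.trans)
  thus "(\<Sum>i\<le>8. x^i / fact i) - 1/10000000 \<le> exp x" "exp x \<le> (\<Sum>i\<le>8. x^i / fact i) + 1/10000000" by linarith+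
qed

text \<open>pi / 8 is below 1/2, within the range of the Taylor bound, and exp pi is the eighth
  power of exp (pi / 8).\<close>

lemma exp_pi_bounds: "(231403/10000) \<le> exp pi" "exp pi \<le> (231411/10000)"
proof -
  have e8: "exp (y::real) = exp (y / 8) ^ 8" for y by (simp flip: exp_of_nat_mult)
  have "((14809715/10000000) :: real) \<le> exp ((314159265/100000000) / 8)"
    by (rule order.trans[OF _ exp_small_bounds(1)]) (simp_all add: eval_nat_numeral fact_numeral)
  hence "((14809715/10000000) :: real)^8 \<le> exp ((314159265/100000000) / 8)^8" by (intro power_mono) auto
  also have "\<dots> = exp ((314159265/100000000) :: real)" by (rule e8[symmetric])
  also have "\<dots> \<le> exp pi" using pi_power_bounds by simp
  finally show "(231403/10000) \<le> exp pi" by (simp add: eval_nat_numeral)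
  have "exp ((314159266/100000000) / 8) \<le> ((14809739/10000000) :: real)"
    by (rule order.trans[OF exp_small_bounds(2)]) (simp_all add: eval_nat_numeral fact_numeral)
  hence "exp ((314159266/100000000) / 8)^8 \<le> ((14809739/10000000) :: real)^8" by (intro power_mono) auto
  hence "exp ((314159266/100000000) :: real) \<le> (14809739/10000000)^8" by (subst e8)
  moreover have "exp pi \<le> exp (314159266/100000000)" using pi_power_bounds by simp
  ultimately have "exp pi \<le> (14809739/10000000)^8" by linarith
  thus "exp pi \<le> (231411/10000)" by (simp add: eval_nat_numeral)
qed

lemma exp_minus_pi_bounds: "(43213/1000000) \<le> exp (- pi)" "exp (- pi) \<le> (43215/1000000)"
  using exp_pi_bounds by (auto simp: exp_minus field_simps)

text \<open>On Re z = 1/4 the factor x^(z - 1) has modulus x^(-3/4); expanding cos and sin of c ln x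
  into Taylor polynomials leaves these moments.\<close>

definition omega_moment :: "nat \<Rightarrow> real" where
  "omega_moment k = integral {1..} (\<lambda>x. omega x * ln x ^ k * x powr (-3/4))"

lemma omega_moment_has_integral:
  "((\<lambda>x. omega x * ln x ^ k * x powr (-3/4)) has_integral omega_moment k) {1..}"
  unfolding omega_moment_def
  by (intro integrable_integral set_lebesgue_integral_eq_integral(1)[OF omega_moment_abs_integrable])

lemma exp_moment_has_integral: "((\<lambda>x. x powr p * exp (- pi * x)) has_integral exp_moment p) {1..}"
  unfolding exp_moment_def by (intro integrable_integral exp_moment_integrable)

lemma omega_le_numeric:
  assumes "x \<ge> 1" shows "omega x \<le> 10001/10000 * exp (- pi * x)"
proof -
  have "exp (- 3 * pi) = exp (- pi) ^ 3" by (simp flip: exp_of_nat_mult)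
  also have "\<dots> \<le> (43215/1000000)^3" using exp_minus_pi_bounds by (intro power_mono) auto
  finally have q: "1 - exp (- 3 * pi) \<ge> 10000/10001" by (simp add: eval_nat_numeral)
  have "omega x \<le> exp (- pi * x) / (1 - exp (- 3 * pi))" by (rule omega_le[OF assms])
  also have "\<dots> \<le> exp (- pi * x) / (10000/10001)" by (rule divide_left_mono[OF q]) (use q in auto)
  finally show ?thesis by simp
qed

lemma sinh_ge_self: "w \<ge> 0 \<Longrightarrow> w \<le> sinh (w::real)"
proof -
  assume w: "w \<ge> 0"
  have "sinh 0 - 0 \<le> sinh w - w"
  proof (rule DERIV_nonneg_imp_nondecreasing[OF w])
    fix u :: real assume "0 \<le> u"
    have "((\<lambda>u. sinh u - u) has_real_derivative cosh u - 1) (at u)" by (auto intro!: derivative_eq_intros)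
    thus "\<exists>y. ((\<lambda>u. sinh u - u) has_real_derivative y) (at u) \<and> 0 \<le> y" using cosh_real_ge_1[of u] by auto
  qed
  thus ?thesis by simp
qed

text \<open>The first two terms of the alternating series of arsinh squared. The difference of the
  two sides and its derivative vanish at 0, and its second derivative is 16/3 sinh^4.\<close>

lemma sinh_power_le_square:
  fixes w :: real assumes w: "w \<ge> 0"
  shows "(sinh w)\<^sup>2 - (sinh w)^4 / 3 \<le> w\<^sup>2"
proof -
  define f' where "f' = (\<lambda>u::real. 2 * u - 2 * sinh u * cosh u + 4/3 * (sinh u)^3 * cosh u)"
  have f'0: "0 \<le> f' v" if v: "v \<ge> 0" for v
  proof -
    have "f' 0 \<le> f' v"
    proof (rule DERIV_nonneg_imp_nondecreasing[OF v])
      fix u :: real assume "0 \<le> u"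
      have "(f' has_real_derivative (2 - 2 * (cosh u * cosh u + sinh u * sinh u) + 4/3 * (3 * (sinh u)^2 * cosh u * cosh u + (sinh u)^3 * sinh u))) (at u)"
        unfolding f'_def by (auto intro!: derivative_eq_intros simp: algebra_simps power2_eq_square)
      moreover have e: "2 - 2 * (cosh u * cosh u + sinh u * sinh u) + 4/3 * (3 * (sinh u)^2 * cosh u * cosh u + (sinh u)^3 * sinh u) = 16/3 * (sinh u)^4"
      proof -
        have "cosh u * cosh u = 1 + sinh u * sinh u" using cosh_square_eq[of u] by (simp add: power2_eq_square)
        thus ?thesis by algebra
      qed
      ultimately have "(f' has_real_derivative 16/3 * (sinh u)^4) (at u)" by (simp only: e)
      thus "\<exists>y. (f' has_real_derivative y) (at u) \<and> 0 \<le> y" by (intro exI conjI) (assumption, use zero_le_even_power[of 4 "sinh u"] in simp)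
    qed
    thus ?thesis by (simp add: f'_def)
  qed
  define f where "f = (\<lambda>u::real. u\<^sup>2 - (sinh u)\<^sup>2 + (sinh u)^4 / 3)"
  have "f 0 \<le> f w"
  proof (rule DERIV_nonneg_imp_nondecreasing[OF w])
    fix u :: real assume u: "0 \<le> u"
    have "(f has_real_derivative f' u) (at u)"
      unfolding f_def f'_def by (auto intro!: derivative_eq_intros simp: algebra_simps power2_eq_square eval_nat_numeral)
    thus "\<exists>y. (f has_real_derivative y) (at u) \<and> 0 \<le> y" using f'0[OF u] by auto
  qed
  thus ?thesis by (simp add: f_def)
qed

text \<open>With w = ln x / 2 one has s = 4 sinh^2 w. Bounds for (ln x)^2 that are rational in x
  turn the logarithmic moments into combinations of \<open>exp_moment\<close>.\<close>

lemma ln_square_bounds: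
  fixes x :: real assumes x: "x \<ge> 1"
  defines "s \<equiv> (x - 1)\<^sup>2 / x"
  shows "(ln x)\<^sup>2 \<le> s" "s - s\<^sup>2 / 12 \<le> (ln x)\<^sup>2"
proof -
  define w where "w = ln x / 2"
  have w: "w \<ge> 0" using x by (simp add: w_def)
  have ew: "exp w * exp w = x" using x by (simp add: w_def flip: exp_add)
  have "4 * (sinh w)\<^sup>2 = s"
  proof -
    have "exp w > 0" by simp
    hence "2 * sinh w = (x - 1) / exp w" using ew by (simp add: sinh_def exp_minus field_simps)
    hence "(2 * sinh w)\<^sup>2 = (x - 1)\<^sup>2 / (exp w * exp w)" by (simp add: power_divide power2_eq_square)
    thus ?thesis unfolding ew s_def by (simp add: power_mult_distrib)
  qed
  hence s: "s = 4 * (sinh w)\<^sup>2" by simp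
  have l: "(ln x)\<^sup>2 = 4 * w\<^sup>2" by (simp add: w_def power_divide)
  have "w\<^sup>2 \<le> (sinh w)\<^sup>2" using sinh_ge_self[OF w] w by (intro power_mono)
  thus "(ln x)\<^sup>2 \<le> s" unfolding l s by simp
  have "s - s\<^sup>2 / 12 = 4 * ((sinh w)\<^sup>2 - (sinh w)^4 / 3)"
    unfolding s by (simp add: power_mult_distrib power2_eq_square eval_nat_numeral)
  thus "s - s\<^sup>2 / 12 \<le> (ln x)\<^sup>2" unfolding l using sinh_power_le_square[OF w] by simp
qed

text \<open>\<open>nu2\<close> and \<open>nu4\<close> are the integrals of s and s^2, where s = (x -
  1)^2 / x, against x^(-3/4) exp (-pi x), with the powers of x - 1 expanded.\<close>

definition nu2 :: real where "nu2 = exp_moment (1/4) - 2 * exp_moment (-3/4) + exp_moment (-7/4)"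
definition nu4 :: real where "nu4 = exp_moment (5/4) - 4 * exp_moment (1/4) + 6 * exp_moment (-3/4) - 4 * exp_moment (-7/4) + exp_moment (-11/4)"

lemma nu2_has_integral:
  "((\<lambda>x. x powr (-3/4) * exp (- pi * x) * ((x - 1)\<^sup>2 / x)) has_integral nu2) {1..}"
proof -
  have "((\<lambda>x. x powr (1/4) * exp (- pi * x) - 2 * (x powr (-3/4) * exp (- pi * x)) + x powr (-7/4) * exp (- pi * x)) has_integral nu2) {1..}"
    unfolding nu2_def by (intro has_integral_diff has_integral_add has_integral_mult_right exp_moment_has_integral)
  thus ?thesis
  proof (rule has_integral_eq[rotated])
    fix x :: real assume "x \<in> {1..}"
    hence x: "x > 0" by simp
    have "x powr (1/4) = x powr (-7/4) * x^2" "x powr (-3/4) = x powr (-7/4) * x"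
      using x powr_add[of x "-7/4" 2] powr_add[of x "-7/4" 1] by (simp_all add: powr_numeral)
    thus "x powr (1/4) * exp (- pi * x) - 2 * (x powr (-3/4) * exp (- pi * x)) + x powr (-7/4) * exp (- pi * x) = x powr (-3/4) * exp (- pi * x) * ((x - 1)\<^sup>2 / x)"
      using x by (simp add: power2_eq_square field_simps)
  qed
qed

lemma nu4_has_integral:
  "((\<lambda>x. x powr (-3/4) * exp (- pi * x) * ((x - 1)\<^sup>2 / x)\<^sup>2) has_integral nu4) {1..}"
proof -
  have "((\<lambda>x. x powr (5/4) * exp (- pi * x) - 4 * (x powr (1/4) * exp (- pi * x)) + 6 * (x powr (-3/4) * exp (- pi * x)) - 4 * (x powr (-7/4) * exp (- pi * x)) + x powr (-11/4) * exp (- pi * x)) has_integral nu4) {1..}"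
    unfolding nu4_def by (intro has_integral_diff has_integral_add has_integral_mult_right exp_moment_has_integral)
  thus ?thesis
  proof (rule has_integral_eq[rotated])
    fix x :: real assume "x \<in> {1..}"
    hence x: "x > 0" by simp
    define y where "y = x powr (-11/4)"
    have p: "x powr (5/4) = y * x^4" "x powr (1/4) = y * x^3" "x powr (-3/4) = y * x^2" "x powr (-7/4) = y * x"
      using x powr_add[of x "-11/4" 4] powr_add[of x "-11/4" 3] powr_add[of x "-11/4" 2] powr_add[of x "-11/4" 1] by (simp_all add: powr_numeral y_def)
    show "x powr (5/4) * exp (- pi * x) - 4 * (x powr (1/4) * exp (- pi * x)) + 6 * (x powr (-3/4) * exp (- pi * x)) - 4 * (x powr (-7/4) * exp (- pi * x)) + x powr (-11/4) * exp (- pi * x) = x powr (-3/4) * exp (- pi * x) * ((x - 1)\<^sup>2 / x)\<^sup>2"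
    proof -
      have "((x - 1)\<^sup>2 / x)\<^sup>2 * x^2 = (x - 1)^4" using x by (simp add: power_divide flip: power_mult)
      hence "x powr (-3/4) * exp (- pi * x) * ((x - 1)\<^sup>2 / x)\<^sup>2 = y * exp (- pi * x) * (x - 1)^4"
        unfolding p by (metis mult.assoc mult.commute)
      also have "\<dots> = y * x^4 * exp (- pi * x) - 4 * (y * x^3 * exp (- pi * x)) + 6 * (y * x^2 * exp (- pi * x)) - 4 * (y * x * exp (- pi * x)) + y * exp (- pi * x)"
        by algebra
      finally show ?thesis unfolding p y_def[symmetric] by simp
    qed
  qed
qed

lemma omega_moment_0_le: "omega_moment 0 \<le> 10001/10000 * exp_moment (-3/4)"
proof (rule has_integral_le[OF omega_moment_has_integral has_integral_mult_right[OF exp_moment_has_integral]])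
  fix x :: real assume "x \<in> {1..}"
  hence "x powr (-3/4) * omega x \<le> x powr (-3/4) * (10001/10000 * exp (- pi * x))"
    by (intro mult_left_mono omega_le_numeric) auto
  thus "omega x * ln x ^ 0 * x powr (-3/4) \<le> 10001/10000 * (x powr (-3/4) * exp (- pi * x))" by (simp add: mult_ac)
qed

lemma omega_moment_4_le: "omega_moment 4 \<le> 10001/10000 * nu4"
proof (rule has_integral_le[OF omega_moment_has_integral has_integral_mult_right[OF nu4_has_integral]])
  fix x :: real assume "x \<in> {1..}"
  hence x: "x \<ge> 1" by simp
  have "(ln x)^4 = ((ln x)\<^sup>2)\<^sup>2" by (simp flip: power_mult)
  also have "\<dots> \<le> ((x - 1)\<^sup>2 / x)\<^sup>2" using ln_square_bounds(1)[OF x] by (intro power_mono) auto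
  finally have l: "(ln x)^4 \<le> ((x - 1)\<^sup>2 / x)\<^sup>2" .
  have "omega x * (ln x ^ 4 * x powr (-3/4)) \<le> (10001/10000 * exp (- pi * x)) * (((x - 1)\<^sup>2 / x)\<^sup>2 * x powr (-3/4))"
    using x l omega_le_numeric[OF x] by (intro mult_mono) auto
  thus "omega x * ln x ^ 4 * x powr (-3/4) \<le> 10001/10000 * (x powr (-3/4) * exp (- pi * x) * ((x - 1)\<^sup>2 / x)\<^sup>2)" by (simp add: mult_ac)
qed

text \<open>For a lower bound the first term of the theta series suffices, together with the lower
  estimate s - s^2 / 12 of the squared logarithm.\<close>

lemma omega_moment_2_ge: "nu2 - nu4 / 12 \<le> omega_moment 2"
proof (rule has_integral_le[OF has_integral_diff[OF nu2_has_integral has_integral_divide[OF nu4_has_integral]] omega_moment_has_integral])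
  fix x :: real assume "x \<in> {1..}"
  hence x: "x \<ge> 1" by simp
  define s where "s = (x - 1)\<^sup>2 / x"
  have "x powr (-3/4) * exp (- pi * x) * s - x powr (-3/4) * exp (- pi * x) * s\<^sup>2 / 12 = (x powr (-3/4) * exp (- pi * x)) * (s - s\<^sup>2 / 12)"
    by (simp add: algebra_simps)
  also have "\<dots> \<le> (x powr (-3/4) * exp (- pi * x)) * (ln x)\<^sup>2"
    using ln_square_bounds(2)[OF x] by (intro mult_left_mono) (auto simp: s_def)
  also have "\<dots> \<le> (x powr (-3/4) * omega x) * (ln x)\<^sup>2"
    using omega_ge[of x] x by (intro mult_right_mono mult_left_mono) auto
  finally show "x powr (-3/4) * exp (- pi * x) * ((x - 1)\<^sup>2 / x) - x powr (-3/4) * exp (- pi * x) * ((x - 1)\<^sup>2 / x)\<^sup>2 / 12 \<le> omega x * ln x ^ 2 * x powr (-3/4)"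
    by (simp add: s_def mult_ac)
qed

lemma inverse_pi_bounds:
  "31830988/100000000 \<le> 1 / pi" "1 / pi \<le> 31830990/100000000"
  "10132117/100000000 \<le> (1 / pi)^2" "(1 / pi)^2 \<le> 10132120/100000000"
  "3225152/100000000 \<le> (1 / pi)^3" "(1 / pi)^3 \<le> 3225155/100000000"
proof -
  have p: "31830988/100000000 \<le> 1 / pi" "1 / pi \<le> 31830990/100000000"
    using pi_power_bounds(1,2) by (simp_all add: pos_le_divide_eq pos_divide_le_eq)
  show "31830988/100000000 \<le> 1 / pi" "1 / pi \<le> 31830990/100000000" by (rule p)+
  have l: "(31830988/100000000 :: real)^n \<le> (1 / pi)^n" "(1 / pi)^n \<le> (31830990/100000000)^n" for n
    using p by (auto intro!: power_mono simp del: power_one_over)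
  show "10132117/100000000 \<le> (1 / pi)^2" by (rule order.trans[OF _ l(1)]) (simp add: power2_eq_square)
  show "(1 / pi)^2 \<le> 10132120/100000000" by (rule order.trans[OF l(2)]) (simp add: power2_eq_square)
  show "3225152/100000000 \<le> (1 / pi)^3" by (rule order.trans[OF _ l(1)]) (simp add: eval_nat_numeral)
  show "(1 / pi)^3 \<le> 3225155/100000000" by (rule order.trans[OF l(2)]) (simp add: eval_nat_numeral)
qed

text \<open>The unknown excess \<open>b\<close> >= 0 of the moment at -7/4 over its lower bound
  enters the upper bounds with a negative and the lower bound for \<open>nu2\<close> with a positive
  coefficient. So the one-sided estimate of that moment suffices for all three inequalities.\<close>

lemma moment_numerics:
  "omega_moment 0 \<le> 11519/1000000" "986/1000000 \<le> omega_moment 2" "omega_moment 4 \<le> 356/1000000"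
proof -
  define k where "k = 1 / pi"
  define e where "e = exp (- pi)"
  define b where "b = exp_moment (-7/4) - 217/1000 * e"
  have b: "b \<ge> 0" using exp_moment_neg_7_4_ge by (simp add: b_def e_def)
  have kp: "k * pi = 1" by (simp add: k_def)
  have rec: "exp_moment p = k * (e + p * exp_moment (p - 1))" for p
    using exp_moment_rec[of p] by (simp add: k_def e_def field_simps)
  have B: "exp_moment (-7/4) = 217/1000 * e + b" by (simp add: b_def)
  \<comment> \<open>The constant 83725/100000 is 1 - 3/4 * 217/1000.\<close>
  have A: "exp_moment (-3/4) = 83725/100000 * (k * e) - 3/4 * (k * b)"
  proof -
    have r: "exp_moment (-3/4) = k * (e + (-3/4) * exp_moment (-7/4))" using rec[of "-3/4"] by simp
    show ?thesis unfolding r B by algebra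
  qed
  have E14: "exp_moment (1/4) = k * e + 1/4 * (k * exp_moment (-3/4))"
    using rec[of "1/4"] by (simp add: algebra_simps)
  have E54: "exp_moment (5/4) = k * e + 5/4 * (k * exp_moment (1/4))"
    using rec[of "5/4"] by (simp add: algebra_simps)
  have E114: "exp_moment (-11/4) = 4/7 * (e - pi * exp_moment (-7/4))"
    using exp_moment_rec[of "-7/4"] by (simp add: e_def algebra_simps)
  have e: "43213/1000000 \<le> e" "e \<le> 43215/1000000" using exp_minus_pi_bounds by (auto simp: e_def)
  have kb: "31830988/100000000 \<le> k" "k \<le> 31830990/100000000"
    "10132117/100000000 \<le> k^2" "k^2 \<le> 10132120/100000000"
    "3225152/100000000 \<le> k^3" "k^3 \<le> 3225155/100000000"
    unfolding k_def using inverse_pi_bounds by blast+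
  define c4 where "c4 = 2 * k * (837250/1000000) * 3 - 3 * k + (5/4 - 837250/1000000) * k^2 + 5/16 * (83725/100000) * k^3 - 868/1000 + 4/7 - 4/7 * (217/1000) * pi"
  define c2 where "c2 = k - 2 * (83725/100000) * k + 1/4 * (83725/100000) * k^2 + 217/1000"
  have nu4: "nu4 = c4 * e - (15/64 * k^3 - 3/4 * k^2 + 9/2 * k + 4 + 4/7 * pi) * b"
    unfolding nu4_def E114 E54 E14 A B c4_def by algebra
  have nu2: "nu2 = c2 * e + (3/2 * k - 3/16 * k^2 + 1) * b"
    unfolding nu2_def E14 A B c2_def by algebra
  have "c4 \<le> 823/100000" unfolding c4_def using kb pi_power_bounds(1) by (simp add: algebra_simps)
  have "c2 \<ge> 23505/1000000" unfolding c2_def using kb by (simp add: algebra_simps)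
  have d4: "(15/64 * k^3 - 3/4 * k^2 + 9/2 * k + 4 + 4/7 * pi) * b \<ge> 0"
    by (rule mult_nonneg_nonneg[OF _ b]) (use kb pi_gt3 in \<open>simp add: algebra_simps\<close>)
  have d2: "(3/2 * k - 3/16 * k^2 + 1) * b \<ge> 0"
    by (rule mult_nonneg_nonneg[OF _ b]) (use kb in \<open>simp add: algebra_simps\<close>)
  have e0: "e \<ge> 0" using e by simp
  have n4: "nu4 \<le> 823/100000 * e"
    using nu4 d4 mult_right_mono[OF \<open>c4 \<le> 823/100000\<close> e0] by linarith
  have n2: "nu2 \<ge> 23505/1000000 * e"
    using nu2 d2 mult_right_mono[OF \<open>c2 \<ge> 23505/1000000\<close> e0] by linarith
  have "k * b \<ge> 0" using b by (simp add: k_def)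
  moreover have "k * e \<le> 31830990/100000000 * (43215/1000000)" using kb e by (intro mult_mono) auto
  ultimately have "exp_moment (-3/4) \<le> 83725/100000 * (31830990/100000000 * (43215/1000000))" using A by linarith
  thus "omega_moment 0 \<le> 11519/1000000" using omega_moment_0_le by simp
  show "omega_moment 4 \<le> 356/1000000" using omega_moment_4_le n4 e by simp
  show "986/1000000 \<le> omega_moment 2" using omega_moment_2_ge n2 n4 e by simp
qed

lemma trig_bounds:
  fixes u :: real assumes u: "u \<ge> 0"
  shows "cos u \<le> 1 - u^2/2 + u^4/24" "u - u^3/6 \<le> sin u"
proof -
  have mono: "f 0 \<le> f v" if "v \<ge> 0" "\<And>x. x \<ge> 0 \<Longrightarrow> (f has_real_derivative f' x) (at x)" "\<And>x. x \<ge> 0 \<Longrightarrow> f' x \<ge> 0" for f f' :: "real \<Rightarrow> real" and v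
    by (rule DERIV_nonneg_imp_nondecreasing[OF that(1)]) (use that in blast)
  have d1: "((\<lambda>x. cos x - 1 + x^2/2) has_real_derivative x - sin x) (at x)" for x :: real
    by (auto intro!: derivative_eq_intros)
  have 1: "1 - v^2/2 \<le> cos v" if v: "v \<ge> 0" for v :: real
    using mono[OF v d1] sin_x_le_x by simp
  have d2: "((\<lambda>x. sin x - x + x^3/6) has_real_derivative cos x - 1 + x^2/2) (at x)" for x :: real
    by (auto intro!: derivative_eq_intros)
  have 2: "v - v^3/6 \<le> sin v" if v: "v \<ge> 0" for v :: real
    using mono[OF v d2] 1 by force
  have d3: "((\<lambda>x. 1 - x^2/2 + x^4/24 - cos x) has_real_derivative sin x - x + x^3/6) (at x)" for x :: real
    by (auto intro!: derivative_eq_intros)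
  show "u - u^3/6 \<le> sin u" by (rule 2[OF u])
  show "cos u \<le> 1 - u^2/2 + u^4/24" using mono[OF u d3] 2 by force
qed

section \<open>The Mellin transform and the completed zeta function on the critical line\<close>

lemma omega_mellin_line:
  "Re (omega_mellin k (Complex (1/4) c)) = integral {1..} (\<lambda>x. omega x * ln x ^ k * x powr (-3/4) * cos (c * ln x))"
  "Im (omega_mellin k (Complex (1/4) c)) = integral {1..} (\<lambda>x. omega x * ln x ^ k * x powr (-3/4) * sin (c * ln x))"
  "((\<lambda>x. omega x * ln x ^ k * x powr (-3/4) * cos (c * ln x)) has_integral Re (omega_mellin k (Complex (1/4) c))) {1..}"
  "((\<lambda>x. omega x * ln x ^ k * x powr (-3/4) * sin (c * ln x)) has_integral Im (omega_mellin k (Complex (1/4) c))) {1..}"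
proof -
  let ?f = "\<lambda>x. complex_of_real (omega x * ln x ^ k) * exp ((Complex (1/4) c - 1) * of_real (ln x))"
  have e: "exp ((Complex (1/4) c - 1) * of_real (ln x)) = of_real (x powr (-3/4)) * cis (c * ln x)" if "x \<in> {1..}" for x
  proof -
    have "(Complex (1/4) c - 1) * of_real (ln x) = Complex (-3/4 * ln x) (c * ln x)" by (simp add: complex_eq_iff)
    hence "exp ((Complex (1/4) c - 1) * of_real (ln x)) = of_real (exp (-3/4 * ln x)) * cis (c * ln x)"
      by (simp add: exp_eq_polar)
    thus ?thesis using that by (simp add: powr_def)
  qed
  have R: "((\<lambda>x. Re (?f x)) has_integral Re (omega_mellin k (Complex (1/4) c))) {1..}"
    using has_integral_linear[OF omega_mellin_has_integral bounded_linear_Re] by (simp only: o_def)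
  have I: "((\<lambda>x. Im (?f x)) has_integral Im (omega_mellin k (Complex (1/4) c))) {1..}"
    using has_integral_linear[OF omega_mellin_has_integral bounded_linear_Im] by (simp only: o_def)
  show r: "((\<lambda>x. omega x * ln x ^ k * x powr (-3/4) * cos (c * ln x)) has_integral Re (omega_mellin k (Complex (1/4) c))) {1..}"
  proof (rule has_integral_eq[OF _ R])
    show "Re (?f x) = omega x * ln x ^ k * x powr (-3/4) * cos (c * ln x)" if "x \<in> {1..}" for x
      unfolding e[OF that] by (simp flip: of_real_mult mult.assoc)
  qed
  show i: "((\<lambda>x. omega x * ln x ^ k * x powr (-3/4) * sin (c * ln x)) has_integral Im (omega_mellin k (Complex (1/4) c))) {1..}"
  proof (rule has_integral_eq[OF _ I])
    show "Im (?f x) = omega x * ln x ^ k * x powr (-3/4) * sin (c * ln x)" if "x \<in> {1..}" for x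
      unfolding e[OF that] by (simp flip: of_real_mult mult.assoc)
  qed
  show "Re (omega_mellin k (Complex (1/4) c)) = integral {1..} (\<lambda>x. omega x * ln x ^ k * x powr (-3/4) * cos (c * ln x))"
    "Im (omega_mellin k (Complex (1/4) c)) = integral {1..} (\<lambda>x. omega x * ln x ^ k * x powr (-3/4) * sin (c * ln x))"
    using r i by (simp_all add: integral_unique)
qed

lemma omega_mellin_line_bounds:
  "Re (omega_mellin 0 (Complex (1/4) c)) \<le> omega_moment 0"
  "c \<ge> 0 \<Longrightarrow> Re (omega_mellin 0 (Complex (1/4) c)) \<le> omega_moment 0 - c^2/2 * omega_moment 2 + c^4/24 * omega_moment 4"
  "c \<ge> 0 \<Longrightarrow> c * omega_moment 2 - c^3/6 * omega_moment 4 \<le> Im (omega_mellin 1 (Complex (1/4) c))"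
proof -
  have w: "omega x * x powr (-3/4) \<ge> 0" if "x \<in> {1..}" for x
    using that omega_nonneg[of x] by simp
  show "Re (omega_mellin 0 (Complex (1/4) c)) \<le> omega_moment 0"
  proof (rule has_integral_le[OF omega_mellin_line(3) omega_moment_has_integral])
    show "omega x * ln x ^ 0 * x powr (-3/4) * cos (c * ln x) \<le> omega x * ln x ^ 0 * x powr (-3/4)" if "x \<in> {1..}" for x
      using mult_left_mono[OF cos_le_one w[OF that]] by simp
  qed
  assume c: "c \<ge> 0"
  show "Re (omega_mellin 0 (Complex (1/4) c)) \<le> omega_moment 0 - c^2/2 * omega_moment 2 + c^4/24 * omega_moment 4"
  proof (rule has_integral_le[OF omega_mellin_line(3) has_integral_add[OF has_integral_diff[OF omega_moment_has_integral has_integral_mult_right[OF omega_moment_has_integral]] has_integral_mult_right[OF omega_moment_has_integral]]])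
    fix x :: real assume x: "x \<in> {1..}"
    have "cos (c * ln x) \<le> 1 - (c * ln x)^2/2 + (c * ln x)^4/24" by (rule trig_bounds) (use c x in simp)
    from mult_left_mono[OF this w[OF x]]
    show "omega x * ln x ^ 0 * x powr (-3/4) * cos (c * ln x) \<le> omega x * ln x ^ 0 * x powr (-3/4) - c^2/2 * (omega x * ln x ^ 2 * x powr (-3/4)) + c^4/24 * (omega x * ln x ^ 4 * x powr (-3/4))"
      by (simp add: algebra_simps power_mult_distrib)
  qed
  show "c * omega_moment 2 - c^3/6 * omega_moment 4 \<le> Im (omega_mellin 1 (Complex (1/4) c))"
  proof (rule has_integral_le[OF has_integral_diff[OF has_integral_mult_right[OF omega_moment_has_integral] has_integral_mult_right[OF omega_moment_has_integral]] omega_mellin_line(4)])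
    fix x :: real assume x: "x \<in> {1..}"
    have "c * ln x - (c * ln x)^3/6 \<le> sin (c * ln x)" by (rule trig_bounds) (use c x in simp)
    moreover have "omega x * x powr (-3/4) * ln x \<ge> 0" using w[OF x] x by simp
    ultimately have "omega x * x powr (-3/4) * ln x * (c * ln x - (c * ln x)^3/6) \<le> omega x * x powr (-3/4) * ln x * sin (c * ln x)"
      by (rule mult_left_mono)
    thus "c * (omega x * ln x ^ 2 * x powr (-3/4)) - c^3/6 * (omega x * ln x ^ 4 * x powr (-3/4)) \<le> omega x * ln x ^ 1 * x powr (-3/4) * sin (c * ln x)"
      by (simp add: algebra_simps power_mult_distrib eval_nat_numeral)
  qed
qed

text \<open>The completed zeta function pi^(-s/2) Gamma(s/2) zeta(s) at s = 1/2 + i t. The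
  subtracted fraction is the contribution of the poles at 0 and 1, since s (s - 1) = -(1/4 +
  t^2).\<close>

definition Lam :: "real \<Rightarrow> real" where
  "Lam t = 2 * Re (omega_mellin 0 (Complex (1/4) (t/2))) - 1 / (1/4 + t\<^sup>2)"

text \<open>The pole term dominates on this range: 1 / 40.5 is larger than twice the bound 0.011519
  for the zeroth moment.\<close>

lemma Lam_neg:
  assumes "0 \<le> t" "t \<le> 6344/1000" shows "Lam t < 0"
proof -
  have t2: "t\<^sup>2 \<le> (6344/1000)\<^sup>2" using assms by (intro power_mono)
  hence "1/4 + t\<^sup>2 \<le> 405/10" by (simp add: power2_eq_square)
  moreover have "1/4 + t\<^sup>2 > 0" by (intro add_pos_nonneg) auto
  ultimately have "1 / (1/4 + t\<^sup>2) \<ge> 1 / (405/10)" by (intro divide_left_mono) auto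
  moreover have "Re (omega_mellin 0 (Complex (1/4) (t/2))) \<le> 11519/1000000"
    using omega_mellin_line_bounds(1) moment_numerics(1) by (rule order.trans)
  ultimately show ?thesis unfolding Lam_def by simp
qed

definition Lam' :: "real \<Rightarrow> real" where
  "Lam' t = 2 * t / (1/4 + t\<^sup>2)\<^sup>2 - Im (omega_mellin 1 (Complex (1/4) (t/2)))"

lemma omega_mellin_line_derivative:
  "((\<lambda>t. omega_mellin k (Complex (1/4) (t/2))) has_vector_derivative \<i> / 2 * omega_mellin (Suc k) (Complex (1/4) (t/2))) (at t)"
proof -
  have 2: "((\<lambda>z. 1/4 + \<i> * z / 2) has_field_derivative \<i> / 2) (at (of_real t))"
    by (auto intro!: derivative_eq_intros)
  have "((omega_mellin k \<circ> (\<lambda>z. 1/4 + \<i> * z / 2)) has_field_derivative omega_mellin (Suc k) (Complex (1/4) (t/2)) * (\<i> / 2)) (at (of_real t))"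
    by (rule DERIV_chain) (use omega_mellin_has_derivative 2 in \<open>simp_all only: Complex_quarter\<close>)
  hence "((\<lambda>t. (omega_mellin k \<circ> (\<lambda>z. 1/4 + \<i> * z / 2)) (of_real t)) has_vector_derivative omega_mellin (Suc k) (Complex (1/4) (t/2)) * (\<i> / 2)) (at t)"
    by (rule has_vector_derivative_real_field)
  thus ?thesis by (simp only: o_def Complex_quarter mult.commute)
qed

lemma Lam_derivative: "(Lam has_real_derivative Lam' t) (at t)"
proof -
  have p: "1/4 + t\<^sup>2 > 0" by (intro add_pos_nonneg) auto
  have "((\<lambda>t. Re (omega_mellin 0 (Complex (1/4) (t/2)))) has_real_derivative - Im (omega_mellin 1 (Complex (1/4) (t/2))) / 2) (at t)"
    using bounded_linear.has_vector_derivative[OF bounded_linear_Re omega_mellin_line_derivative[of 0 t]]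
    unfolding has_real_derivative_iff_has_vector_derivative by simp
  from DERIV_cmult[OF this, of 2]
  have 1: "((\<lambda>t. 2 * Re (omega_mellin 0 (Complex (1/4) (t/2)))) has_real_derivative - Im (omega_mellin 1 (Complex (1/4) (t/2)))) (at t)" by simp
  have 2: "((\<lambda>t. 1 / (1/4 + t\<^sup>2)) has_real_derivative - (2 * t / (1/4 + t\<^sup>2)\<^sup>2)) (at t)"
    using p by (auto intro!: derivative_eq_intros simp: power2_eq_square)
  show ?thesis unfolding Lam_def[abs_def] Lam'_def using DERIV_diff[OF 1 2] by simp
qed

text \<open>With \<open>J = Im \<psi>(1/4 + i t/2) / 2\<close>, the left-hand side has the sign of \<open>Z'\<close>, since \<open>Z\<close> is \<open>Lam\<close> times a positive function
  with logarithmic derivative \<open>J\<close>.\<close>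
lemma Lam_log_derivative_sign:
  assumes t: "6 \<le> t" "t \<le> 6344/1000" and J: "J \<ge> 812/1000"
  shows "Lam' t + J * Lam t < 0"
proof -
  define c where "c = t / 2"
  define m0 m2 m4 where "m0 = omega_moment 0" and "m2 = omega_moment 2" and "m4 = omega_moment 4"
  have m: "m0 \<le> 11519/1000000" "986/1000000 \<le> m2" "m4 \<le> 356/1000000"
    unfolding m0_def m2_def m4_def by (rule moment_numerics)+
  define Q where "Q = 1/4 + t\<^sup>2"
  have Q: "Q > 0" unfolding Q_def by (intro add_pos_nonneg) auto
  have c: "c \<ge> 0" using t by (simp add: c_def)
  \<comment> \<open>As \<open>Lam\<close> is negative here, the smallest admissible \<open>J\<close>
    is the worst case.\<close>
  have "Lam t \<le> 0" using Lam_neg[of t] t by simp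
  hence "J * Lam t \<le> 812/1000 * Lam t" using J by (intro mult_right_mono_neg)
  moreover have "Re (omega_mellin 0 (Complex (1/4) c)) \<le> m0 - c^2/2 * m2 + c^4/24 * m4"
    unfolding m0_def m2_def m4_def by (rule omega_mellin_line_bounds(2)[OF c])
  hence "Lam t \<le> 2 * (m0 - c^2/2 * m2 + c^4/24 * m4) - 1 / Q"
    unfolding Lam_def Q_def c_def by (intro diff_right_mono mult_left_mono) simp_all
  hence "812/1000 * Lam t \<le> 812/1000 * (2 * (m0 - c^2/2 * m2 + c^4/24 * m4) - 1 / Q)"
    by (intro mult_left_mono) simp_all
  moreover have "c * m2 - c^3/6 * m4 \<le> Im (omega_mellin 1 (Complex (1/4) c))"
    unfolding m2_def m4_def by (rule omega_mellin_line_bounds(3)[OF c])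
  hence "Lam' t \<le> 2 * t / Q\<^sup>2 - (c * m2 - c^3/6 * m4)"
    unfolding Lam'_def Q_def c_def by (intro diff_left_mono)
  moreover have "x + y \<le> a + b" if "y \<le> z" "z \<le> b" "x \<le> a" for x y z a b :: real using that by linarith
  ultimately have "Lam' t + J * Lam t \<le> 2 * t / Q\<^sup>2 - (c * m2 - c^3/6 * m4) + 812/1000 * (2 * (m0 - c^2/2 * m2 + c^4/24 * m4) - 1 / Q)"
    by blast
  also have "\<dots> \<le> 2 * t / Q\<^sup>2 - (c * (986/1000000) - c^3/6 * (356/1000000)) + 812/1000 * (2 * (11519/1000000 - c^2/2 * (986/1000000) + c^4/24 * (356/1000000)) - 1 / Q)"
    using m c by (intro add_mono diff_mono mult_left_mono order.refl) auto
  also have "\<dots> = (2 * t - 812/1000 * Q + Q\<^sup>2 * (812/1000 * (2 * (11519/1000000) - c^2 * (986/1000000) + c^4/12 * (356/1000000)) - c * (986/1000000) + c^3/6 * (356/1000000))) / Q\<^sup>2"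
    using Q by (simp add: field_simps power2_eq_square)
  also have "\<dots> < 0"
  proof (rule divide_neg_pos)
    \<comment> \<open>In u = t - 6 the numerator is a polynomial of degree 8 with negative constant
      term and otherwise positive coefficients, so each power may be replaced by its value at the
      right end 0.344.\<close>
    define u where "u = t - 6"
    have u: "0 \<le> u" "u \<le> 344/1000" using t by (auto simp: u_def)
    have up: "u^n \<le> (344/1000)^n" for n using u by (intro power_mono)
    have tu: "t = 6 + u" by (simp add: u_def)
    have "2 * t - 812/1000 * Q + Q\<^sup>2 * (812/1000 * (2 * (11519/1000000) - c^2 * (986/1000000) + c^4/12 * (356/1000000)) - c * (986/1000000) + c^3/6 * (356/1000000))
      = - 246331059/160000000 + 347545061/200000000 * u + 5826588229/4000000000 * u^2 + 4809343991/12000000000 * u^3 + 17069919091/192000000000 * u^4 + 96903941/6000000000 * u^5 + 39113347/24000000000 * u^6 + 119527/1500000000 * u^7 + 18067/12000000000 * u^8"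
      unfolding Q_def c_def tu by (simp add: eval_nat_numeral field_simps)
    also have "\<dots> < 0" using u(2) up[of 2] up[of 3] up[of 4] up[of 5] up[of 6] up[of 7] up[of 8] 
      by (simp add: eval_nat_numeral)
    finally show "2 * t - 812/1000 * Q + Q\<^sup>2 * (812/1000 * (2 * (11519/1000000) - c^2 * (986/1000000) + c^4/12 * (356/1000000)) - c * (986/1000000) + c^3/6 * (356/1000000)) < 0" .
  qed (use Q in simp)
  finally show ?thesis .
qed

subsection \<open>Hardy's function and the phase of the derivative of zeta\<close>

text \<open>The reciprocal of the modulus of pi^(-s/2) Gamma(s/2) at s = 1/2 + i t.\<close>

definition line_scale :: "real \<Rightarrow> real" where
  "line_scale t = pi powr (1/4) * exp (- log_abs_Gamma t)"

definition Z :: "real \<Rightarrow> real" where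
  "Z t = line_scale t * Lam t"

lemma line_scale_pos: "line_scale t > 0"
  by (simp add: line_scale_def)

lemma xi_line: "xi (Complex (1/2) t) = of_real (- (1/4 + t\<^sup>2) / 2 * Lam t)"
proof -
  let ?s = "Complex (1/2) t"
  have s1: "?s / 2 = Complex (1/4) (t/2)" "(1 - ?s) / 2 = cnj (Complex (1/4) (t/2))" by (simp_all add: complex_eq_iff)
  have s2: "?s * (?s - 1) = of_real (- (1/4 + t\<^sup>2))" by (simp add: complex_eq_iff power2_eq_square)
  have p: "1/4 + t\<^sup>2 > 0" by (intro add_pos_nonneg) auto
  have "xi ?s = (of_real (- (1/4 + t\<^sup>2)) * of_real (2 * Re (omega_mellin 0 (Complex (1/4) (t/2)))) + 1) / 2"
    unfolding xi_def s1 s2 omega_mellin_cnj complex_add_cnj by simp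
  also have "\<dots> = of_real ((- (1/4 + t\<^sup>2) * (2 * Re (omega_mellin 0 (Complex (1/4) (t/2)))) + 1) / 2)" by simp
  also have "(- (1/4 + t\<^sup>2) * (2 * Re (omega_mellin 0 (Complex (1/4) (t/2)))) + 1) / 2 = - (1/4 + t\<^sup>2) / 2 * Lam t"
  proof -
    have "(- q * R + 1) / 2 = - q / 2 * (R - 1 / q)" if "q > 0" for q R :: real using that by (simp add: field_simps)
    thus ?thesis unfolding Lam_def using p by blast
  qed
  finally show ?thesis .
qed

text \<open>The completed zeta function is real on the line, and pi^(s/2) / Gamma(s/2) has phase
  -theta: the term t / 2 * ln pi in the phase of Gamma cancels against that of the power of
  pi.\<close>

theorem zeta_line: "zeta (Complex (1/2) t) = of_real (Z t) * cis (- theta t)"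
proof -
  let ?s = "Complex (1/2) t"
  let ?z = "Complex (1/4) (t/2)"
  have s1: "?s / 2 = ?z" by (simp add: complex_eq_iff)
  have s2: "?z * (2 * (?s - 1)) = of_real (- (1/4 + t\<^sup>2))" by (simp add: complex_eq_iff power2_eq_square)
  have p: "1/4 + t\<^sup>2 > 0" by (intro add_pos_nonneg) auto
  have sn: "?s \<noteq> 1" "?s - 1 \<noteq> 0" "?z \<noteq> 0" by (auto simp: complex_eq_iff)
  have rG: "rGamma (?z + 1) = rGamma ?z / ?z" using rGamma_plus1[of ?z] sn(3) by (simp add: field_simps)
  have rG2: "rGamma ?z = of_real (exp (- log_abs_Gamma t)) * cis (- (theta t + t / 2 * ln pi))"
    unfolding rGamma_inverse_Gamma Gamma_line by (simp add: exp_minus)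
  have pw: "of_real pi powr ?z = of_real (pi powr (1/4)) * cis (t / 2 * ln pi)"
  proof -
    have "?z * of_real (ln pi) = Complex (1/4 * ln pi) (t / 2 * ln pi)" by (simp add: complex_eq_iff)
    thus ?thesis by (simp add: powr_def exp_eq_polar Ln_of_real)
  qed
  have "zeta ?s = xi ?s * of_real pi powr ?z * (rGamma ?z / ?z) / (?s - 1)"
    unfolding zeta_eq zeta_formula_def s1 rG using sn by simp
  also have "\<dots> = 2 * xi ?s / (?z * (2 * (?s - 1))) * (of_real pi powr ?z * rGamma ?z)" using sn by (simp add: field_simps)
  also have "2 * xi ?s / (?z * (2 * (?s - 1))) = of_real (Lam t)"
  proof -
    have "2 * (- q / 2 * L) / (- q) = L" if "q > 0" for q L :: real using that by simp
    hence "2 * (- (1/4 + t\<^sup>2) / 2 * Lam t) / (- (1/4 + t\<^sup>2)) = Lam t" using p by blast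
    thus ?thesis unfolding s2 xi_line by (metis of_real_divide of_real_mult of_real_numeral)
  qed
  also have "of_real pi powr ?z * rGamma ?z = of_real (line_scale t) * (cis (t / 2 * ln pi) * cis (- (theta t + t / 2 * ln pi)))"
    unfolding pw rG2 line_scale_def by simp
  also have "cis (t / 2 * ln pi) * cis (- (theta t + t / 2 * ln pi)) = cis (- theta t)" by (simp add: cis_mult)
  finally show ?thesis by (simp add: Z_def mult_ac)
qed

lemma zeta_line_zero_iff: "zeta (Complex (1/2) t) = 0 \<longleftrightarrow> Z t = 0"
  unfolding zeta_line by simp

lemma real_analytic_Lam: "real_analytic Lam"
proof -
  have h: "(\<lambda>z. 2 * omega_mellin 0 (1/4 + \<i> * z / 2)) holomorphic_on UNIV" by (intro holomorphic_intros) auto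
  have "real_analytic (\<lambda>t. Re (2 * omega_mellin 0 (1/4 + \<i> * of_real t / 2)))"
    by (rule real_analytic_Re[OF h]) auto
  moreover have "real_analytic (\<lambda>t. 1 / (1/4 + t\<^sup>2))"
  proof (rule real_analytic_of_holomorphic[where F = "\<lambda>z. 1 / (1/4 + z\<^sup>2)" and A = "- {z. 1/4 + z\<^sup>2 = 0}"])
    show "(\<lambda>z. 1 / (1/4 + z\<^sup>2)) holomorphic_on - {z. 1/4 + z\<^sup>2 = (0::complex)}" by (intro holomorphic_intros) auto
    show "open (- {z. 1/4 + z\<^sup>2 = (0::complex)})" by (intro open_Compl closed_Collect_eq continuous_intros)
    show "complex_of_real x \<in> - {z. 1/4 + z\<^sup>2 = 0}" for x
    proof -
      have "1/4 + x\<^sup>2 > 0" by (intro add_pos_nonneg) auto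
      hence "complex_of_real (1/4 + x\<^sup>2) \<noteq> 0" unfolding of_real_eq_0_iff by simp
      thus ?thesis by simp
    qed
  qed simp
  ultimately have "real_analytic (\<lambda>t. Re (2 * omega_mellin 0 (1/4 + \<i> * of_real t / 2)) - 1 / (1/4 + t\<^sup>2))"
    by (rule real_analytic_diff)
  thus ?thesis by (rule real_analytic_cong) (simp add: Lam_def Complex_quarter)
qed

lemma real_analytic_Z: "real_analytic Z"
proof -
  have "real_analytic (\<lambda>t. exp (0 - log_abs_Gamma t))"
    by (rule real_analytic_comp[of exp, OF _ _ real_analytic_diff[OF real_analytic_const real_analytic_log_abs_Gamma]])
      (auto simp: exp_of_real intro: holomorphic_intros)
  hence "real_analytic (\<lambda>t. pi powr (1/4) * exp (0 - log_abs_Gamma t) * Lam t)"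
    by (intro real_analytic_mult real_analytic_const real_analytic_Lam)
  thus ?thesis by (rule real_analytic_cong) (simp add: Z_def line_scale_def)
qed

lemma Z_deriv: "deriv Z t = line_scale t * (Lam' t + psi_im (t/2) / 2 * Lam t)"
proof -
  have "(line_scale has_real_derivative line_scale t * (psi_im (t/2) / 2)) (at t)"
    unfolding line_scale_def by (auto intro!: derivative_eq_intros log_abs_Gamma_derivative)
  from DERIV_mult[OF this Lam_derivative] show ?thesis
    unfolding Z_def[abs_def] by (intro DERIV_imp_deriv) (simp add: algebra_simps)
qed

lemma Z_neg: "0 \<le> t \<Longrightarrow> t \<le> 6344/1000 \<Longrightarrow> Z t < 0"
  using Lam_neg[of t] line_scale_pos[of t] by (simp add: Z_def mult_pos_neg)

lemma Z_deriv_a_theta: "deriv Z a_theta < 0"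
proof -
  have "psi_im (a_theta / 2) \<ge> 1624/1000" using a_theta_props by (intro psi_im_lower_bound) auto
  hence "Lam' a_theta + psi_im (a_theta/2) / 2 * Lam a_theta < 0"
    using a_theta_props by (intro Lam_log_derivative_sign) auto
  thus ?thesis using line_scale_pos unfolding Z_deriv by (intro mult_pos_neg)
qed

text \<open>This makes (P, Q) start on the real axis, as the normalisation h(0) = 0 requires; all
  three quantities involved are odd in t.\<close>

lemma Z_deriv_0: "deriv Z 0 = 0"
proof -
  have c: "Complex (1/4) 0 = of_real (1/4)" by (simp add: complex_eq_iff)
  have "Im (omega_mellin 1 (Complex (1/4) 0)) = 0" unfolding c omega_mellin_of_real by simp
  moreover have "psi_im 0 = 0" using LIMSEQ_unique[OF psi_im_LIMSEQ[of 0]] by simp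
  ultimately show ?thesis unfolding Z_deriv by (simp add: Lam'_def)
qed

lemma zeta_holomorphic: "zeta holomorphic_on - {1}"
  unfolding zeta_eq by (rule holomorphic_transform[OF zeta_formula_holomorphic]) auto

definition P_line :: "real \<Rightarrow> real" where "P_line t = deriv theta t * Z t"

lemma zeta_deriv_line: "deriv zeta (Complex (1/2) t) = - (Complex (P_line t) (deriv Z t) * cis (- theta t))"
proof -
  have C: "1/2 + \<i> * complex_of_real t = Complex (1/2) t" for t by (simp add: complex_eq_iff)
  have 1: "(zeta has_field_derivative deriv zeta (Complex (1/2) t)) (at (Complex (1/2) t))"
    by (rule holomorphic_derivI[OF zeta_holomorphic]) (auto simp: complex_eq_iff)
  have 2: "((\<lambda>z. 1/2 + \<i> * z) has_field_derivative \<i>) (at (of_real t))"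
    by (auto intro!: derivative_eq_intros)
  have "((zeta \<circ> (\<lambda>z. 1/2 + \<i> * z)) has_field_derivative deriv zeta (Complex (1/2) t) * \<i>) (at (of_real t))"
    by (rule DERIV_chain) (use 1 2 in \<open>simp_all only: C\<close>)
  hence "((\<lambda>t. (zeta \<circ> (\<lambda>z. 1/2 + \<i> * z)) (of_real t)) has_vector_derivative deriv zeta (Complex (1/2) t) * \<i>) (at t)"
    by (rule has_vector_derivative_real_field)
  hence L: "((\<lambda>t. of_real (Z t) * cis (- theta t)) has_vector_derivative deriv zeta (Complex (1/2) t) * \<i>) (at t)"
    by (simp only: o_def C zeta_line)
  have dZ: "((\<lambda>t. complex_of_real (Z t)) has_vector_derivative of_real (deriv Z t)) (at t)"
    by (rule has_vector_derivative_of_real) (rule real_analytic_has_derivative[OF real_analytic_Z])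
  have dcis: "((\<lambda>t. cis (- theta t)) has_vector_derivative - of_real (deriv theta t) * (\<i> * cis (- theta t))) (at t)"
  proof -
    have th: "((\<lambda>t. - theta t) has_real_derivative - deriv theta t) (at t)"
      using real_analytic_has_derivative[OF real_analytic_theta] by (rule DERIV_minus)
    have "((\<lambda>t. complex_of_real (- theta t)) has_vector_derivative of_real (- deriv theta t)) (at t)"
      by (rule has_vector_derivative_of_real[OF th])
    hence "((\<lambda>t. \<i> * complex_of_real (- theta t)) has_vector_derivative \<i> * of_real (- deriv theta t)) (at t)"
      by (rule has_vector_derivative_mult_right)
    hence "((exp \<circ> (\<lambda>t. \<i> * complex_of_real (- theta t))) has_vector_derivative (\<i> * of_real (- deriv theta t)) * exp (\<i> * complex_of_real (- theta t))) (at t)"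
      by (rule field_vector_diff_chain_at) (rule DERIV_exp)
    thus ?thesis unfolding o_def cis_conv_exp by (simp add: mult_ac)
  qed
  have R: "((\<lambda>t. of_real (Z t) * cis (- theta t)) has_vector_derivative
      of_real (Z t) * (- of_real (deriv theta t) * (\<i> * cis (- theta t))) + of_real (deriv Z t) * cis (- theta t)) (at t)"
    by (rule has_vector_derivative_mult[OF dZ dcis])
  have "deriv zeta (Complex (1/2) t) * \<i> = of_real (Z t) * (- of_real (deriv theta t) * (\<i> * cis (- theta t))) + of_real (deriv Z t) * cis (- theta t)"
    by (rule vector_derivative_unique_at[OF L R])
  moreover have "deriv zeta (Complex (1/2) t) = deriv zeta (Complex (1/2) t) * \<i> * (- \<i>)" by (simp add: mult.assoc)
  ultimately have "deriv zeta (Complex (1/2) t) = (of_real (Z t) * (- of_real (deriv theta t) * (\<i> * cis (- theta t))) + of_real (deriv Z t) * cis (- theta t)) * (- \<i>)"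
    by metis
  also have "\<dots> = - ((of_real (deriv theta t * Z t) + \<i> * of_real (deriv Z t)) * cis (- theta t))"
    by (simp add: algebra_simps)
  finally show ?thesis by (simp add: P_line_def Complex_eq)
qed

lemma real_analytic_P_line: "real_analytic P_line"
  unfolding P_line_def[abs_def] by (intro real_analytic_mult real_analytic_deriv real_analytic_theta real_analytic_Z)

lemma deriv_theta_sign:
  assumes "t \<ge> 0"
  shows "t < a_theta \<Longrightarrow> deriv theta t < 0" "t > a_theta \<Longrightarrow> deriv theta t > 0"
  using deriv_theta_strict_mono[of t a_theta] deriv_theta_strict_mono[of a_theta t] a_theta_props assms by auto

lemma P_line_0: "P_line 0 \<noteq> 0"
  using deriv_theta_sign[of 0] a_theta_props Z_neg[of 0] by (auto simp: P_line_def)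

text \<open>The summand pi absorbs the minus sign in \<open>zeta_deriv_line\<close>. For uniqueness,
  two candidate phases differ by an angle whose sine vanishes wherever \<open>\<rho>\<close> does
  not, hence everywhere by the identity theorem; so the difference is constant.\<close>

lemma ph_zeta'_exists:
  obtains h \<rho> where "real_analytic h" "real_analytic \<rho>" "h 0 = 0"
    "\<And>t. P_line t = \<rho> t * cos (h t)" "\<And>t. deriv Z t = \<rho> t * sin (h t)"
    "ph_zeta' = (\<lambda>t. pi - theta t + h t)"
proof -
  obtain h \<rho> where h: "real_analytic h" "real_analytic \<rho>" "h 0 = 0"
    and PQ: "\<And>t. P_line t = \<rho> t * cos (h t)" "\<And>t. deriv Z t = \<rho> t * sin (h t)"
    using real_analytic_phase_exists[OF real_analytic_P_line real_analytic_deriv[OF real_analytic_Z] P_line_0 Z_deriv_0] by blast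
  define g where "g = (\<lambda>t. pi - theta t + h t)"
  have ga: "real_analytic g" unfolding g_def
    by (intro real_analytic_add real_analytic_diff real_analytic_const real_analytic_theta h)
  have eq: "deriv zeta (Complex (1/2) t) = of_real (\<rho> t) * cis (g t)" for t
  proof -
    have "Complex (P_line t) (deriv Z t) = of_real (\<rho> t) * cis (h t)" by (simp add: PQ complex_eq_iff)
    hence "deriv zeta (Complex (1/2) t) = of_real (\<rho> t) * (- 1 * (cis (h t) * cis (- theta t)))"
      unfolding zeta_deriv_line by simp
    also have "- 1 * (cis (h t) * cis (- theta t)) = cis (g t)"
      by (simp only: cis_pi[symmetric] cis_mult) (simp add: g_def algebra_simps)
    finally show ?thesis .
  qed
  have "ph_zeta' = g"
    unfolding ph_zeta'_def
  proof (rule the_equality, intro conjI)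
    show "real_analytic g" by (rule ga)
    show "g 0 = pi" by (simp add: g_def theta_0 h)
    show "\<exists>\<rho>. real_analytic \<rho> \<and> (\<forall>t. deriv zeta (Complex (1/2) t) = of_real (\<rho> t) * cis (g t))"
      using h eq by blast
  next
    fix k assume k: "real_analytic k \<and> k 0 = pi \<and> (\<exists>\<rho>. real_analytic \<rho> \<and> (\<forall>t. deriv zeta (Complex (1/2) t) = of_real (\<rho> t) * cis (k t)))"
    then obtain \<rho>' where r': "\<And>t. deriv zeta (Complex (1/2) t) = of_real (\<rho>' t) * cis (k t)" by blast
    have z: "\<rho> t * sin (g t - k t) = 0" for t
    proof -
      have "of_real (\<rho> t) * cis (g t) * cis (- k t) = of_real (\<rho>' t) * cis (k t) * cis (- k t)"
        using eq[of t] r'[of t] by simp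
      hence "of_real (\<rho> t) * cis (g t - k t) = complex_of_real (\<rho>' t)"
        by (simp add: mult.assoc cis_mult)
      hence "Im (of_real (\<rho> t) * cis (g t - k t)) = 0" by simp
      thus ?thesis by simp
    qed
    have r0: "\<rho> 0 \<noteq> 0" using P_line_0 PQ(1)[of 0] by auto
    have da: "real_analytic (\<lambda>t. sin (g t - k t))" using k ga by (intro real_analytic_sin real_analytic_diff) auto
    have s: "sin (g t - k t) = 0" for t
    proof (rule real_analytic_identity[OF da, of 0])
      have "\<forall>\<^sub>F y in at 0. \<rho> y \<noteq> 0" by (rule real_analytic_eventually_nonzero[OF h(2) r0])
      hence "\<forall>\<^sub>F y in at 0. sin (g y - k y) = 0" by eventually_elim (use z in auto)
      thus "\<exists>\<^sub>F y in at 0. sin (g y - k y) = 0" by (rule eventually_frequently[rotated]) simp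
    qed
    have "g t - k t = g 0 - k 0" for t
    proof (rule sin_eq_zero_imp_const[where d = "\<lambda>t. g t - k t" and A = UNIV])
      show "continuous_on UNIV (\<lambda>t. g t - k t)" using k ga by (intro real_analytic_continuous_on real_analytic_diff) auto
    qed (use s in auto)
    moreover have "g 0 - k 0 = 0" using k by (simp add: g_def theta_0 h)
    ultimately show "k = g" by (simp add: fun_eq_iff)
  qed
  with that[OF h PQ] show ?thesis unfolding g_def by blast
qed

subsection \<open>The crossings of the phase\<close>

text \<open>The hypothesis makes h exceed h(t0) just to the left of t0 and fall below it just to the
  right. As a ceiling keeps its value just below an integer and rises by one just above it,
  \<open>K\<close> is continuous from the right at t0 and larger by one on the left.\<close>

lemma ceiling_phase_crossing:
  fixes h :: "real \<Rightarrow> real"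
  assumes c: "isCont h t0" and cos0: "cos (h t0) = 0"
    and sgn: "\<forall>\<^sub>F t in at t0. (t - t0) * (sin (h t) * cos (h t)) > 0"
  defines "K \<equiv> \<lambda>t. \<lceil>h t / pi + 1/2\<rceil>"
  shows "\<exists>d>0. \<forall>t. \<bar>t - t0\<bar> < d \<longrightarrow> K t = K t0 + (if t < t0 then 1 else 0)"
proof -
  obtain n :: int where n: "h t0 = of_int n * pi + pi / 2" using cos0 unfolding cos_zero_iff_int2 by blast
  have K0: "h t0 / pi + 1/2 = of_int (n + 1)" unfolding n by (simp add: field_simps)
  have "\<forall>\<^sub>F t in at t0. dist (h t) (h t0) < pi / 2"
    using c unfolding isCont_def by (rule tendstoD) simp
  with sgn have "\<forall>\<^sub>F t in at t0. K t = K t0 + (if t < t0 then 1 else 0)"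
  proof eventually_elim
    case (elim t)
    define g where "g = h t - h t0"
    have g: "\<bar>g\<bar> < pi / 2" using elim(2) by (simp add: g_def dist_real_def)
    have x: "h t / pi + 1/2 = of_int (n + 1) + g / pi" using K0 by (simp add: g_def diff_divide_distrib)
    have gp: "\<bar>g / pi\<bar> < 1/2" using g by (simp add: abs_divide field_simps)
    have "2 * (sin (h t) * cos (h t)) = sin (2 * h t)" by (simp add: sin_double)
    also have "2 * h t = (2 * g + pi) + of_int n * (2 * pi)" by (simp add: g_def n algebra_simps)
    also have "sin \<dots> = sin (2 * g + pi)" using sin.plus_of_int[of "2 * g + pi" n] by (simp add: mult.commute)
    also have "\<dots> = - sin (2 * g)" by simp
    finally have sc: "2 * (sin (h t) * cos (h t)) = - sin (2 * g)" .
    have pos: "(t - t0) * (2 * (sin (h t) * cos (h t))) > 0"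
      using elim(1) by (subst mult.left_commute) simp
    hence neg: "(t - t0) * sin (2 * g) < 0" unfolding sc by simp
    show ?case
    proof (cases "t < t0")
      case True
      hence "sin (2 * g) > 0" using neg by (simp add: mult_less_0_iff)
      have "g > 0"
      proof (rule ccontr)
        assume "\<not> g > 0"
        hence "sin (- (2 * g)) \<ge> 0" using g by (intro sin_ge_zero; linarith)
        thus False using \<open>sin (2 * g) > 0\<close> by simp
      qed
      hence "0 < g / pi" by simp
      hence "\<lceil>of_int (n + 1) + g / pi\<rceil> = n + 2" using gp by (intro ceiling_unique; simp; linarith)
      thus ?thesis unfolding K_def x K0 using True by simp
    next
      case False
      hence "t - t0 \<ge> 0" by simp
      hence "sin (2 * g) < 0" using neg by (meson mult_nonneg_nonneg not_le)
      have "g < 0"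
      proof (rule ccontr)
        assume "\<not> g < 0"
        hence "sin (2 * g) \<ge> 0" using g by (intro sin_ge_zero; linarith)
        thus False using \<open>sin (2 * g) < 0\<close> by simp
      qed
      hence "g / pi < 0" by (simp add: divide_neg_pos)
      hence "\<lceil>of_int (n + 1) + g / pi\<rceil> = n + 1" using gp by (intro ceiling_unique; simp; linarith)
      thus ?thesis unfolding K_def x K0 using False by simp
    qed
  qed
  then obtain d where d: "d > 0" "\<forall>t\<in>UNIV. t \<noteq> t0 \<and> dist t t0 < d \<longrightarrow> K t = K t0 + (if t < t0 then 1 else 0)"
    unfolding eventually_at by (elim exE conjE)
  have "K t = K t0 + (if t < t0 then 1 else 0)" if "\<bar>t - t0\<bar> < d" for t
  proof (cases "t = t0")
    case False
    thus ?thesis using that by (intro d(2)[rule_format]) (simp_all add: dist_real_def)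
  qed simp
  thus ?thesis using d(1) by blast
qed

text \<open>h / pi + 1/2 is an integer exactly where cos h = 0, and the ceiling is locally constant
  at non-integers.\<close>

lemma ceiling_phase_locally_constant:
  fixes h :: "real \<Rightarrow> real"
  assumes c: "isCont h t0" and cos0: "cos (h t0) \<noteq> 0"
  shows "\<exists>d>0. \<forall>t. \<bar>t - t0\<bar> < d \<longrightarrow> \<lceil>h t / pi + 1/2\<rceil> = \<lceil>h t0 / pi + 1/2\<rceil>"
proof -
  define x where "x = (\<lambda>t. h t / pi + 1/2)"
  define k where "k = \<lceil>x t0\<rceil>"
  have ni: "x t0 \<noteq> of_int k"
  proof
    assume "x t0 = of_int k"
    hence "h t0 = of_int (k - 1) * pi + pi / 2" by (simp add: x_def field_simps)
    thus False using cos0 unfolding cos_zero_iff_int2 by blast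
  qed
  hence k: "of_int k - 1 < x t0" "x t0 < of_int k" unfolding k_def by linarith+
  have "isCont x t0" unfolding x_def using c by (intro continuous_intros) auto
  hence l: "(x \<longlongrightarrow> x t0) (at t0)" by (simp add: isCont_def)
  have "\<forall>\<^sub>F t in at t0. of_int k - 1 < x t" "\<forall>\<^sub>F t in at t0. x t < of_int k"
    using order_tendstoD[OF l] k by auto
  hence "\<forall>\<^sub>F t in at t0. \<lceil>x t\<rceil> = k" by eventually_elim (intro ceiling_unique, auto)
  then obtain d where d: "d > 0" "\<And>t. t \<noteq> t0 \<Longrightarrow> dist t t0 < d \<Longrightarrow> \<lceil>x t\<rceil> = k" unfolding eventually_at by blast
  have "\<lceil>x t\<rceil> = k" if "\<bar>t - t0\<bar> < d" for t
    using d(2)[of t] that by (cases "t = t0") (auto simp: dist_real_def k_def)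
  thus ?thesis using d(1) unfolding x_def k_def by blast
qed

lemma finite_real_analytic_zeros:
  assumes "real_analytic f" "f x0 \<noteq> 0"
  shows "finite {t. a \<le> t \<and> t \<le> b \<and> f t = 0}"
proof -
  have "\<not> z islimpt {t. f t = 0}" for z
  proof -
    obtain d where "d > 0" "\<And>y. y \<noteq> z \<Longrightarrow> dist y z < d \<Longrightarrow> f y \<noteq> 0"
      using real_analytic_eventually_nonzero[OF assms, of z] unfolding eventually_at by blast
    thus ?thesis unfolding islimpt_approachable by blast
  qed
  hence "finite ({a..b} \<inter> {t. f t = 0})" by (intro finite_not_islimpt_in_compact) auto
  thus ?thesis by (rule finite_subset[rotated]) auto
qed

lemma Z_nonzero_0: "Z 0 \<noteq> 0"
  using Z_neg[of 0] by simp

lemma Z_zero_gt_a_theta: "0 \<le> t \<Longrightarrow> Z t = 0 \<Longrightarrow> t > a_theta"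
  using Z_neg[of t] a_theta_props by (cases "t \<le> 6344/1000") auto

context
  fixes h \<rho> :: "real \<Rightarrow> real"
  assumes h: "real_analytic h" and P: "\<And>t. P_line t = \<rho> t * cos (h t)" and Q: "\<And>t. deriv Z t = \<rho> t * sin (h t)"
begin

lemma phase_relation: "P_line t * sin (h t) = deriv Z t * cos (h t)"
  unfolding P Q by simp

lemma phase_crossing_a_theta:
  "cos (h a_theta) = 0" "\<forall>\<^sub>F t in at a_theta. (t - a_theta) * (sin (h t) * cos (h t)) > 0"
proof -
  let ?a = a_theta
  have "deriv Z ?a * cos (h ?a) = 0"
    using phase_relation[of ?a] a_theta_props by (simp add: P_line_def)
  thus c0: "cos (h ?a) = 0" using Z_deriv_a_theta by simp
  have Za: "Z ?a < 0" using Z_neg[of ?a] a_theta_props by simp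
  have "isCont Z ?a" "isCont (deriv Z) ?a"
    using real_analytic_isCont real_analytic_Z real_analytic_deriv by blast+
  hence l: "(Z \<longlongrightarrow> Z ?a) (at ?a)" "(deriv Z \<longlongrightarrow> deriv Z ?a) (at ?a)" by (simp_all add: isCont_def)
  have "\<forall>\<^sub>F t in at ?a. Z t < 0" "\<forall>\<^sub>F t in at ?a. deriv Z t < 0"
    using order_tendstoD(2)[OF l(1) Za] order_tendstoD(2)[OF l(2) Z_deriv_a_theta] .
  moreover have "\<forall>\<^sub>F t in at ?a. t > 0" using order_tendstoD(1)[OF tendsto_ident_at, of 0 ?a] a_theta_props by simp
  moreover have "\<forall>\<^sub>F t in at ?a. t \<noteq> ?a" by (simp add: eventually_at_filter)
  ultimately show "\<forall>\<^sub>F t in at ?a. (t - ?a) * (sin (h t) * cos (h t)) > 0"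
  proof eventually_elim
    case (elim t)
    have th: "(t - ?a) * deriv theta t > 0"
      using deriv_theta_sign[of t] elim by (cases "t < ?a") (auto intro: mult_neg_neg mult_pos_pos)
    have Pn: "P_line t \<noteq> 0" using th elim by (auto simp: P_line_def)
    hence cn: "cos (h t) \<noteq> 0" using P[of t] by auto
    define X where "X = (t - ?a) * (sin (h t) * cos (h t))"
    \<comment> \<open>Multiplication by the square of \<open>P_line\<close> produces P sin h, which
      \<open>phase_relation\<close> replaces by Z' cos h; what remains is a product of positive
      factors.\<close>
    have "(deriv theta t)\<^sup>2 * (Z t)\<^sup>2 * X = ((t - ?a) * deriv theta t) * (P_line t * sin (h t)) * Z t * cos (h t)"
      unfolding X_def P_line_def by (simp add: power2_eq_square algebra_simps)
    also have "\<dots> = ((t - ?a) * deriv theta t) * (deriv Z t * Z t) * (cos (h t))\<^sup>2"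
      unfolding phase_relation by (simp add: power2_eq_square algebra_simps)
    also have "\<dots> > 0"
    proof -
      have "deriv Z t * Z t > 0" using elim by (intro mult_neg_neg) auto
      moreover have "(cos (h t))\<^sup>2 > 0" using cn by simp
      ultimately show ?thesis using th by (metis mult_pos_pos)
    qed
    finally have "((deriv theta t)\<^sup>2 * (Z t)\<^sup>2) * X > 0" .
    moreover have "(deriv theta t)\<^sup>2 * (Z t)\<^sup>2 \<ge> 0" by simp
    ultimately show ?case unfolding X_def[symmetric] by (meson mult_nonneg_nonpos not_le)
  qed
qed

text \<open>With Z = (t - t0)^m g, the relation P sin h = Z' cos h can be divided by (t - t0)^(m -
  1), which leaves theta' (t - t0) g sin h = B cos h with B(t0) = m g(t0) nonzero. So cos h vanishes
  at t0 whatever the order, and g B > 0 nearby gives the sign.\<close>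

lemma phase_crossing_zero:
  assumes t0: "t0 > a_theta" and Z0: "Z t0 = 0"
  shows "cos (h t0) = 0" "\<forall>\<^sub>F t in at t0. (t - t0) * (sin (h t) * cos (h t)) > 0"
proof -
  obtain m g r G where G: "extends_near g t0 r G" and g0: "g t0 \<noteq> 0"
    and Zf: "\<And>y. \<bar>y - t0\<bar> < r \<Longrightarrow> Z y = (y - t0) ^ m * g y" and m: "m > 0"
    using real_analytic_factor[OF real_analytic_Z Z_nonzero_0, of t0] Z0 by blast
  have r: "r > 0" using G by (simp add: extends_near_def)
  define B where "B = (\<lambda>t. real m * g t + (t - t0) * deriv g t)"
  have cg: "isCont g t0" by (rule DERIV_isCont[OF extends_near_derivative(1)[OF G]]) (use r in simp)
  have cg': "isCont (deriv g) t0"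
    by (rule DERIV_isCont[OF extends_near_derivative(1)[OF extends_near_deriv[OF G]]]) (use r in simp)
  have cB: "isCont B t0" unfolding B_def by (intro continuous_intros cg cg')
  have dZ: "deriv Z t = (t - t0) ^ (m - 1) * B t" if t: "\<bar>t - t0\<bar> < r" for t
  proof -
    have op: "open {t. \<bar>t - t0\<bar> < r}" by (intro open_Collect_less continuous_intros)
    have "((\<lambda>t. (t - t0) ^ m) has_real_derivative real m * (t - t0) ^ (m - 1)) (at t)" by (auto intro!: derivative_eq_intros)
    from DERIV_mult[OF this extends_near_derivative(1)[OF G t]]
    have d: "((\<lambda>t. (t - t0) ^ m * g t) has_real_derivative real m * (t - t0) ^ (m - 1) * g t + deriv g t * (t - t0) ^ m) (at t)" .
    have "(Z has_real_derivative real m * (t - t0) ^ (m - 1) * g t + deriv g t * (t - t0) ^ m) (at t)"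
      by (rule has_field_derivative_transform_within_open[OF d op]) (use Zf t in auto)
    hence "deriv Z t = real m * (t - t0) ^ (m - 1) * g t + deriv g t * (t - t0) ^ m" by (rule DERIV_imp_deriv)
    also have "(t - t0) ^ m = (t - t0) ^ (m - 1) * (t - t0)" using m by (cases m) auto
    finally show ?thesis by (simp add: B_def algebra_simps)
  qed
  have rel: "deriv theta t * (t - t0) * g t * sin (h t) = B t * cos (h t)" if t: "\<bar>t - t0\<bar> < r" "t \<noteq> t0" for t
  proof -
    have e: "(t - t0) ^ m = (t - t0) ^ (m - 1) * (t - t0)" using m by (cases m) auto
    have "(t - t0) ^ (m - 1) * (deriv theta t * (t - t0) * g t * sin (h t)) = P_line t * sin (h t)"
      unfolding P_line_def Zf[OF t(1)] e by (simp only: mult_ac)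
    also have "\<dots> = (t - t0) ^ (m - 1) * (B t * cos (h t))" unfolding phase_relation dZ[OF t(1)] by simp
    finally show ?thesis using t(2) by simp
  qed
  have near: "\<forall>\<^sub>F t in at t0. \<bar>t - t0\<bar> < r \<and> t \<noteq> t0"
    unfolding eventually_at using r by (intro exI[of _ r]) (auto simp: dist_real_def)
  show c0: "cos (h t0) = 0"
  proof -
    have ch: "isCont h t0" and ct: "isCont (deriv theta) t0"
      using real_analytic_isCont h real_analytic_deriv real_analytic_theta by blast+
    have "isCont (\<lambda>t. deriv theta t * (t - t0) * g t * sin (h t)) t0" by (intro continuous_intros ch ct cg)
    hence 1: "((\<lambda>t. deriv theta t * (t - t0) * g t * sin (h t)) \<longlongrightarrow> 0) (at t0)" by (simp add: isCont_def)
    have "isCont (\<lambda>t. B t * cos (h t)) t0" by (intro continuous_intros cB ch)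
    hence 2: "((\<lambda>t. B t * cos (h t)) \<longlongrightarrow> B t0 * cos (h t0)) (at t0)" by (simp add: isCont_def)
    have "\<forall>\<^sub>F t in at t0. deriv theta t * (t - t0) * g t * sin (h t) = B t * cos (h t)"
      using near by eventually_elim (use rel in blast)
    with 1 have "((\<lambda>t. B t * cos (h t)) \<longlongrightarrow> 0) (at t0)" by (rule Lim_transform_eventually)
    hence "B t0 * cos (h t0) = 0" using 2 LIM_unique by blast
    thus ?thesis using m g0 by (simp add: B_def)
  qed
  have "(\<lambda>t. g t * B t) \<midarrow>t0\<rightarrow> g t0 * B t0" using cg cB by (intro tendsto_mult) (auto simp: isCont_def)
  moreover have "g t0 * B t0 > 0"
  proof -
    have "g t0 * B t0 = real m * (g t0)\<^sup>2" by (simp add: B_def power2_eq_square)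
    thus ?thesis using m g0 by simp
  qed
  ultimately have "\<forall>\<^sub>F t in at t0. g t * B t > 0" by (rule order_tendstoD(1))
  moreover have "\<forall>\<^sub>F t in at t0. Z t \<noteq> 0" by (rule real_analytic_eventually_nonzero[OF real_analytic_Z Z_nonzero_0])
  moreover have "\<forall>\<^sub>F t in at t0. t > a_theta" using order_tendstoD(1)[OF tendsto_ident_at t0] .
  ultimately show "\<forall>\<^sub>F t in at t0. (t - t0) * (sin (h t) * cos (h t)) > 0"
    using near
  proof eventually_elim
    case (elim t)
    have th: "deriv theta t > 0" using deriv_theta_sign(2)[of t] elim a_theta_props by auto
    have cn: "cos (h t) \<noteq> 0" using P[of t] th elim by (auto simp: P_line_def)
    have "deriv theta t * (g t)\<^sup>2 * ((t - t0) * (sin (h t) * cos (h t))) = (deriv theta t * (t - t0) * g t * sin (h t)) * (g t * cos (h t))"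
      by (simp add: power2_eq_square algebra_simps)
    also have "\<dots> = (g t * B t) * (cos (h t))\<^sup>2" unfolding rel[OF conjunct1[OF elim(4)] conjunct2[OF elim(4)]] by (simp add: power2_eq_square algebra_simps)
    also have "\<dots> > 0" using elim cn by simp
    finally have pos: "deriv theta t * (g t)\<^sup>2 * ((t - t0) * (sin (h t) * cos (h t))) > 0" .
    have "deriv theta t * (g t)\<^sup>2 \<ge> 0" using th by simp
    with pos show ?case by (simp add: zero_less_mult_iff)
  qed
qed

text \<open>At each crossing \<open>K\<close> drops by one while \<open>M\<close>, which counts with
  x <= t, rises by one; both are continuous from the right. Hence \<open>f\<close> is locally
  constant on [0, oo), and comparing it at 0 and at t gives K t = -n.\<close>

lemma phase_bounds:
  assumes h0: "h 0 = 0" and t: "t \<ge> a_theta"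
  defines "n \<equiv> card {\<xi>. 0 < \<xi> \<and> \<xi> \<le> t \<and> Z \<xi> = 0}"
  shows "- 3/2 - real n < h t / pi" "h t / pi \<le> - 1/2 - real n"
proof -
  \<comment> \<open>The points where the integer drops; \<open>a_theta\<close> is the only one that
    is not a zero of \<open>Z\<close>, which makes \<open>M t\<close> equal to n + 1.\<close>
  define W where "W = {x. 0 < x \<and> (Z x = 0 \<or> x = a_theta)}"
  define M where "M = (\<lambda>t. card {x \<in> W. x \<le> t})"
  define K where "K = (\<lambda>t. \<lceil>h t / pi + 1/2\<rceil>)"
  define f where "f = (\<lambda>t. K t + int (M t))"
  have fin: "finite {x \<in> W. x \<le> b}" for b
  proof -
    have "{x \<in> W. x \<le> b} \<subseteq> insert a_theta {t. 0 \<le> t \<and> t \<le> b \<and> Z t = 0}" by (auto simp: W_def)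
    thus ?thesis using finite_real_analytic_zeros[OF real_analytic_Z Z_nonzero_0, of 0 b] by (meson finite.insertI finite_subset)
  qed
  have iso: "\<exists>d>0. \<forall>x\<in>W. \<bar>x - t0\<bar> < d \<longrightarrow> x = t0" for t0
  proof -
    have "finite ({x \<in> W. x \<le> t0 + 1} - {t0})" using fin by blast
    from finite_set_avoid[OF this, of t0] obtain d where d: "d > 0" "\<And>x. x \<in> {x \<in> W. x \<le> t0 + 1} - {t0} \<Longrightarrow> x \<noteq> t0 \<Longrightarrow> d \<le> dist t0 x"
      by blast
    have "x = t0" if "x \<in> W" "\<bar>x - t0\<bar> < min d 1" for x
      using d(2)[of x] that by (force simp: dist_real_def abs_minus_commute abs_less_iff)
    thus ?thesis using d(1) by (intro exI[of _ "min d 1"]) auto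
  qed
  have cross: "cos (h t0) = 0 \<and> (\<forall>\<^sub>F t in at t0. (t - t0) * (sin (h t) * cos (h t)) > 0)" if "t0 \<in> W" for t0
  proof (cases "t0 = a_theta")
    case True thus ?thesis using phase_crossing_a_theta by simp
  next
    case False
    hence "Z t0 = 0" "t0 \<ge> 0" using that by (auto simp: W_def)
    thus ?thesis using phase_crossing_zero Z_zero_gt_a_theta by blast
  qed
  have hc: "isCont h t0" for t0 using real_analytic_isCont[OF h] .
  have loc: "\<exists>d>0. \<forall>t. \<bar>t - t0\<bar> < d \<longrightarrow> f t = f t0" if t0: "t0 \<ge> 0" for t0
  proof -
    obtain d1 where d1: "d1 > 0" "\<And>x. x \<in> W \<Longrightarrow> \<bar>x - t0\<bar> < d1 \<Longrightarrow> x = t0" using iso[of t0] by blast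
    show ?thesis
    proof (cases "t0 \<in> W")
      case True
      from ceiling_phase_crossing[OF hc] cross[OF True]
      obtain d2 where d2: "d2 > 0" "\<And>t. \<bar>t - t0\<bar> < d2 \<Longrightarrow> K t = K t0 + (if t < t0 then 1 else 0)"
        unfolding K_def by blast
      have "f t = f t0" if tt: "\<bar>t - t0\<bar> < min d1 d2" for t
      proof (cases "t < t0")
        case tl: True
        have "{x \<in> W. x \<le> t0} = insert t0 {x \<in> W. x \<le> t}"
        proof (intro equalityI subsetI)
          fix x assume x: "x \<in> {x \<in> W. x \<le> t0}"
          show "x \<in> insert t0 {x \<in> W. x \<le> t}"
          proof (cases "x \<le> t")
            case False
            hence "\<bar>x - t0\<bar> < d1" using x tt by auto
            thus ?thesis using d1(2)[of x] x by auto
          qed (use x in auto)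
        qed (use True tl in auto)
        hence "M t0 = Suc (M t)" unfolding M_def using fin[of t] tl by simp
        thus ?thesis using d2(2)[of t] tt tl by (simp add: f_def)
      next
        case False
        have "{x \<in> W. x \<le> t0} = {x \<in> W. x \<le> t}"
        proof (intro equalityI subsetI)
          fix x assume x: "x \<in> {x \<in> W. x \<le> t}"
          show "x \<in> {x \<in> W. x \<le> t0}"
          proof (cases "x \<le> t0")
            case False
            hence "\<bar>x - t0\<bar> < d1" using x tt by auto
            thus ?thesis using d1(2)[of x] x by auto
          qed (use x in auto)
        qed (use False in auto)
        thus ?thesis using d2(2)[of t] tt False by (simp add: f_def M_def)
      qed
      moreover have "min d1 d2 > 0" using d1(1) d2(1) by simp
      ultimately show ?thesis by blast
    next
      case False
      have "cos (h t0) \<noteq> 0"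
      proof -
        have "Z t0 \<noteq> 0" using False t0 Z_nonzero_0 by (cases "t0 = 0") (auto simp: W_def)
        moreover have "t0 \<noteq> a_theta" using False a_theta_props by (auto simp: W_def)
        hence "deriv theta t0 \<noteq> 0" using deriv_theta_sign[OF t0] by (cases "t0 < a_theta") auto
        ultimately show ?thesis using P[of t0] by (auto simp: P_line_def)
      qed
      from ceiling_phase_locally_constant[OF hc this]
      obtain d2 where d2: "d2 > 0" "\<And>t. \<bar>t - t0\<bar> < d2 \<Longrightarrow> K t = K t0"
        unfolding K_def by blast
      have "f t = f t0" if tt: "\<bar>t - t0\<bar> < min d1 d2" for t
      proof -
        have "x \<le> t \<longleftrightarrow> x \<le> t0" if "x \<in> W" for x
        proof -
          have "x \<noteq> t0" using False that by auto
          hence "\<bar>x - t0\<bar> \<ge> d1" using d1(2)[OF that] by (meson not_le)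
          thus ?thesis using tt by auto
        qed
        hence "{x \<in> W. x \<le> t} = {x \<in> W. x \<le> t0}" by blast
        thus ?thesis using d2(2)[of t] tt by (simp add: f_def M_def)
      qed
      moreover have "min d1 d2 > 0" using d1(1) d2(1) by simp
      ultimately show ?thesis by blast
    qed
  qed
  have "f 0 = f t"
  proof (rule connected_local_const[where f = f and A = "{0..}" and a = 0 and b = t])
    show "connected {0::real..}" by simp
    show "\<forall>a\<in>{0..}. \<forall>\<^sub>F b in at a within {0..}. f a = f b"
    proof
      fix a :: real assume "a \<in> {0..}"
      then obtain d where d: "d > 0" "\<And>t. \<bar>t - a\<bar> < d \<Longrightarrow> f t = f a" using loc[of a] by auto
      thus "\<forall>\<^sub>F b in at a within {0..}. f a = f b"
        unfolding eventually_at dist_real_def by metis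
    qed
  qed (use t a_theta_props in auto)
  moreover have "f 0 = 1"
  proof -
    have "{x \<in> W. x \<le> 0} = {}" by (auto simp: W_def)
    moreover have "K 0 = 1" unfolding K_def h0 by (intro ceiling_unique) auto
    ultimately show ?thesis by (simp only: f_def M_def card.empty)
  qed
  moreover have "M t = Suc n"
  proof -
    have "{x \<in> W. x \<le> t} = insert a_theta {\<xi>. 0 < \<xi> \<and> \<xi> \<le> t \<and> Z \<xi> = 0}"
      using t a_theta_props by (auto simp: W_def)
    moreover have "a_theta \<notin> {\<xi>. 0 < \<xi> \<and> \<xi> \<le> t \<and> Z \<xi> = 0}" using Z_neg[of a_theta] a_theta_props by auto
    moreover have "finite {\<xi>. 0 < \<xi> \<and> \<xi> \<le> t \<and> Z \<xi> = 0}"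
      by (rule finite_subset[OF _ finite_real_analytic_zeros[OF real_analytic_Z Z_nonzero_0, of 0 t]]) auto
    ultimately show ?thesis unfolding M_def n_def by simp
  qed
  ultimately have "K t = - int n" by (simp add: f_def)
  hence Kt: "\<lceil>h t / pi + 1/2\<rceil> = - int n" by (simp only: K_def)
  have "of_int \<lceil>h t / pi + 1/2\<rceil> - 1 < h t / pi + 1/2" "h t / pi + 1/2 \<le> of_int \<lceil>h t / pi + 1/2\<rceil>"
    using ceiling_correct by blast+
  thus "- 3/2 - real n < h t / pi" "h t / pi \<le> - 1/2 - real n" unfolding Kt by simp_all
qed

end

subsection \<open>The argument principle for xi\<close>

text \<open>The terms from 2 on have total modulus at most zeta(2) - 1 = pi^2 / 6 - 1, which is less
  than the first term 1.\<close>

lemma zeta_right_half_plane: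
  assumes "Re s \<ge> 2" shows "Re (zeta s) > 0"
proof -
  define f where "f = (\<lambda>n. of_nat (Suc n) powr (- s) :: complex)"
  have sf: "summable f" unfolding f_def using assms by (intro Dirichlet_series_summable) simp
  have z: "zeta s = suminf f"
    using assms zeta_formula_Dirichlet[of s] unfolding zeta_eq f_def by auto
  have sq: "(\<lambda>n. 1 / (real (Suc (n + 1)))\<^sup>2) sums (pi\<^sup>2 / 6 - 1)"
    using inverse_squares_sums sums_Suc_iff[of "\<lambda>n. 1 / (real n + 1)\<^sup>2" "pi\<^sup>2 / 6 - 1"] by (simp add: add_ac)
  have "norm (\<Sum>n. f (Suc n)) \<le> pi\<^sup>2 / 6 - 1"
  proof -
    have le: "norm (f (Suc n)) \<le> 1 / (real (Suc (n + 1)))\<^sup>2" for n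
    proof -
      have "norm (f (Suc n)) = real (Suc (Suc n)) powr (- Re s)"
        using norm_powr_real_powr[of "of_nat (Suc (Suc n))" "- s"] unfolding f_def by (simp del: of_nat_Suc)
      also have "\<dots> \<le> real (Suc (Suc n)) powr (- real 2)" using assms by (intro powr_mono) auto
      also have "\<dots> = 1 / (real (Suc (n + 1)))\<^sup>2" by (simp only: powr_minus powr_realpow[of "real (Suc (Suc n))" 2] of_nat_0_less_iff zero_less_Suc) (simp add: inverse_eq_divide)
      finally show ?thesis .
    qed
    have "norm (\<Sum>n. f (Suc n)) \<le> (\<Sum>n. 1 / (real (Suc (n + 1)))\<^sup>2)"
      by (intro norm_suminf_le le sums_summable[OF sq])
    thus ?thesis using sums_unique[OF sq] by simp
  qed
  moreover have "pi\<^sup>2 / 6 - 1 < 1"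
  proof -
    have "pi * pi \<le> 3.2 * 3.2" using pi_less_4 pi_approx by (intro mult_mono) auto
    thus ?thesis by (simp add: power2_eq_square)
  qed
  moreover have "zeta s = 1 + (\<Sum>n. f (Suc n))"
    unfolding z using suminf_split_head[OF sf] by (simp add: f_def)
  moreover have "- Re (\<Sum>n. f (Suc n)) \<le> norm (\<Sum>n. f (Suc n))"
    using abs_Re_le_cmod[of "\<Sum>n. f (Suc n)"] by linarith
  ultimately show ?thesis by simp
qed

lemma zeta_cnj: "zeta (cnj s) = cnj (zeta s)"
proof (cases "s = 1")
  case False
  have "cnj s / 2 + 1 = cnj (s / 2 + 1)" by simp
  moreover have "of_real pi powr (cnj s / 2) = cnj (of_real pi powr (s / 2))"
    by (simp add: powr_def Ln_of_real exp_cnj)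
  moreover have "rGamma (cnj (s / 2 + 1)) = cnj (rGamma (s / 2 + 1))" by (rule cnj_rGamma[symmetric])
  moreover have "cnj s \<noteq> 1" using False by (metis complex_cnj_cnj complex_cnj_one)
  ultimately show ?thesis using False unfolding zeta_eq zeta_formula_def xi_cnj by simp
qed (simp add: zeta_eq)

definition archimedean_factor :: "complex \<Rightarrow> complex" where
  "archimedean_factor s = (s - 1) * of_real pi powr (- (s / 2)) * Gamma (s / 2 + 1)"

lemma xi_eq_zeta:
  assumes "s \<noteq> 1" "s / 2 + 1 \<notin> \<int>\<^sub>\<le>\<^sub>0"
  shows "xi s = zeta s * archimedean_factor s"
proof -
  have "rGamma (s / 2 + 1) * Gamma (s / 2 + 1) = 1"
    using assms(2) by (simp add: rGamma_inverse_Gamma Gamma_eq_zero_iff)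
  moreover have "of_real pi powr (s / 2) * of_real pi powr (- (s / 2)) = (1 :: complex)"
    by (simp flip: powr_add)
  ultimately have "xi s = xi s * (of_real pi powr (s / 2) * of_real pi powr (- (s / 2))) * (rGamma (s / 2 + 1) * Gamma (s / 2 + 1))" by simp
  also have "\<dots> = zeta s * archimedean_factor s"
    using assms(1) by (simp add: zeta_eq zeta_formula_def archimedean_factor_def)
  finally show ?thesis .
qed

lemma archimedean_factor_nonzero:
  assumes "s \<noteq> 1" "s / 2 + 1 \<notin> \<int>\<^sub>\<le>\<^sub>0"
  shows "archimedean_factor s \<noteq> 0"
  using assms by (simp add: archimedean_factor_def Gamma_eq_zero_iff)

lemma not_nonpos_Int_half:
  assumes "Im s \<noteq> 0 \<or> Re s > -2"
  shows "s / 2 + 1 \<notin> \<int>\<^sub>\<le>\<^sub>0"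
proof
  assume "s / 2 + 1 \<in> \<int>\<^sub>\<le>\<^sub>0"
  then obtain n where "s / 2 + 1 = - of_nat n" by (auto elim!: nonpos_Ints_cases')
  hence "s = of_real (- 2 * real n - 2)" by (simp add: field_simps)
  thus False using assms by auto
qed

lemma xi_nonzero_outside:
  assumes "Re s \<ge> 2 \<or> Re s \<le> -1" shows "xi s \<noteq> 0"
proof -
  have r: "xi s \<noteq> 0" if "Re s \<ge> 2" for s
  proof -
    have "s \<noteq> 1" "s / 2 + 1 \<notin> \<int>\<^sub>\<le>\<^sub>0" using that not_nonpos_Int_half[of s] by auto
    moreover have "zeta s \<noteq> 0" using zeta_right_half_plane[OF that] by auto
    ultimately show ?thesis using xi_eq_zeta archimedean_factor_nonzero by auto
  qed
  show ?thesis using assms r[of s] r[of "1 - s"] by (auto simp: xi_symmetric)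
qed

lemma omega_mellin_0_real_bounds:
  assumes "p \<le> 1"
  shows "0 \<le> Re (omega_mellin 0 (of_real p))" "Re (omega_mellin 0 (of_real p)) \<le> 1"
proof -
  have e: "Re (omega_mellin 0 (of_real p)) = integral {1..} (\<lambda>x. omega x * ln x ^ 0 * x powr (p - 1))"
    unfolding omega_mellin_of_real by simp
  have i: "(\<lambda>x. omega x * ln x ^ 0 * x powr (p - 1)) integrable_on {1..}"
    by (intro set_lebesgue_integral_eq_integral(1)[OF omega_moment_abs_integrable])
  show "0 \<le> Re (omega_mellin 0 (of_real p))"
    unfolding e by (rule integral_nonneg[OF i]) (use omega_nonneg in auto)
  have "((\<lambda>x. exp (- pi * x)) has_integral exp (- pi * 1) / pi) {1..}"
    by (rule has_integral_exp_minus_to_infinity) simp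
  hence j: "((\<lambda>x. 2 * exp (- pi * x)) has_integral 2 * (exp (- pi * 1) / pi)) {1..}"
    by (rule has_integral_mult_right)
  have "integral {1..} (\<lambda>x. omega x * ln x ^ 0 * x powr (p - 1)) \<le> 2 * (exp (- pi * 1) / pi)"
  proof (rule has_integral_le[OF integrable_integral[OF i] j])
    fix x :: real assume "x \<in> {1..}"
    hence x: "x \<ge> 1" by simp
    hence "x powr (p - 1) \<le> x powr 0" using assms by (intro powr_mono) auto
    hence "omega x * x powr (p - 1) \<le> (2 * exp (- pi * x)) * 1"
      using x omega_le'[OF x] omega_nonneg[of x] by (intro mult_mono) auto
    thus "omega x * ln x ^ 0 * x powr (p - 1) \<le> 2 * exp (- pi * x)" by simp
  qed
  also have "\<dots> \<le> 1"
  proof -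
    have "exp (- pi) \<le> 1" by simp
    hence "2 * exp (- pi) \<le> pi" using pi_ge_two by linarith
    thus ?thesis by (simp add: field_simps)
  qed
  finally show "Re (omega_mellin 0 (of_real p)) \<le> 1" unfolding e .
qed

text \<open>Keeps the bottom edge of the rectangle in the argument principle free of zeros: the two
  transforms sum to m in [0, 2], and s (s - 1) >= -1/4, so s (s - 1) m + 1 >= 1/2.\<close>

lemma xi_real_pos:
  fixes \<sigma> :: real
  assumes "-1 \<le> \<sigma>" "\<sigma> \<le> 2"
  shows "Re (xi (of_real \<sigma>)) > 0"
proof -
  define m where "m = Re (omega_mellin 0 (of_real (\<sigma> / 2))) + Re (omega_mellin 0 (of_real ((1 - \<sigma>) / 2)))"
  have m: "0 \<le> m" "m \<le> 2"
    using omega_mellin_0_real_bounds[of "\<sigma> / 2"] omega_mellin_0_real_bounds[of "(1 - \<sigma>) / 2"] assms by (auto simp: m_def)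
  have "xi (of_real \<sigma>) = (of_real (\<sigma> * (\<sigma> - 1)) * (omega_mellin 0 (of_real (\<sigma> / 2)) + omega_mellin 0 (of_real ((1 - \<sigma>) / 2))) + 1) / 2"
    unfolding xi_def by simp
  hence "Re (xi (of_real \<sigma>)) = (\<sigma> * (\<sigma> - 1) * m + 1) / 2" unfolding m_def
    by (simp only: Re_complex_of_real Re_divide_numeral plus_complex.sel one_complex.sel Re_complex_of_real times_complex.sel Im_complex_of_real) simp
  moreover have "\<sigma> * (\<sigma> - 1) \<ge> - 1 / 4"
  proof -
    have "\<sigma> * (\<sigma> - 1) = (\<sigma> - 1/2)\<^sup>2 - 1 / 4" by (simp add: power2_eq_square algebra_simps)
    thus ?thesis by simp
  qed
  hence "- 1 / 4 * m \<le> \<sigma> * (\<sigma> - 1) * m" using m by (intro mult_right_mono)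
  ultimately show ?thesis using m by simp
qed


section \<open>The logarithmic derivative of xi and its symmetries\<close>

definition xi_log_deriv :: "complex \<Rightarrow> complex" where
  "xi_log_deriv s = deriv xi s / xi s"

lemma xi_has_derivative: "(xi has_field_derivative deriv xi s) (at s)"
  using xi_holomorphic[of UNIV] by (simp add: holomorphic_derivI)

lemma xi_log_deriv_reflect: "xi_log_deriv (1 - s) = - xi_log_deriv s"
proof -
  have "((\<lambda>s. xi (1 - s)) has_field_derivative deriv xi (1 - s) * (0 - 1)) (at s)"
    by (rule DERIV_chain2[where f = xi, OF xi_has_derivative]) (auto intro!: derivative_eq_intros)
  hence "deriv xi s = - deriv xi (1 - s)" unfolding xi_symmetric by (simp add: DERIV_imp_deriv)
  thus ?thesis by (simp add: xi_log_deriv_def xi_symmetric)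
qed

lemma xi_log_deriv_cnj: "xi_log_deriv (cnj s) = cnj (xi_log_deriv s)"
proof -
  have "(cnj has_derivative cnj) (at (cnj s))"
    by (rule bounded_linear_imp_has_derivative[OF bounded_linear_cnj])
  moreover have "(xi has_derivative (*) (deriv xi s)) (at (cnj (cnj s)))"
    using xi_has_derivative[of s] by (simp add: has_field_derivative_def)
  ultimately have "((\<lambda>w. xi (cnj w)) has_derivative (\<lambda>h. deriv xi s * cnj h)) (at (cnj s))"
    by (rule has_derivative_compose)
  from bounded_linear.has_derivative[OF bounded_linear_cnj this]
  have "(xi has_derivative (\<lambda>h. cnj (deriv xi s) * h)) (at (cnj s))" by (simp add: xi_cnj)
  hence "(xi has_field_derivative cnj (deriv xi s)) (at (cnj s))" by (simp add: has_field_derivative_def)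
  hence "deriv xi (cnj s) = cnj (deriv xi s)" by (rule DERIV_imp_deriv)
  thus ?thesis by (simp add: xi_log_deriv_def xi_cnj)
qed

lemma xi_log_deriv_holomorphic:
  assumes "\<And>s. s \<in> A \<Longrightarrow> xi s \<noteq> 0"
  shows "xi_log_deriv holomorphic_on A"
proof -
  have "deriv xi holomorphic_on UNIV" by (intro holomorphic_deriv xi_holomorphic) simp
  hence "deriv xi holomorphic_on A" by (rule holomorphic_on_subset) simp
  thus ?thesis unfolding xi_log_deriv_def[abs_def] by (rule holomorphic_on_divide[OF _ xi_holomorphic assms])
qed

text \<open>The velocity of the reflected path is minus the conjugate of the original velocity; this
  sign cancels the sign in the hypothesis on f.\<close>

lemma contour_integral_linepath_antireflect:
  assumes "\<And>s. f (1 - cnj s) = - cnj (f s)"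
  shows "contour_integral (linepath (1 - cnj a) (1 - cnj b)) f = cnj (contour_integral (linepath a b) f)"
proof -
  have "linepath (1 - cnj a) (1 - cnj b) x = 1 - cnj (linepath a b x)" for x
    by (simp add: linepath_def algebra_simps scaleR_conv_of_real)
  moreover have "1 - cnj b - (1 - cnj a) = - cnj (b - a)" by simp
  ultimately have e: "f (linepath (1 - cnj a) (1 - cnj b) x) * vector_derivative (linepath (1 - cnj a) (1 - cnj b)) (at x) =
         cnj (f (linepath a b x) * vector_derivative (linepath a b) (at x))" for x
    by (simp only: assms vector_derivative_linepath_at complex_cnj_mult mult_minus_left mult_minus_right minus_minus)
  show ?thesis unfolding contour_integral_integral e by (simp add: integral_cnj)
qed

lemma contour_integral_linepath_real:
  assumes "\<And>s. f (cnj s) = cnj (f s)" "Im a = 0" "Im b = 0"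
  shows "Im (contour_integral (linepath a b) f) = 0"
proof -
  have "cnj a = a" "cnj b = b" using assms by (simp_all add: complex_eq_iff)
  hence "cnj (linepath a b x) = linepath a b x" for x by (simp add: linepath_def)
  hence e: "cnj (f (linepath a b x) * vector_derivative (linepath a b) (at x)) = f (linepath a b x) * vector_derivative (linepath a b) (at x)" for x
    using \<open>cnj a = a\<close> \<open>cnj b = b\<close> by (simp flip: assms(1))
  have "cnj (contour_integral (linepath a b) f) = contour_integral (linepath a b) f"
    unfolding contour_integral_integral integral_cnj e ..
  thus ?thesis by (metis complex_cnj_cancel_iff Reals_cnj_iff complex_is_Real_iff)
qed

lemma xi_zeros_bounded_finite:
  assumes "bounded A" shows "finite {s \<in> A. xi s = 0}"
proof -
  have "\<not> z islimpt {s. xi s = 0}" for z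
  proof
    assume "z islimpt {s. xi s = 0}"
    hence "xi 2 = 0"
      by (intro analytic_continuation[of xi UNIV "{s. xi s = 0}" z 2] xi_holomorphic) (simp_all add: convex_connected)
    moreover have "xi 2 \<noteq> 0" by (rule xi_nonzero_outside) simp
    ultimately show False by contradiction
  qed
  hence "finite (closure A \<inter> {s. xi s = 0})" using assms by (intro finite_not_islimpt_in_compact) (simp_all add: compact_closure)
  moreover have "{s \<in> A. xi s = 0} \<subseteq> closure A \<inter> {s. xi s = 0}"
    by (intro subsetI) (simp add: subsetD[OF closure_subset])
  ultimately show ?thesis by (rule finite_subset[rotated])
qed

lemma xi_zero_upper_strip_finite: "finite {s. xi s = 0 \<and> 0 < Im s \<and> Im s \<le> t}"
proof -
  have "{s. xi s = 0 \<and> 0 < Im s \<and> Im s \<le> t} \<subseteq> {s \<in> cbox (Complex (-1) 0) (Complex 2 t). xi s = 0}"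
    using xi_nonzero_outside by (force simp: in_cbox_complex_iff)
  thus ?thesis using xi_zeros_bounded_finite[OF bounded_cbox] finite_subset by blast
qed

text \<open>Of the rectangle with corners \<open>-1\<close>, \<open>2\<close>, \<open>2 + i t\<close>, \<open>-1 + i t\<close>, the bottom edge contributes a real number,
  and the reflection \<open>s \<mapsto> 1 - cnj s\<close> maps the right half of the remaining path to the left half.\<close>
lemma xi_argument_principle:
  assumes t: "t > 0" and nz: "\<And>s. Im s = t \<Longrightarrow> xi s \<noteq> 0"
  shows "Im (contour_integral (linepath 2 (Complex 2 t) +++ linepath (Complex 2 t) (Complex (1/2) t)) xi_log_deriv)
           = pi * of_int (\<Sum>s | xi s = 0 \<and> 0 < Im s \<and> Im s \<le> t. zorder xi s)"
proof -
  let ?F = xi_log_deriv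
  define N where "N = (\<Sum>s | xi s = 0 \<and> 0 < Im s \<and> Im s \<le> t. zorder xi s)"
  define R where "R = rectpath (-1) (Complex 2 t)"
  \<comment> \<open>Any connected open set around the rectangle would serve; zeros of
    \<open>xi\<close> in this ball that lie outside the rectangle have winding number 0.\<close>
  define S0 where "S0 = (ball 0 (t + 4) :: complex set)"
  have img: "path_image R = {z. Re z \<in> {-1, 2} \<and> Im z \<in> {0..t}} \<union> {z. Im z \<in> {0, t} \<and> Re z \<in> {-1..2}}"
    unfolding R_def using t by (subst path_image_rectpath) auto
  have xi_img: "xi z \<noteq> 0" if "z \<in> path_image R" for z
  proof -
    consider "Re z \<ge> 2 \<or> Re z \<le> -1" | "Im z = t" | "Im z = 0" "-1 \<le> Re z" "Re z \<le> 2" using \<open>z \<in> path_image R\<close> unfolding img by auto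
    thus ?thesis
    proof cases
      case 3
      hence "z = of_real (Re z)" by (simp add: complex_eq_iff)
      thus ?thesis using xi_real_pos[OF 3(2,3)] by (metis less_irrefl zero_complex.sel(1))
    qed (use xi_nonzero_outside nz in auto)
  qed
  have box: "z \<in> box (-1) (Complex 2 t) \<longleftrightarrow> -1 < Re z \<and> Re z < 2 \<and> 0 < Im z \<and> Im z < t" for z
    by (auto simp: in_box_complex_iff)
  have cbox: "z \<in> cbox (-1) (Complex 2 t) \<longleftrightarrow> -1 \<le> Re z \<and> Re z \<le> 2 \<and> 0 \<le> Im z \<and> Im z \<le> t" for z
    by (auto simp: in_cbox_complex_iff)
  have sub: "cbox (-1) (Complex 2 t) \<subseteq> S0"
  proof
    fix z assume "z \<in> cbox (-1) (Complex 2 t)"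
    hence "\<bar>Re z\<bar> \<le> 2" "\<bar>Im z\<bar> \<le> t" unfolding cbox by auto
    thus "z \<in> S0" using cmod_le[of z] unfolding S0_def by simp
  qed
  define pz where "pz = {w \<in> S0. xi w = 0 \<or> w \<in> {}}"
  have fin: "finite pz" using xi_zeros_bounded_finite[of S0] by (simp add: pz_def S0_def)
  have "contour_integral R (\<lambda>x. deriv xi x * 1 / xi x) = 2 * pi * \<i> * (\<Sum>p\<in>pz. winding_number R p * 1 * zorder xi p)"
    unfolding pz_def
  proof (rule argument_principle)
    show "path_image R \<subseteq> S0 - {w \<in> S0. xi w = 0 \<or> w \<in> {}}"
      using sub path_image_rectpath_subset_cbox[of "-1" "Complex 2 t"] t xi_img unfolding R_def by auto
    show "\<forall>z. z \<notin> S0 \<longrightarrow> winding_number R z = 0"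
      using sub t unfolding R_def by (intro allI impI winding_number_rectpath_outside) auto
    show "finite {w \<in> S0. xi w = 0 \<or> w \<in> {}}" using fin by (simp add: pz_def)
  qed (auto simp: S0_def R_def intro: holomorphic_intros)
  hence total: "contour_integral R ?F = 2 * pi * \<i> * (\<Sum>p\<in>pz. winding_number R p * of_int (zorder xi p))"
    by (simp add: xi_log_deriv_def[abs_def])
  also have "(\<Sum>p\<in>pz. winding_number R p * of_int (zorder xi p)) = (\<Sum>s | xi s = 0 \<and> 0 < Im s \<and> Im s \<le> t. of_int (zorder xi s))"
  proof (rule sum.mono_neutral_cong_right[OF fin])
    show "{s. xi s = 0 \<and> 0 < Im s \<and> Im s \<le> t} \<subseteq> pz"
    proof
      fix s assume s: "s \<in> {s. xi s = 0 \<and> 0 < Im s \<and> Im s \<le> t}"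
      hence "s \<in> cbox (-1) (Complex 2 t)" using xi_nonzero_outside[of s] unfolding cbox by fastforce
      thus "s \<in> pz" using s sub by (auto simp: pz_def)
    qed
    show "\<forall>i\<in>pz - {s. xi s = 0 \<and> 0 < Im s \<and> Im s \<le> t}. winding_number R i * of_int (zorder xi i) = 0"
    proof
      fix p assume p: "p \<in> pz - {s. xi s = 0 \<and> 0 < Im s \<and> Im s \<le> t}"
      have "p \<notin> cbox (-1) (Complex 2 t)"
      proof
        assume "p \<in> cbox (-1) (Complex 2 t)"
        hence "Im p = 0" using p unfolding cbox by (auto simp: pz_def)
        hence "p \<in> path_image R" using \<open>p \<in> cbox (-1) (Complex 2 t)\<close> unfolding img cbox by auto
        thus False using xi_img p by (auto simp: pz_def)
      qed
      hence "winding_number R p = 0" using t unfolding R_def by (intro winding_number_rectpath_outside) auto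
      thus "winding_number R p * of_int (zorder xi p) = 0" by simp
    qed
    fix s assume "s \<in> {s. xi s = 0 \<and> 0 < Im s \<and> Im s \<le> t}"
    moreover from this have "-1 < Re s" "Re s < 2" "Im s \<noteq> t" using xi_nonzero_outside[of s] nz[of s] by (auto simp: not_le[symmetric])
    ultimately have "winding_number R s = 1" unfolding R_def by (intro winding_number_rectpath) (auto simp: box)
    thus "winding_number R s * of_int (zorder xi s) = of_int (zorder xi s)" by simp
  qed
  also have "\<dots> = of_int N" by (simp add: N_def)
  finally have RN: "contour_integral R ?F = 2 * pi * \<i> * of_int N" .

  have F: "?F holomorphic_on path_image R" by (intro xi_log_deriv_holomorphic xi_img)
  have cont: "continuous_on (closed_segment a b) ?F" if "closed_segment a b \<subseteq> path_image R" for a b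
    using holomorphic_on_imp_continuous_on[OF F] continuous_on_subset that by blast
  let ?m = "Complex (1/2) t"
  have c: "Complex 2 0 = 2" by (simp add: complex_eq_iff)
  have segs: "closed_segment (-1) 2 \<subseteq> path_image R" "closed_segment 2 (Complex 2 t) \<subseteq> path_image R"
    "closed_segment (Complex 2 t) (Complex (-1) t) \<subseteq> path_image R" "closed_segment (Complex (-1) t) (-1) \<subseteq> path_image R"
    unfolding R_def rectpath_def Let_def by (auto simp: path_image_join c)
  \<comment> \<open>The top edge is split at the fixed point of the reflection.\<close>
  have mid: "?m \<in> closed_segment (Complex 2 t) (Complex (-1) t)"
    unfolding closed_segment_def by (auto simp: complex_eq_iff intro!: exI[of _ "1/2"])
  have segs': "closed_segment (Complex 2 t) ?m \<subseteq> path_image R" "closed_segment ?m (Complex (-1) t) \<subseteq> path_image R"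
    using segs(3) mid subset_closed_segment[of "Complex 2 t" ?m "Complex 2 t" "Complex (-1) t"]
      subset_closed_segment[of ?m "Complex (-1) t" "Complex 2 t" "Complex (-1) t"] by auto
  note ci = contour_integrable_continuous_linepath[OF cont]
  define I where "I = (\<lambda>a b. contour_integral (linepath a b) ?F)"
  have "contour_integral R ?F = I (-1) 2 + (I 2 (Complex 2 t) + (I (Complex 2 t) (Complex (-1) t) + I (Complex (-1) t) (-1)))"
    unfolding R_def rectpath_def Let_def I_def using ci[OF segs(1)] ci[OF segs(2)] ci[OF segs(3)] ci[OF segs(4)]
    by (simp add: c)
  also have "I (Complex 2 t) (Complex (-1) t) = I (Complex 2 t) ?m + I ?m (Complex (-1) t)"
    unfolding I_def by (rule contour_integral_split_linepath[OF cont[OF segs(3)] mid])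
  finally have parts: "contour_integral R ?F = I (-1) 2 + (I 2 (Complex 2 t) + I (Complex 2 t) ?m)
      + (I ?m (Complex (-1) t) + I (Complex (-1) t) (-1))" by simp
  have anti: "?F (1 - cnj s) = - cnj (?F s)" for s by (simp add: xi_log_deriv_reflect xi_log_deriv_cnj)
  have rev: "I b a = - I a b" if "closed_segment a b \<subseteq> path_image R" for a b
    unfolding I_def using contour_integral_reverse_linepath[OF cont[OF that]] by simp
  have c1: "1 - cnj ?m = ?m" "1 - cnj (Complex 2 t) = Complex (-1) t" "1 - cnj 2 = -1" by (simp_all add: complex_eq_iff)
  have "I ?m (Complex (-1) t) = - cnj (I (Complex 2 t) ?m)"
    using contour_integral_linepath_antireflect[of ?F ?m "Complex 2 t", OF anti] rev[OF segs'(1)] unfolding c1 I_def by simp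
  moreover have "I (Complex (-1) t) (-1) = - cnj (I 2 (Complex 2 t))"
    using contour_integral_linepath_antireflect[of ?F "Complex 2 t" 2, OF anti] rev[OF segs(2)] unfolding c1 I_def by simp
  moreover have "Im (I (-1) 2) = 0"
    unfolding I_def by (rule contour_integral_linepath_real) (simp_all add: xi_log_deriv_cnj)
  moreover have "Im (contour_integral R ?F) = 2 * pi * of_int N" unfolding RN by simp
  \<comment> \<open>With I the integral over the right half, the two halves contribute I - cnj I,
    whose imaginary part is twice that of I.\<close>
  ultimately have "Im (I 2 (Complex 2 t) + I (Complex 2 t) ?m) = pi * of_int N" unfolding parts by simp
  thus ?thesis unfolding N_def[symmetric] I_def using ci[OF segs(2)] ci[OF segs'(1)] by simp
qed

subsection \<open>The argument of zeta\<close>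

text \<open>The imaginary part of a continuous logarithm of p is a continuous argument. Its initial
  value is a multiple of 2 pi because p starts on the positive axis, so subtracting it gives the
  normalised argument.\<close>

lemma arg_along_winding_number:
  assumes p: "path p" "0 \<notin> path_image p" and p0: "Im (p 0) = 0" "Re (p 0) > 0"
  shows "arg_along p = 2 * pi * Re (winding_number p 0)"
proof -
  obtain q where q: "path q" "pathfinish q - pathstart q = 2 * of_real pi * \<i> * winding_number p 0"
      "\<And>x. x \<in> {0..1} \<Longrightarrow> p x = 0 + exp (q x)"
    using winding_number_as_continuous_log[OF p] by blast
  define g where "g = (\<lambda>x. Im (q x) - Im (q 0))"
  have pc: "p x = of_real (cmod (p x)) * cis (Im (q x))" if "x \<in> {0..1}" for x
    using q(3)[OF that] by (simp add: exp_eq_polar norm_mult)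
  have "p 0 = of_real (cmod (p 0))" using p0 by (simp add: complex_eq_iff cmod_eq_Re)
  moreover have "cmod (p 0) > 0" using p0 by auto
  ultimately have c0: "cis (Im (q 0)) = 1" using pc[of 0] by (metis atLeastAtMost_iff less_irrefl mult_cancel_left1 of_real_eq_0_iff order_refl zero_le_one)
  have cq: "continuous_on {0..1} q" using q(1) by (simp add: path_def)
  have G: "continuous_on {0..1} g \<and> g 0 = 0 \<and> (\<forall>x\<in>{0..1}. p x = of_real (cmod (p x)) * cis (g x))"
  proof (intro conjI ballI)
    show "continuous_on {0..1} g" unfolding g_def by (intro continuous_intros cq)
    show "p x = of_real (cmod (p x)) * cis (g x)" if "x \<in> {0..1}" for x
      using pc[OF that] c0 by (simp add: g_def flip: cis_divide)
  qed (simp add: g_def)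
  have g1: "g 1 = 2 * pi * Re (winding_number p 0)"
  proof -
    have "g 1 = Im (pathfinish q - pathstart q)" by (simp add: g_def pathfinish_def pathstart_def)
    thus ?thesis unfolding q(2) by simp
  qed
  show ?thesis unfolding arg_along_def
  proof (rule the_equality)
    show "\<exists>g. continuous_on {0..1} g \<and> g 0 = 0 \<and> g 1 = 2 * pi * Re (winding_number p 0) \<and> (\<forall>x\<in>{0..1}. p x = of_real (cmod (p x)) * cis (g x))"
      using G g1 by blast
    fix \<alpha> assume "\<exists>g. continuous_on {0..1} g \<and> g 0 = 0 \<and> g 1 = \<alpha> \<and> (\<forall>x\<in>{0..1}. p x = of_real (cmod (p x)) * cis (g x))"
    then obtain k where k: "continuous_on {0..1} k" "k 0 = 0" "k 1 = \<alpha>" "\<And>x. x \<in> {0..1} \<Longrightarrow> p x = of_real (cmod (p x)) * cis (k x)" by blast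
    have "k 1 - g 1 = k 0 - g 0"
    proof (rule sin_eq_zero_imp_const[where d = "\<lambda>x. k x - g x" and A = "{0..1}"])
      show "continuous_on {0..1} (\<lambda>x. k x - g x)" using k(1) G by (intro continuous_intros) auto
      fix x :: real assume x: "x \<in> {0..1}"
      have "p x \<noteq> 0" using p(2) x by (metis image_eqI path_image_def)
      moreover have "of_real (cmod (p x)) * cis (k x) = of_real (cmod (p x)) * cis (g x)" using k(4)[OF x] G x by metis
      ultimately have "cis (k x) = cis (g x)" by simp
      hence "cis (k x - g x) = 1" by (simp flip: cis_divide)
      thus "sin (k x - g x) = 0" by (simp add: complex_eq_iff)
    qed auto
    thus "\<alpha> = 2 * pi * Re (winding_number p 0)" using k G g1 by simp
  qed
qed

text \<open>\<open>ln_Gamma (s / 2) + Ln (s / 2)\<close> instead of \<open>ln_Gamma (s / 2 + 1)\<close> makes \<open>theta\<close> appear on the critical line.\<close>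
definition log_archimedean_factor :: "complex \<Rightarrow> complex" where
  "log_archimedean_factor s = Ln (s - 1) - s / 2 * of_real (ln pi) + ln_Gamma (s / 2) + Ln (s / 2)"

text \<open>The right half-plane without the real segment up to 1 and what lies below it: here
  \<open>Ln (s - 1)\<close> and \<open>ln_Gamma (s / 2)\<close> are holomorphic, and the path
  defining S stays inside.\<close>

definition slit_quadrant :: "complex set" where
  "slit_quadrant = {s. 0 < Re s} \<inter> ({s. 0 < Im s} \<union> {s. 1 < Re s})"

lemma open_slit_quadrant: "open slit_quadrant"
  unfolding slit_quadrant_def by (intro open_Int open_Un open_halfspace_Re_gt open_halfspace_Im_gt)

lemma exp_log_archimedean_factor:
  assumes "s \<in> slit_quadrant" shows "exp (log_archimedean_factor s) = archimedean_factor s"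
proof -
  have s: "s \<noteq> 0" "s \<noteq> 1" "s / 2 \<notin> \<int>\<^sub>\<le>\<^sub>0"
    using assms not_nonpos_Int_half[of "s - 2"] by (auto simp: slit_quadrant_def diff_divide_distrib)
  have "exp (ln_Gamma (s / 2)) = Gamma (s / 2)" using s(3) by (simp add: Gamma_complex_altdef)
  moreover have "exp (s / 2 * of_real (ln pi)) = of_real pi powr (s / 2)" by (simp add: powr_def Ln_of_real)
  ultimately have "exp (log_archimedean_factor s) = (s - 1) / of_real pi powr (s / 2) * (Gamma (s / 2) * (s / 2))"
    using s(1,2) unfolding log_archimedean_factor_def exp_add exp_diff by simp
  also have "Gamma (s / 2) * (s / 2) = Gamma (s / 2 + 1)" using Gamma_plus1[OF s(3)] by simp
  finally show ?thesis by (simp only: archimedean_factor_def powr_minus divide_inverse)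
qed

lemma log_archimedean_factor_holomorphic: "log_archimedean_factor holomorphic_on slit_quadrant"
  unfolding log_archimedean_factor_def[abs_def]
  by (intro holomorphic_intros holomorphic_on_compose[OF _ holomorphic_ln_Gamma, unfolded o_def])
     (auto simp: slit_quadrant_def complex_nonpos_Reals_iff)

text \<open>Since s - 1 = -cnj s on the critical line, the arguments of s - 1 and s add up to pi.
  This is the origin of the summand -1 in the formula for S.\<close>

lemma Im_log_archimedean_factor_line:
  assumes "t > 0"
  shows "Im (log_archimedean_factor (Complex (1/2) t)) = pi + theta t"
proof -
  let ?s = "Complex (1/2) t"
  have "?s - 1 = - cnj ?s" by (simp add: complex_eq_iff)
  moreover have "Ln (- cnj ?s) = Ln (cnj ?s) + \<i> * of_real pi"
    using assms by (subst Ln_minus) (auto simp: complex_eq_iff)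
  moreover have "Ln (cnj ?s) = cnj (Ln ?s)" by (rule cnj_Ln[symmetric]) (simp add: complex_nonpos_Reals_iff)
  moreover have "Im (Ln (?s / of_real 2)) = Im (Ln ?s)"
    by (subst Ln_divide_of_real) (auto simp: complex_eq_iff)
  ultimately have "Im (Ln (?s - 1)) + Im (Ln (?s / 2)) = pi" by simp
  moreover have "?s / 2 = Complex (1/4) (t/2)" by (simp add: complex_eq_iff)
  ultimately show ?thesis by (simp add: log_archimedean_factor_def theta_def)
qed

lemma xi_log_deriv_eq:
  assumes "s \<in> slit_quadrant" "zeta s \<noteq> 0"
  shows "xi_log_deriv s = deriv zeta s / zeta s + deriv log_archimedean_factor s"
proof -
  have s1: "s \<noteq> 1" using assms by (auto simp: slit_quadrant_def)
  let ?L = log_archimedean_factor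
  have xi: "xi w = zeta w * exp (?L w)" if "w \<in> slit_quadrant" for w
  proof -
    have "w \<noteq> 1" "w / 2 + 1 \<notin> \<int>\<^sub>\<le>\<^sub>0" using that by (auto simp: slit_quadrant_def intro!: not_nonpos_Int_half)
    thus ?thesis using xi_eq_zeta exp_log_archimedean_factor[OF that] by simp
  qed
  have "(zeta has_field_derivative deriv zeta s) (at s)"
    by (rule holomorphic_derivI[OF zeta_holomorphic]) (use s1 in auto)
  moreover have "(?L has_field_derivative deriv ?L s) (at s)"
    by (rule holomorphic_derivI[OF log_archimedean_factor_holomorphic open_slit_quadrant assms(1)])
  hence "((\<lambda>w. exp (?L w)) has_field_derivative exp (?L s) * deriv ?L s) (at s)" by (rule DERIV_fun_exp)
  ultimately have "((\<lambda>w. zeta w * exp (?L w)) has_field_derivative deriv zeta s * exp (?L s) + exp (?L s) * deriv ?L s * zeta s) (at s)"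
    by (rule DERIV_mult)
  hence "(xi has_field_derivative deriv zeta s * exp (?L s) + exp (?L s) * deriv ?L s * zeta s) (at s)"
    by (rule has_field_derivative_transform_within_open[OF _ open_slit_quadrant assms(1)]) (simp add: xi)
  hence "deriv xi s = deriv zeta s * exp (?L s) + exp (?L s) * deriv ?L s * zeta s" by (rule DERIV_imp_deriv)
  thus ?thesis using assms(2) by (simp add: xi_log_deriv_def xi[OF assms(1)] field_simps)
qed

section \<open>Zeros of zeta and of xi above the real axis, and the formula for S\<close>

lemma zeta_upper_zero_iff: "Im s > 0 \<Longrightarrow> zeta s = 0 \<longleftrightarrow> xi s = 0"
  using xi_eq_zeta[of s] archimedean_factor_nonzero[of s] not_nonpos_Int_half[of s] by (cases "s = 1") auto

lemma zorder_zeta_upper: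
  assumes "Im s > 0" shows "zorder xi s = zorder zeta s"
proof -
  let ?U = "{w. Im w > 0}"
  have U: "open ?U" "s \<in> ?U" using assms by (auto intro: open_halfspace_Im_gt)
  have nz: "w \<noteq> 1" "w / 2 + 1 \<notin> \<int>\<^sub>\<le>\<^sub>0" if "w \<in> ?U" for w
    using that by (auto intro!: not_nonpos_Int_half)
  have xi: "xi w = zeta w * archimedean_factor w" if "w \<in> ?U" for w using xi_eq_zeta nz that by blast
  have ah: "archimedean_factor holomorphic_on ?U"
    unfolding archimedean_factor_def[abs_def]
    by (intro holomorphic_intros) (use nz in auto)
  have A: "zeta analytic_on {s}" "archimedean_factor analytic_on {s}"
    using U ah holomorphic_on_subset[OF zeta_holomorphic, of ?U] by (auto simp: analytic_at)
  have ev: "\<forall>\<^sub>F w in at s. w \<in> ?U" using U eventually_at_in_open' by blast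
  have "\<forall>\<^sub>F w in at s. xi w \<noteq> 0"
  proof (rule ccontr)
    assume "\<not> ?thesis"
    hence "s islimpt {w. xi w = 0}" unfolding islimpt_def eventually_at_topological by blast
    hence "xi 2 = 0"
      by (intro analytic_continuation[of xi UNIV "{s. xi s = 0}" s 2] xi_holomorphic) (simp_all add: convex_connected)
    moreover have "xi 2 \<noteq> 0" by (rule xi_nonzero_outside) simp
    ultimately show False by contradiction
  qed
  hence "\<forall>\<^sub>F w in at s. zeta w * archimedean_factor w \<noteq> 0" using ev by eventually_elim (simp add: xi)
  hence "zorder (\<lambda>w. zeta w * archimedean_factor w) s = zorder zeta s + zorder archimedean_factor s"
    by (rule zorder_times_analytic[OF A])
  moreover have "zorder archimedean_factor s = 0"
    by (rule zorder_eq_0I[OF A(2)]) (rule archimedean_factor_nonzero[OF nz[OF U(2)]])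
  moreover have "zorder xi s = zorder (\<lambda>w. zeta w * archimedean_factor w) s"
    using ev by (intro zorder_cong) (auto elim!: eventually_mono simp: xi)
  ultimately show ?thesis by simp
qed

lemma zero_count_eq_xi: "zero_count t = (\<Sum>s | xi s = 0 \<and> 0 < Im s \<and> Im s \<le> t. zorder xi s)"
  unfolding zero_count_def by (rule sum.cong) (auto simp: zeta_upper_zero_iff zorder_zeta_upper)

text \<open>The winding number of the image path is the integral of zeta' / zeta, that is of the
  logarithmic derivative of xi minus that of the archimedean factor. The first is given by the
  argument principle, the second by the explicit primitive.\<close>

lemma S_generic_eq:
  assumes t: "t > 0" and nz: "\<And>s. Im s = t \<Longrightarrow> zeta s \<noteq> 0"
  shows "S_generic t = of_int (zero_count t) - 1 - theta t / pi"
proof -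
  let ?g = "linepath 2 (Complex 2 t) +++ linepath (Complex 2 t) (Complex (1/2) t)"
  let ?L = log_archimedean_factor
  have img: "Re z = 2 \<and> 0 \<le> Im z \<or> Im z = t \<and> 1/2 \<le> Re z" if "z \<in> path_image ?g" for z
  proof -
    have "closed_segment 2 (Complex 2 t) \<subseteq> {z. Re z = 2 \<and> 0 \<le> Im z}"
      using t by (auto simp: closed_segment_def)
    moreover have "closed_segment (Complex 2 t) (Complex (1/2) t) \<subseteq> {z. Im z = t \<and> 1/2 \<le> Re z}"
      by (auto simp: closed_segment_def left_diff_distrib)
    ultimately show ?thesis using that by (auto simp: path_image_join)
  qed
  have zz: "zeta z \<noteq> 0" if "z \<in> path_image ?g" for z
    using img[OF that] nz[of z] zeta_right_half_plane[of z] by auto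
  have D: "path_image ?g \<subseteq> slit_quadrant" using img t by (force simp: slit_quadrant_def)
  have n1: "path_image ?g \<subseteq> - {1}" using img t by force
  have vp: "valid_path ?g" by (intro valid_path_join) auto
  have za: "zeta analytic_on - {1}" by (subst analytic_on_open) (auto intro: zeta_holomorphic)
  define p where "p = zeta \<circ> ?g"
  have vpp: "valid_path p" unfolding p_def
    by (rule valid_path_compose_holomorphic[OF vp zeta_holomorphic _ n1]) auto
  have p0: "0 \<notin> path_image p" unfolding p_def path_image_compose using zz by force
  have start: "p 0 = zeta 2" by (simp add: p_def joinpaths_def linepath_def)
  have "Im (zeta 2) = 0" using zeta_cnj[of 2] by (simp add: complex_eq_iff)
  hence "arg_along p = 2 * pi * Re (winding_number p 0)"
    using arg_along_winding_number[OF valid_path_imp_path[OF vpp] p0] zeta_right_half_plane[of 2] start by simp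
  also have "winding_number p 0 = 1 / (2 * pi * \<i>) * contour_integral p (\<lambda>w. 1 / (w - 0))"
    by (rule winding_number_valid_path[OF vpp p0])
  also have "contour_integral p (\<lambda>w. 1 / (w - 0)) = contour_integral ?g (\<lambda>w. deriv zeta w * (1 / (zeta w - 0)))"
    unfolding p_def by (rule contour_integral_comp_analyticW[OF za vp n1])
  also have "\<dots> = contour_integral ?g (\<lambda>w. xi_log_deriv w - deriv ?L w)"
    by (rule contour_integral_eq) (use D zz xi_log_deriv_eq in force)
  also have "\<dots> = contour_integral ?g xi_log_deriv - (?L (Complex (1/2) t) - ?L 2)"
  proof -
    have xz: "xi z \<noteq> 0" if "z \<in> path_image ?g" for z
      using img[OF that] xi_nonzero_outside[of z] zeta_upper_zero_iff[of z] nz[of z] t by auto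
    have "continuous_on (path_image ?g) xi_log_deriv"
      by (intro holomorphic_on_imp_continuous_on xi_log_deriv_holomorphic xz)
    hence "xi_log_deriv contour_integrable_on ?g"
      by (auto simp: path_image_join intro!: contour_integrable_joinI contour_integrable_continuous_linepath elim: continuous_on_subset)
    moreover have "(deriv ?L has_contour_integral ?L (pathfinish ?g) - ?L (pathstart ?g)) ?g"
      using log_archimedean_factor_holomorphic open_slit_quadrant vp D
      by (intro contour_integral_primitive[where S = slit_quadrant]) (auto intro: DERIV_subset holomorphic_derivI)
    ultimately have "((\<lambda>w. xi_log_deriv w - deriv ?L w) has_contour_integral
        contour_integral ?g xi_log_deriv - (?L (pathfinish ?g) - ?L (pathstart ?g))) ?g"
      by (intro has_contour_integral_diff has_contour_integral_integral)
    thus ?thesis by (simp only: contour_integral_unique pathfinish_join pathstart_join pathfinish_linepath pathstart_linepath)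
  qed
  finally have "arg_along p = 2 * pi * Re (1 / (2 * pi * \<i>) * (contour_integral ?g xi_log_deriv - (?L (Complex (1/2) t) - ?L 2)))" .
  moreover have "2 * pi * Re (1 / (2 * pi * \<i>) * w) = Im w" for w
    by (simp add: Re_divide power2_eq_square)
  ultimately have "arg_along p = Im (contour_integral ?g xi_log_deriv) - (Im (?L (Complex (1/2) t)) - Im (?L 2))"
    by (simp only: minus_complex.sel)
  moreover have "Im (contour_integral ?g xi_log_deriv) = pi * of_int (zero_count t)"
    unfolding zero_count_eq_xi by (rule xi_argument_principle[OF t]) (use nz t zeta_upper_zero_iff in auto)
  moreover have "Im (?L 2) = 0"
    using ln_Gamma_complex_of_real[of 1] by (simp add: log_archimedean_factor_def)
  ultimately have "arg_along p = pi * of_int (zero_count t) - (pi + theta t)"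
    unfolding Im_log_archimedean_factor_line[OF t] by simp
  thus ?thesis unfolding S_generic_def p_def[symmetric] by (simp add: field_simps)
qed

text \<open>Ordinates of zeros are isolated, so just to the right of t there is none and
  \<open>zero_count\<close> keeps its value at t; continuity of \<open>theta\<close> then gives the
  right-hand limit.\<close>

lemma S_eq:
  assumes t: "t > 0"
  shows "S t = of_int (zero_count t) - 1 - theta t / pi"
proof (cases "\<exists>s. zeta s = 0 \<and> Im s = t")
  case False
  thus ?thesis unfolding S_def using S_generic_eq[OF t] by auto
next
  case True
  let ?A = "\<lambda>u. {s. xi s = 0 \<and> 0 < Im s \<and> Im s \<le> u}"
  obtain d where d: "d > 0" "\<And>y. y \<in> Im ` ?A (t + 1) \<Longrightarrow> y \<noteq> t \<Longrightarrow> d \<le> dist t y"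
    using finite_set_avoid[OF finite_imageI[OF xi_zero_upper_strip_finite, of Im "t + 1"], of t] by blast
  have near: "S_generic u = of_int (zero_count t) - 1 - theta u / pi" if u: "t < u" "u < t + min d 1" for u
  proof -
    have gap: "xi s \<noteq> 0" if "t < Im s" "Im s \<le> u" for s
    proof
      assume "xi s = 0"
      hence "Im s \<in> Im ` ?A (t + 1)" using that u t by auto
      thus False using d(2)[of "Im s"] that u by (simp add: dist_real_def)
    qed
    have "?A u = ?A t" using gap u by force
    hence "zero_count u = zero_count t" unfolding zero_count_eq_xi by simp
    moreover have "zeta s \<noteq> 0" if "Im s = u" for s using gap[of s] zeta_upper_zero_iff[of s] that u t by auto
    ultimately show ?thesis using S_generic_eq[of u] u t by auto
  qed
  have "((\<lambda>u. of_int (zero_count t) - 1 - theta u / pi) \<longlongrightarrow> of_int (zero_count t) - 1 - theta t / pi) (at_right t)"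
    using real_analytic_isCont[OF real_analytic_theta, of t]
    by (intro tendsto_intros) (auto simp: isCont_def intro: tendsto_within_subset)
  moreover have "\<forall>\<^sub>F u in at_right t. of_int (zero_count t) - 1 - theta u / pi = S_generic u"
    by (rule eventually_at_rightI[of t "t + min d 1"]) (use near d(1) in auto)
  ultimately have "(S_generic \<longlongrightarrow> of_int (zero_count t) - 1 - theta t / pi) (at_right t)"
    by (rule Lim_transform_eventually)
  hence "Lim (at_right t) S_generic = of_int (zero_count t) - 1 - theta t / pi"
    by (intro tendsto_Lim) auto
  thus ?thesis unfolding S_def using True by simp
qed

theorem proposition44:
  fixes t :: real
  assumes "t > a_theta"
  shows "- 1/2 + real_of_int (RH t) < S t + 1 / pi * E t \<and>
         S t + 1 / pi * E t \<le> 1/2 + real_of_int (RH t)"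
proof -
  obtain h \<rho> where h: "real_analytic h" "real_analytic \<rho>" "h 0 = 0" "\<And>t. P_line t = \<rho> t * cos (h t)"
      "\<And>t. deriv Z t = \<rho> t * sin (h t)" "ph_zeta' = (\<lambda>t. pi - theta t + h t)"
    by (rule ph_zeta'_exists, rule that)
  have t0: "t > 0" using assms a_theta_props by simp
  define n where "n = card {\<xi>. 0 < \<xi> \<and> \<xi> \<le> t \<and> Z \<xi> = 0}"
  have "critical_zero_count t = n" unfolding critical_zero_count_def n_def zeta_line_zero_iff ..
  hence RH: "of_int (RH t) = of_int (zero_count t) - real n" by (simp add: RH_def)
  \<comment> \<open>The 2 is the sum of the pi in E and the initial value pi of the phase, each
    divided by pi; of 2 theta, one theta cancels against the phase and the other against S.\<close>
  have "1 / pi * E t = 2 + theta t / pi + h t / pi"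
    unfolding E_def rs_theta_eq h(6) by (simp add: add_divide_distrib diff_divide_distrib)
  hence "S t + 1 / pi * E t = of_int (zero_count t) + 1 + h t / pi"
    unfolding S_eq[OF t0] by simp
  moreover have "- 3/2 - real n < h t / pi" "h t / pi \<le> - 1/2 - real n"
    unfolding n_def using phase_bounds[OF h(1,4,5,3) less_imp_le[OF assms]] by blast+
  ultimately show ?thesis unfolding RH by simp
qed

end
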